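(* For all sufficiently large $n$ the following holds. Let $K\subset\mathbb{R}^n$ be a bounded closed centrally-symmetric convex body and let $k$ be a positive integer. Then $$\chi(\mathbb{R}_{K}^n) \leq (1 + \gamma(K, k))^n\Big[n\ln n+n\ln \ln n+2\ln k+2n\big(1+\ln (2 \gamma(K, k))\big)\Big].$$ In particular, if $K_n\subset\mathbb{R}^n$ is a sequence of such bodies and $k_n$ is a sequence of positive integers such that $k_n\leq n^{cn}$ for some absolute constant $c$, then $$\chi(\mathbb{R}_{K_n}^n) \leq (1 + \gamma(K_n, k_n)+o(1))^n \quad (n\to\infty).$$
   Context: For a bounded closed convex body $K\subset\mathbb{R}^n$ centrally symmetric about the origin, $\mathbb{R}^n_K$ denotes $\mathbb{R}^n$ with the norm whose unit ball is $K$ (i.e. $\|x\|_K=\inf\{t>0: x\in tK\}$), and $\chi(\mathbb{R}^n_K)$ is the chromatic number of this normed space: the smallest number of colors needed to color all points of $\mathbb{R}^n$ so that any two points at $\|\cdot\|_K$-distance exactly $1$ receive different colors. Let $\Omega$ be a lattice in $\mathbb{R}^n$. A multilattice is a set $\Phi=\bigcup_{i=1}^{k}(\Omega+x_i)$ for finitely many vectors $x_1,\dots,x_k$; $q(\Phi)$ denotes the number $k$ of translates of $\Omega$ in $\Phi$. A tiling $\Psi$ of $\mathbb{R}^n$ by convex polytopes is associated with $\Phi$ if there is a bijection $x\mapsto\psi_x$ between the points of $\Phi$ and the polytopes of $\Psi$ such that each $x$ lies in the interior of $\psi_x$. The tiling parameter is $$\gamma(K,\Phi,\Psi)=\inf\{\beta/\alpha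 : \alpha K+x\subset\psi_x\subset\beta K+x \text{ for all } x\in\Phi\},$$ and $\gamma(K,k)=\inf\gamma(K,\Phi,\Psi)$, the infimum over all multilattices $\Phi$ with $q(\Phi)\le k$ and all tilings $\Psi$ associated with them. *)

theory Defs
  imports "HOL-Analysis.Analysis" "HOL-Analysis.Finite_Function_Topology"
begin

text \<open>
  The dimension is quantified inside the statement, so it cannot be a type. The space
  \<open>\<real>\<^sup>n\<close> is the \<open>n\<close>-dimensional subspace of the normed space of finitely supported real
  sequences spanned by the first \<open>n\<close> unit vectors. The norm of the ambient type is the
  sum of the absolute values of the coordinates; on this subspace it induces the usual
  topology and the usual bounded sets.
\<close>

type_synonym rvec = "nat \<Rightarrow>\<^sub>0 real"

definition Rn :: "nat \<Rightarrow> rvec set" where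
  "Rn n = {x. Poly_Mapping.keys x \<subseteq> {..<n}}"

text \<open>Interiors have to be taken relative to \<^term>\<open>Rn n\<close>, which has empty interior in the
  ambient type.\<close>

definition Rn_interior :: "nat \<Rightarrow> rvec set \<Rightarrow> rvec set" where
  "Rn_interior n S = top_of_set (Rn n) interior_of S"

definition symmetric_convex_body :: "nat \<Rightarrow> rvec set \<Rightarrow> bool" where
  "symmetric_convex_body n K \<longleftrightarrow>
     K \<subseteq> Rn n \<and> closed K \<and> bounded K \<and> convex K \<and> Rn_interior n K \<noteq> {} \<and> uminus ` K = K"

definition body_norm :: "rvec set \<Rightarrow> rvec \<Rightarrow> real" where
  "body_norm K x = Inf {t. 0 < t \<and> x \<in> (\<lambda>y. t *\<^sub>R y) ` K}"

definition proper_coloring :: "nat \<Rightarrow> rvec set \<Rightarrow> nat \<Rightarrow> (rvec \<Rightarrow> nat) \<Rightarrow> bool" where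
  "proper_coloring n K m c \<longleftrightarrow>
     c ` Rn n \<subseteq> {..<m} \<and>
     (\<forall>x\<in>Rn n. \<forall>y\<in>Rn n. body_norm K (x - y) = 1 \<longrightarrow> c x \<noteq> c y)"

text \<open>The value is \<open>\<infinity>\<close> if no finite number of colours suffices.\<close>

definition chromatic_number :: "nat \<Rightarrow> rvec set \<Rightarrow> enat" where
  "chromatic_number n K = Inf {enat m | m. \<exists>c. proper_coloring n K m c}"

definition is_lattice :: "nat \<Rightarrow> rvec set \<Rightarrow> bool" where
  "is_lattice n \<Omega> \<longleftrightarrow>
     (\<exists>B. finite B \<and> independent B \<and> span B = Rn n \<and>
          \<Omega> = {(\<Sum>b\<in>B. of_int (z b) *\<^sub>R b) | z :: rvec \<Rightarrow> int. True})"

definition is_multilattice :: "nat \<Rightarrow> rvec set \<Rightarrow> rvec set \<Rightarrow> bool" where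
  "is_multilattice n \<Omega> \<Phi> \<longleftrightarrow>
     is_lattice n \<Omega> \<and>
     (\<exists>X. finite X \<and> X \<noteq> {} \<and> X \<subseteq> Rn n \<and> \<Phi> = (\<Union>x\<in>X. (+) x ` \<Omega>))"

text \<open>The number \<open>q(\<Phi>)\<close> of distinct translates of \<open>\<Omega>\<close> that make up \<open>\<Phi>\<close>.\<close>

definition num_translates :: "rvec set \<Rightarrow> rvec set \<Rightarrow> nat" where
  "num_translates \<Omega> \<Phi> = card ((\<lambda>x. (+) x ` \<Omega>) ` \<Phi>)"

definition is_polytope_tiling :: "nat \<Rightarrow> rvec set set \<Rightarrow> bool" where
  "is_polytope_tiling n \<Psi> \<longleftrightarrow>
     (\<forall>P\<in>\<Psi>. polytope P \<and> Rn_interior n P \<noteq> {}) \<and>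
     \<Union>\<Psi> = Rn n \<and>
     pairwise (\<lambda>P Q. Rn_interior n P \<inter> Rn_interior n Q = {}) \<Psi>"

definition associated_via ::
    "nat \<Rightarrow> rvec set \<Rightarrow> rvec set set \<Rightarrow> (rvec \<Rightarrow> rvec set) \<Rightarrow> bool" where
  "associated_via n \<Phi> \<Psi> \<psi> \<longleftrightarrow> bij_betw \<psi> \<Phi> \<Psi> \<and> (\<forall>x\<in>\<Phi>. x \<in> Rn_interior n (\<psi> x))"

definition associated :: "nat \<Rightarrow> rvec set \<Rightarrow> rvec set set \<Rightarrow> bool" where
  "associated n \<Phi> \<Psi> \<longleftrightarrow> is_polytope_tiling n \<Psi> \<and> (\<exists>\<psi>. associated_via n \<Phi> \<Psi> \<psi>)"

text \<open>The tiles of a tiling have disjoint interiors, so the bijection \<open>\<psi>\<close> below is determined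
  on \<open>\<Phi>\<close> by \<open>\<Phi>\<close> and \<open>\<Psi>\<close>. The infimum is taken in the extended reals: it is \<open>\<infinity>\<close> if no pair
  \<open>\<alpha>, \<beta>\<close> is admissible.\<close>

definition tiling_parameter :: "nat \<Rightarrow> rvec set \<Rightarrow> rvec set \<Rightarrow> rvec set set \<Rightarrow> ereal" where
  "tiling_parameter n K \<Phi> \<Psi> =
     Inf {ereal (\<beta> / \<alpha>) | \<alpha> \<beta> \<psi>.
            0 < \<alpha> \<and> 0 < \<beta> \<and> associated_via n \<Phi> \<Psi> \<psi> \<and>
            (\<forall>x\<in>\<Phi>. (\<lambda>y. \<alpha> *\<^sub>R y + x) ` K \<subseteq> \<psi> x \<and> \<psi> x \<subseteq> (\<lambda>y. \<beta> *\<^sub>R y + x) ` K)}"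

definition min_tiling_parameter :: "nat \<Rightarrow> rvec set \<Rightarrow> nat \<Rightarrow> ereal" where
  "min_tiling_parameter n K k =
     Inf {tiling_parameter n K \<Phi> \<Psi> | \<Omega> \<Phi> \<Psi>.
            is_multilattice n \<Omega> \<Phi> \<and> num_translates \<Omega> \<Phi> \<le> k \<and> associated n \<Phi> \<Psi>}"

text \<open>For a symmetric convex body and \<open>k \<ge> 1\<close> the infimum above is a real number that is at
  least 1 (the integer lattice with its tiling by unit cubes has a finite parameter), so the
  conversion loses nothing.\<close>

definition tiling_gamma :: "nat \<Rightarrow> rvec set \<Rightarrow> nat \<Rightarrow> real" where
  "tiling_gamma n K k = real_of_ereal (min_tiling_parameter n K k)"

end

theory Submission
  imports Defs "HOL-Real_Asymp.Real_Asymp"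
begin

text \<open>
  Shrink every tile of a tiling with ratio \<open>\<gamma>\<close> about its centre by the factor \<open>1 / (1 + \<gamma>)\<close>. After
  rescaling, the union \<open>S\<close> of the shrunk tiles avoids the distance 1 and has density
  \<open>(1 + \<gamma>)\<^sup>-\<^sup>n\<close>, so the task is to cover the space by few translates of such sets.

  The tiles of a multilattice may be arranged non-periodically. The tiling is therefore cut off at a
  large box and repeated periodically; the box has to be so large that a union bound over a net of
  the box would cost \<open>2 n ln n\<close> instead of \<open>n ln n\<close>. The union bound is only used to guarantee
  that no unit ball contains many uncovered net points that are pairwise weakly correlated, where
  the correlation of \<open>p\<close> and \<open>q\<close> is the probability that a random translate of \<open>S\<close> contains both.
  All other uncovered net points are strongly correlated with one of a few points \<open>p\<close>, and then
  random translates of \<open>S\<close> through \<open>p\<close> cover them quickly. Hence polynomially many further colours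
  suffice in each unit ball. Finally the space is covered by \<open>(5 (1 + \<gamma>) / 6)\<^sup>n\<close>, up to a polynomial
  factor, families of cells that lie in unit balls and are more than 1 apart, which come from the
  same tiling at a larger scale; the additional colours are negligible. All this needs \<open>\<gamma> \<le> 8\<close>;
  for larger \<open>\<gamma>\<close> a greedy colouring of a separated net with \<open>9\<^sup>n\<close> colours is good enough.
\<close>

section \<open>Lebesgue measure on the coordinate space\<close>

abbreviation coord :: "rvec \<Rightarrow> nat \<Rightarrow> real" where
  "coord \<equiv> Poly_Mapping.lookup"

abbreviation unit_vec :: "nat \<Rightarrow> rvec" where
  "unit_vec i \<equiv> Poly_Mapping.single i 1"

lemma coord_scaleR [simp]: "coord (r *\<^sub>R x) i = r * coord x i"
  by (simp add: scaleR_poly_mapping_def)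

lemma coord_unit_vec: "coord (unit_vec i) j = (if i = j then 1 else 0)"
  by (simp add: lookup_single when_def)

lemma mem_Rn: "x \<in> Rn n \<longleftrightarrow> (\<forall>i\<ge>n. coord x i = 0)"
  by (auto simp: Rn_def subset_iff in_keys_iff) (meson linorder_not_less)

lemma Rn_eqI: "x \<in> Rn n \<Longrightarrow> y \<in> Rn n \<Longrightarrow> (\<And>i. i < n \<Longrightarrow> coord x i = coord y i) \<Longrightarrow> x = y"
  by (rule poly_mapping_eqI) (metis mem_Rn linorder_not_less)

lemma subspace_Rn: "subspace (Rn n)"
  by (simp add: subspace_def mem_Rn lookup_add)

lemmas Rn_zero [simp] = subspace_0[OF subspace_Rn]
  and Rn_add [simp] = subspace_add[OF subspace_Rn]
  and Rn_diff [simp] = subspace_diff[OF subspace_Rn]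
  and Rn_uminus [simp] = subspace_neg[OF subspace_Rn]
  and Rn_scaleR [simp] = subspace_scale[OF subspace_Rn]
  and Rn_sum [intro] = subspace_sum[OF subspace_Rn]

lemma unit_vec_Rn: "i < n \<Longrightarrow> unit_vec i \<in> Rn n"
  by (auto simp: mem_Rn coord_unit_vec)

lemma coord_sum: "coord (\<Sum>i\<in>I. f i) j = (\<Sum>i\<in>I. coord (f i) j)"
  by (induction I rule: infinite_finite_induct) (auto simp: lookup_add)

definition of_coords :: "nat \<Rightarrow> (nat \<Rightarrow> real) \<Rightarrow> rvec" where
  "of_coords n f = (\<Sum>i<n. f i *\<^sub>R unit_vec i)"

lemma coord_of_coords: "coord (of_coords n f) j = (if j < n then f j else 0)"
  by (auto simp: of_coords_def coord_sum coord_unit_vec if_distrib[of "(*) _"] cong: if_cong)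

lemma of_coords_Rn [simp]: "of_coords n f \<in> Rn n"
  by (simp add: mem_Rn coord_of_coords)

lemma of_coords_coord: "x \<in> Rn n \<Longrightarrow> of_coords n (coord x) = x"
  by (rule Rn_eqI) (auto simp: coord_of_coords)

lemma norm_rvec: "norm (x::rvec) = (\<Sum>i\<in>Poly_Mapping.keys x. \<bar>coord x i\<bar>)"
  by (simp add: norm_poly_mapping_def dist_poly_mapping_def)

lemma norm_unit_vec: "norm (unit_vec i) = 1"
  by (simp add: norm_rvec)

lemma norm_Rn: "x \<in> Rn n \<Longrightarrow> norm x = (\<Sum>i<n. \<bar>coord x i\<bar>)"
  unfolding norm_rvec
  by (rule sum.mono_neutral_left) (auto simp: Rn_def in_keys_iff)

lemma sum_coord_le_norm: "(\<Sum>i<n. \<bar>coord x i\<bar>) \<le> norm (x::rvec)"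
proof -
  have "(\<Sum>i<n. \<bar>coord x i\<bar>) = (\<Sum>i\<in>{..<n} \<inter> Poly_Mapping.keys x. \<bar>coord x i\<bar>)"
    by (rule sum.mono_neutral_right) (auto simp: in_keys_iff)
  also have "\<dots> \<le> norm x"
    unfolding norm_rvec by (rule sum_mono2) auto
  finally show ?thesis .
qed

lemma abs_coord_le_norm: "\<bar>coord x i\<bar> \<le> norm x"
proof -
  have "\<bar>coord x i\<bar> \<le> (\<Sum>j<Suc i. \<bar>coord x j\<bar>)"
    by (rule member_le_sum) auto
  then show ?thesis
    using sum_coord_le_norm order_trans by blast
qed

lemma continuous_on_coord [continuous_intros]: "continuous_on A (\<lambda>x. coord x i)"
proof -
  have "bounded_linear (\<lambda>x. coord x i)"
    by (rule bounded_linear_intro[where K = 1])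
       (auto simp: lookup_add abs_coord_le_norm)
  then show ?thesis
    by (rule linear_continuous_on)
qed

lemma closed_Rn: "closed (Rn n)"
proof -
  have "Rn n = (\<Inter>i\<in>{n..}. {x. coord x i = 0})"
    by (auto simp: mem_Rn)
  moreover have "closed {x. coord x i = 0}" for i
    by (intro closed_Collect_eq continuous_intros)
  ultimately show ?thesis
    by auto
qed

lemma linear_continuous_on_Rn:
  fixes f :: "rvec \<Rightarrow> 'b :: real_normed_vector"
  assumes "linear f"
  shows "continuous_on (Rn n) f"
proof -
  have "f x = (\<Sum>i<n. coord x i *\<^sub>R f (unit_vec i))" if "x \<in> Rn n" for x
  proof -
    have "f x = f (of_coords n (coord x))"
      using that by (simp add: of_coords_coord)
    also have "\<dots> = (\<Sum>i<n. coord x i *\<^sub>R f (unit_vec i))"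
      using assms by (simp add: of_coords_def linear_sum linear_scale)
    finally show ?thesis .
  qed
  moreover have "continuous_on (Rn n) (\<lambda>x. \<Sum>i<n. coord x i *\<^sub>R f (unit_vec i))"
    by (intro continuous_intros)
  ultimately show ?thesis
    by (simp cong: continuous_on_cong)
qed

definition coord_lborel :: "nat \<Rightarrow> (nat \<Rightarrow> real) measure" where
  "coord_lborel n = Pi\<^sub>M {..<n} (\<lambda>_. lborel)"

definition vol :: "nat \<Rightarrow> rvec measure" where
  "vol n = distr (coord_lborel n) borel (of_coords n)"

lemma continuous_on_of_coords: "continuous_on UNIV (of_coords n)"
  unfolding of_coords_def by (intro continuous_intros continuous_on_product_coordinates)

lemma measurable_of_coords [measurable]: "of_coords n \<in> measurable (coord_lborel n) borel"
proof -
  define g where "g = (\<lambda>f i. if i < n then f i else 0 :: real)"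
  have "g \<in> borel_measurable (coord_lborel n)"
    unfolding g_def coord_lborel_def
  proof (rule measurable_coordinatewise_then_product)
    show "(\<lambda>f. if i < n then f i else 0) \<in> borel_measurable (Pi\<^sub>M {..<n} (\<lambda>_. lborel))" for i
    proof (cases "i < n")
      case True
      then have "(\<lambda>f. f i) \<in> measurable (Pi\<^sub>M {..<n} (\<lambda>_. lborel)) (lborel :: real measure)"
        by (intro measurable_component_singleton) auto
      with True show ?thesis
        by simp
    qed simp
  qed
  moreover have "of_coords n \<in> borel_measurable borel"
    by (rule borel_measurable_continuous_onI[OF continuous_on_of_coords])
  ultimately have "of_coords n \<circ> g \<in> measurable (coord_lborel n) borel"
    by (rule measurable_comp)
  moreover have "of_coords n \<circ> g = of_coords n"
    by (auto simp: of_coords_def g_def)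
  ultimately show ?thesis
    by simp
qed

lemma sets_vol [simp, measurable_cong]: "sets (vol n) = sets borel"
  and space_vol [simp]: "space (vol n) = UNIV"
  by (auto simp: vol_def)

lemma emeasure_lborel_affine:
  assumes "c > 0" "A \<in> sets borel"
  shows "ennreal c * emeasure lborel {x. t + c * x \<in> A} = emeasure lborel (A :: real set)"
proof -
  have "emeasure lborel A = emeasure (density (distr lborel borel (\<lambda>x. t + c * x)) (\<lambda>_. ennreal \<bar>c\<bar>)) A"
    using assms by (subst lborel_real_affine[of c t]) auto
  also have "\<dots> = ennreal c * emeasure (distr lborel borel (\<lambda>x. t + c * x)) A"
    using assms by (subst emeasure_density_const) auto
  also have "emeasure (distr lborel borel (\<lambda>x. t + c * x)) A = emeasure lborel {x. t + c * x \<in> A}"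
    using assms by (subst emeasure_distr) (auto simp: vimage_def)
  finally show ?thesis ..
qed

lemma coord_lborel_affine:
  assumes "c > 0"
  shows "scale_measure (ennreal (c ^ n))
           (distr (coord_lborel n) (coord_lborel n) (\<lambda>f. \<lambda>i\<in>{..<n}. t i + c * f i)) = coord_lborel n"
proof -
  interpret product_sigma_finite "\<lambda>_::nat. lborel :: real measure" ..
  have meas: "(\<lambda>f. \<lambda>i\<in>{..<n}. t i + c * f i) \<in> measurable (coord_lborel n) (coord_lborel n)"
    unfolding coord_lborel_def by measurable
  show ?thesis
    unfolding coord_lborel_def
  proof (rule PiM_eqI)
    fix A :: "nat \<Rightarrow> real set" assume A: "\<And>i. i \<in> {..<n} \<Longrightarrow> A i \<in> sets lborel"
    let ?P = "Pi\<^sub>M {..<n} (\<lambda>_. lborel :: real measure)"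
    have eq: "(\<lambda>f. \<lambda>i\<in>{..<n}. t i + c * f i) -` Pi\<^sub>E {..<n} A \<inter> space ?P
        = Pi\<^sub>E {..<n} (\<lambda>i. {x. t i + c * x \<in> A i})"
      by (auto simp: space_PiM PiE_def Pi_def)
    have A': "{x. t i + c * x \<in> A i} \<in> sets lborel" if "i \<in> {..<n}" for i
    proof -
      have "(\<lambda>x. t i + c * x) -` A i \<inter> space lborel \<in> sets lborel"
        by (rule measurable_sets[OF _ A[OF that]]) simp
      then show ?thesis
        by (simp add: vimage_def)
    qed
    have "emeasure (distr ?P ?P (\<lambda>f. \<lambda>i\<in>{..<n}. t i + c * f i)) (Pi\<^sub>E {..<n} A)
        = (\<Prod>i<n. emeasure lborel {x. t i + c * x \<in> A i})"
      using A meas[unfolded coord_lborel_def]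
      by (subst emeasure_distr) (auto simp: eq intro!: emeasure_PiM A')
    then have "emeasure (scale_measure (ennreal (c ^ n))
            (distr ?P ?P (\<lambda>f. \<lambda>i\<in>{..<n}. t i + c * f i))) (Pi\<^sub>E {..<n} A)
        = ennreal c ^ n * (\<Prod>i<n. emeasure lborel {x. t i + c * x \<in> A i})"
      using assms by (simp add: ennreal_power)
    also have "\<dots> = (\<Prod>i<n. ennreal c * emeasure lborel {x. t i + c * x \<in> A i})"
      by (simp add: prod.distrib)
    also have "\<dots> = (\<Prod>i<n. emeasure lborel (A i))"
      using A assms by (intro prod.cong refl emeasure_lborel_affine) auto
    finally show "emeasure (scale_measure (ennreal (c ^ n))
            (distr ?P ?P (\<lambda>f. \<lambda>i\<in>{..<n}. t i + c * f i))) (Pi\<^sub>E {..<n} A)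
        = (\<Prod>i<n. emeasure lborel (A i))" .
  qed auto
qed

lemma borel_affine_preimage [measurable]:
  assumes "S \<in> sets borel"
  shows "{x. t + c *\<^sub>R x \<in> S} \<in> sets (borel :: rvec measure)"
proof -
  have "(\<lambda>x. t + c *\<^sub>R x) -` S \<inter> space borel \<in> sets (borel :: rvec measure)"
    by (rule measurable_sets[OF _ assms])
       (intro borel_measurable_continuous_onI continuous_intros)
  then show ?thesis
    by (simp add: vimage_def)
qed

lemma borel_translate_preimage: "S \<in> sets borel \<Longrightarrow> {x. t + x \<in> S} \<in> sets (borel :: rvec measure)"
  using borel_affine_preimage[of S t 1] by simp

lemma emeasure_vol_affine_preimage:
  assumes "c > 0" "t \<in> Rn n" and S [measurable]: "S \<in> sets borel"
  shows "ennreal (c ^ n) * emeasure (vol n) {x. t + c *\<^sub>R x \<in> S} = emeasure (vol n) S"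
proof -
  let ?A = "\<lambda>f. \<lambda>i\<in>{..<n}. coord t i + c * f i"
  have meas: "?A \<in> measurable (coord_lborel n) (coord_lborel n)"
    unfolding coord_lborel_def by measurable
  have of_coords: "of_coords n (?A f) = t + c *\<^sub>R of_coords n f" for f
    using assms by (intro Rn_eqI[of _ n]) (auto simp: coord_of_coords lookup_add)
  have pre: "of_coords n -` S \<inter> space (coord_lborel n) \<in> sets (coord_lborel n)"
    by (rule measurable_sets[OF measurable_of_coords S])
  have sp: "?A f \<in> space (coord_lborel n)" for f
    by (auto simp: coord_lborel_def space_PiM)
  have "emeasure (vol n) S = emeasure (coord_lborel n) (of_coords n -` S \<inter> space (coord_lborel n))"
    unfolding vol_def by (rule emeasure_distr[OF measurable_of_coords S])
  also have "\<dots> = ennreal (c ^ n) * emeasure (distr (coord_lborel n) (coord_lborel n) ?A)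
        (of_coords n -` S \<inter> space (coord_lborel n))"
    by (subst coord_lborel_affine[OF assms(1), of n "coord t", symmetric]) simp
  also have "emeasure (distr (coord_lborel n) (coord_lborel n) ?A) (of_coords n -` S \<inter> space (coord_lborel n))
      = emeasure (coord_lborel n) (?A -` (of_coords n -` S \<inter> space (coord_lborel n)) \<inter> space (coord_lborel n))"
    by (rule emeasure_distr[OF meas pre])
  also have "?A -` (of_coords n -` S \<inter> space (coord_lborel n)) \<inter> space (coord_lborel n)
      = of_coords n -` {x. t + c *\<^sub>R x \<in> S} \<inter> space (coord_lborel n)"
    using sp of_coords by auto
  also have "emeasure (coord_lborel n) \<dots> = emeasure (vol n) {x. t + c *\<^sub>R x \<in> S}"
    unfolding vol_def by (rule emeasure_distr[OF measurable_of_coords, symmetric]) measurable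
  finally show ?thesis ..
qed

lemma affine_image_eq_preimage:
  assumes "c \<noteq> (0::real)"
  shows "(\<lambda>x. t + c *\<^sub>R x) ` S = {y :: 'a :: real_vector. - ((1/c) *\<^sub>R t) + (1/c) *\<^sub>R y \<in> S}"
proof (intro set_eqI iffI)
  fix y assume "y \<in> {y. - ((1/c) *\<^sub>R t) + (1/c) *\<^sub>R y \<in> S}"
  moreover have "y = t + c *\<^sub>R (- ((1/c) *\<^sub>R t) + (1/c) *\<^sub>R y)"
    using assms by (simp add: algebra_simps)
  ultimately show "y \<in> (\<lambda>x. t + c *\<^sub>R x) ` S"
    by blast
qed (use assms in \<open>auto simp: algebra_simps\<close>)

lemma borel_affine_image:
  assumes "S \<in> sets borel" "c \<noteq> 0"
  shows "(\<lambda>x. t + c *\<^sub>R x) ` S \<in> sets (borel :: rvec measure)"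
  unfolding affine_image_eq_preimage[OF assms(2)] by (rule borel_affine_preimage[OF assms(1)])

lemma emeasure_vol_affine_image:
  assumes "c > 0" "t \<in> Rn n" and S [measurable]: "S \<in> sets borel"
  shows "emeasure (vol n) ((\<lambda>x. t + c *\<^sub>R x) ` S) = ennreal (c ^ n) * emeasure (vol n) S"
proof -
  have "(\<lambda>x. t + c *\<^sub>R x) ` S \<in> sets borel"
    using assms by (intro borel_affine_image) auto
  from emeasure_vol_affine_preimage[OF assms(1,2) this]
  have "emeasure (vol n) ((\<lambda>x. t + c *\<^sub>R x) ` S)
      = ennreal (c ^ n) * emeasure (vol n) {x. t + c *\<^sub>R x \<in> (\<lambda>x. t + c *\<^sub>R x) ` S}" ..
  also have "{x. t + c *\<^sub>R x \<in> (\<lambda>x. t + c *\<^sub>R x) ` S} = S"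
    using assms by auto
  finally show ?thesis .
qed

lemma measure_vol_affine_image:
  assumes "c > 0" "t \<in> Rn n" "S \<in> sets borel"
  shows "measure (vol n) ((\<lambda>x. t + c *\<^sub>R x) ` S) = c ^ n * measure (vol n) S"
  using assms by (simp add: measure_def emeasure_vol_affine_image enn2real_mult)

lemma emeasure_vol_translate:
  assumes "t \<in> Rn n" "S \<in> sets borel"
  shows "emeasure (vol n) {x. t + x \<in> S} = emeasure (vol n) S"
  using emeasure_vol_affine_preimage[of 1 t n S] assms by simp

definition hbox :: "nat \<Rightarrow> real \<Rightarrow> real \<Rightarrow> rvec set" where
  "hbox n a b = {x \<in> Rn n. \<forall>i<n. a \<le> coord x i \<and> coord x i < b}"

lemma hbox_Rn: "x \<in> hbox n a b \<Longrightarrow> x \<in> Rn n"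
  by (simp add: hbox_def)

lemma borel_hbox [measurable]: "hbox n a b \<in> sets borel"
proof -
  have "{x. a \<le> coord x i} \<in> sets borel" "{x. coord x i < b} \<in> sets borel" for i
    by (intro borel_closed closed_Collect_le borel_open open_Collect_less continuous_intros)+
  then have "{x. a \<le> coord x i} \<inter> {x. coord x i < b} \<in> sets borel" for i
    by auto
  moreover have "hbox n a b = Rn n \<inter> (\<Inter>i\<in>{..<n}. {x. a \<le> coord x i} \<inter> {x. coord x i < b})" if "n \<noteq> 0"
    by (auto simp: hbox_def)
  moreover have "hbox n a b = Rn n" if "n = 0"
    using that by (auto simp: hbox_def)
  moreover have "Rn n \<in> sets borel"
    by (simp add: borel_closed closed_Rn)
  ultimately show ?thesis
    by (cases "n = 0") (auto intro!: sets.Int sets.finite_INT)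
qed

lemma emeasure_hbox:
  assumes "a \<le> b"
  shows "emeasure (vol n) (hbox n a b) = ennreal ((b - a) ^ n)"
proof -
  interpret product_sigma_finite "\<lambda>_::nat. lborel :: real measure" ..
  have "emeasure (vol n) (hbox n a b)
      = emeasure (coord_lborel n) (of_coords n -` hbox n a b \<inter> space (coord_lborel n))"
    unfolding vol_def by (rule emeasure_distr) auto
  also have "of_coords n -` hbox n a b \<inter> space (coord_lborel n) = Pi\<^sub>E {..<n} (\<lambda>_. {a..<b})"
    by (auto simp: coord_lborel_def space_PiM hbox_def coord_of_coords PiE_def Pi_def)
  also have "emeasure (coord_lborel n) \<dots> = (\<Prod>i<n. emeasure lborel {a..<b})"
    unfolding coord_lborel_def by (rule emeasure_PiM) auto
  also have "\<dots> = ennreal ((b - a) ^ n)"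
    using assms by (simp add: ennreal_power)
  finally show ?thesis .
qed

lemma measure_hbox: "a \<le> b \<Longrightarrow> measure (vol n) (hbox n a b) = (b - a) ^ n"
  by (simp add: measure_def emeasure_hbox)

lemma hbox_fmeasurable [simp]: "hbox n a b \<in> fmeasurable (vol n)"
proof (rule fmeasurableI2)
  show "hbox n a (max a b) \<in> fmeasurable (vol n)"
    by (rule fmeasurableI) (simp_all add: emeasure_hbox)
  show "hbox n a b \<subseteq> hbox n a (max a b)"
    by (auto simp: hbox_def)
qed simp

lemma fmeasurable_if_subset_hbox:
  "S \<in> sets borel \<Longrightarrow> S \<subseteq> hbox n a b \<Longrightarrow> S \<in> fmeasurable (vol n)"
  by (rule fmeasurableI2[OF hbox_fmeasurable]) simp_all

section \<open>Periodic sets\<close>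

definition period_lattice :: "nat \<Rightarrow> real \<Rightarrow> rvec set" where
  "period_lattice n l = {w \<in> Rn n. \<forall>i<n. \<exists>z::int. coord w i = l * of_int z}"

definition periodic :: "nat \<Rightarrow> real \<Rightarrow> rvec set \<Rightarrow> bool" where
  "periodic n l S \<longleftrightarrow> (\<forall>y\<in>Rn n. \<forall>w\<in>period_lattice n l. y + w \<in> S \<longleftrightarrow> y \<in> S)"

lemma period_lattice_Rn: "w \<in> period_lattice n l \<Longrightarrow> w \<in> Rn n"
  by (simp add: period_lattice_def)

lemma period_lattice_zero [simp]: "0 \<in> period_lattice n l"
  by (auto simp: period_lattice_def intro!: exI[of _ 0])

lemma period_lattice_add [simp]:
  assumes "v \<in> period_lattice n l" "w \<in> period_lattice n l"
  shows "v + w \<in> period_lattice n l"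
proof -
  have "\<exists>z::int. coord (v + w) i = l * of_int z" if i: "i < n" for i
  proof -
    from assms i obtain y z :: int where "coord v i = l * of_int y" "coord w i = l * of_int z"
      by (fastforce simp: period_lattice_def)
    then show ?thesis
      by (auto simp: lookup_add algebra_simps intro!: exI[of _ "y + z"])
  qed
  then show ?thesis
    using assms by (simp add: period_lattice_def)
qed

lemma period_lattice_uminus [simp]:
  assumes "v \<in> period_lattice n l"
  shows "- v \<in> period_lattice n l"
proof -
  have "\<exists>z::int. coord (- v) i = l * of_int z" if i: "i < n" for i
  proof -
    from assms i obtain y :: int where "coord v i = l * of_int y"
      by (fastforce simp: period_lattice_def)
    then show ?thesis
      by (auto intro!: exI[of _ "- y"])
  qed
  then show ?thesis
    using assms by (simp add: period_lattice_def)
qed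

lemma period_lattice_diff [simp]:
  "v \<in> period_lattice n l \<Longrightarrow> w \<in> period_lattice n l \<Longrightarrow> v - w \<in> period_lattice n l"
  using period_lattice_add[of v n l "- w"] by simp

lemma countable_period_lattice: "countable (period_lattice n l)"
proof -
  have "period_lattice n l \<subseteq> (\<lambda>z. of_coords n (\<lambda>i. l * of_int (z i))) ` (Pi\<^sub>E {..<n} (\<lambda>_. UNIV :: int set))"
  proof
    fix w assume w: "w \<in> period_lattice n l"
    then have "\<forall>i\<in>{..<n}. \<exists>z::int. coord w i = l * of_int z"
      by (auto simp: period_lattice_def)
    then obtain z :: "nat \<Rightarrow> int" where z: "\<And>i. i < n \<Longrightarrow> coord w i = l * of_int (z i)"
      by (metis lessThan_iff)
    have "w = of_coords n (\<lambda>i. l * of_int (restrict z {..<n} i))"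
      using w z by (intro Rn_eqI[of _ n]) (auto simp: coord_of_coords period_lattice_Rn)
    then show "w \<in> (\<lambda>z. of_coords n (\<lambda>i. l * of_int (z i))) ` (Pi\<^sub>E {..<n} (\<lambda>_. UNIV :: int set))"
      by (intro image_eqI[of _ _ "restrict z {..<n}"]) auto
  qed
  moreover have "countable (Pi\<^sub>E {..<n} (\<lambda>_. UNIV :: int set))"
    by (intro countable_PiE) auto
  ultimately show ?thesis
    by (meson countable_image countable_subset)
qed

definition fundamental_domain :: "nat \<Rightarrow> real \<Rightarrow> rvec set \<Rightarrow> bool" where
  "fundamental_domain n l E \<longleftrightarrow>
     E \<in> sets borel \<and> E \<subseteq> Rn n \<and> (\<forall>x\<in>Rn n. \<exists>!w. w \<in> period_lattice n l \<and> x + w \<in> E)"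

lemma period_reduce:
  assumes l: "l > 0" and x: "x \<in> Rn n"
  obtains w where "w \<in> period_lattice n l" "x + w \<in> hbox n 0 l"
proof
  define w where "w = of_coords n (\<lambda>i. l * of_int (- \<lfloor>coord x i / l\<rfloor>))"
  have "\<exists>z::int. coord w i = l * of_int z" if "i < n" for i
    using that unfolding w_def by (simp only: coord_of_coords if_True) blast
  then show "w \<in> period_lattice n l"
    by (simp add: period_lattice_def w_def)
  have "0 \<le> coord x i + coord w i \<and> coord x i + coord w i < l" if "i < n" for i
  proof -
    have "of_int \<lfloor>coord x i / l\<rfloor> * l \<le> coord x i"
      using pos_le_divide_eq[OF l] of_int_floor_le by blast
    moreover have "coord x i < (of_int \<lfloor>coord x i / l\<rfloor> + 1) * l"
      by (rule iffD1[OF pos_divide_less_eq[OF l]]) linarith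
    ultimately show ?thesis
      using that by (simp add: w_def coord_of_coords algebra_simps)
  qed
  then show "x + w \<in> hbox n 0 l"
    using x by (simp add: hbox_def w_def lookup_add)
qed

lemma period_unique:
  assumes l: "l > 0" and v: "v \<in> period_lattice n l" "x + v \<in> hbox n 0 l"
    and w: "w \<in> period_lattice n l" "x + w \<in> hbox n 0 l"
  shows "v = w"
proof (rule Rn_eqI[of _ n])
  fix i assume i: "i < n"
  obtain y z :: int where yz: "coord v i = l * of_int y" "coord w i = l * of_int z"
    using v(1) w(1) i by (fastforce simp: period_lattice_def)
  have "0 \<le> coord x i + coord v i" "coord x i + coord v i < l"
    "0 \<le> coord x i + coord w i" "coord x i + coord w i < l"
    using v(2) w(2) i by (auto simp: hbox_def lookup_add)
  then have "\<bar>l * (of_int y - of_int z)\<bar> < l * 1"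
    unfolding yz right_diff_distrib by linarith
  then have "\<bar>real_of_int y - of_int z\<bar> < 1"
    using l by (simp add: abs_mult)
  then have "y = z"
    by linarith
  then show "coord v i = coord w i"
    using yz by simp
qed (use v w in \<open>auto simp: period_lattice_Rn\<close>)

lemma fundamental_domain_hbox:
  assumes l: "l > 0"
  shows "fundamental_domain n l (hbox n 0 l)"
proof -
  have "\<exists>!w. w \<in> period_lattice n l \<and> x + w \<in> hbox n 0 l" if x: "x \<in> Rn n" for x
    using period_reduce[OF l x] period_unique[OF l] by metis
  then show ?thesis
    by (auto simp: fundamental_domain_def hbox_Rn)
qed

lemma fundamental_domain_translate:
  assumes E: "fundamental_domain n l E" and t: "t \<in> Rn n"
  shows "fundamental_domain n l {x. t + x \<in> E}"
  unfolding fundamental_domain_def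
proof (intro conjI ballI subsetI)
  show "{x. t + x \<in> E} \<in> sets borel"
    using E by (simp add: fundamental_domain_def borel_translate_preimage)
next
  fix x assume "x \<in> {x. t + x \<in> E}"
  then have "t + x \<in> Rn n"
    using E by (auto simp: fundamental_domain_def)
  then have "t + x - t \<in> Rn n"
    using t by (rule Rn_diff)
  then show "x \<in> Rn n"
    by simp
next
  fix x assume "x \<in> Rn n"
  then have "t + x \<in> Rn n"
    using t by simp
  then show "\<exists>!w. w \<in> period_lattice n l \<and> x + w \<in> {x. t + x \<in> E}"
    using E by (simp add: fundamental_domain_def flip: add.assoc)
qed

lemma emeasure_vol_split_fundamental_domain:
  assumes E: "fundamental_domain n l E" and S: "S \<in> sets borel" "S \<subseteq> Rn n"
  shows "emeasure (vol n) S
    = (\<integral>\<^sup>+w. emeasure (vol n) {x \<in> S. x + w \<in> E} \<partial>count_space (period_lattice n l))"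
proof -
  let ?part = "\<lambda>w. {x \<in> S. x + w \<in> E}"
  have "S = (\<Union>w\<in>period_lattice n l. ?part w)"
    using E S(2) unfolding fundamental_domain_def by blast
  moreover have "disjoint_family_on ?part (period_lattice n l)"
    using E S(2) unfolding fundamental_domain_def disjoint_family_on_def by blast
  moreover have "?part w \<in> sets (vol n)" for w
  proof -
    have "?part w = S \<inter> {x. w + x \<in> E}"
      by (auto simp: add.commute)
    then show ?thesis
      using E S(1) by (auto simp: fundamental_domain_def borel_translate_preimage)
  qed
  ultimately show ?thesis
    using emeasure_UN_countable[of "period_lattice n l" ?part "vol n"] countable_period_lattice by simp
qed

lemma emeasure_periodic_fundamental_domain:
  assumes E: "fundamental_domain n l E" and F: "fundamental_domain n l F"
    and S: "S \<in> sets borel" "periodic n l S"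
  shows "emeasure (vol n) (S \<inter> E) = emeasure (vol n) (S \<inter> F)"
proof -
  let ?L = "period_lattice n l"
  have borel: "E \<in> sets borel" "F \<in> sets borel" and Rn: "E \<subseteq> Rn n" "F \<subseteq> Rn n"
    using E F by (auto simp: fundamental_domain_def)
  have part: "emeasure (vol n) {x \<in> S \<inter> E. x + w \<in> F} = emeasure (vol n) {y \<in> S \<inter> F. y + - w \<in> E}"
    if w: "w \<in> ?L" for w
  proof -
    have "x \<in> S \<longleftrightarrow> w + x \<in> S" if "x \<in> E" for x
      using S(2) w that Rn(1) unfolding periodic_def by (metis add.commute subsetD)
    then have "{x \<in> S \<inter> E. x + w \<in> F} = {x. w + x \<in> {y \<in> S \<inter> F. y + - w \<in> E}}"
      by (auto simp: add.commute)
    moreover have "{y \<in> S \<inter> F. y + - w \<in> E} = S \<inter> F \<inter> {y. - w + y \<in> E}"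
      by (auto simp: add.commute)
    then have "{y \<in> S \<inter> F. y + - w \<in> E} \<in> sets borel"
      using S(1) borel by (simp only:) (intro sets.Int borel_translate_preimage)
    ultimately show ?thesis
      using w by (simp only: emeasure_vol_translate[OF period_lattice_Rn])
  qed
  have "emeasure (vol n) (S \<inter> E)
      = (\<integral>\<^sup>+w. emeasure (vol n) {x \<in> S \<inter> E. x + w \<in> F} \<partial>count_space ?L)"
    using S(1) borel Rn by (intro emeasure_vol_split_fundamental_domain F) auto
  also have "\<dots> = (\<integral>\<^sup>+w. emeasure (vol n) {y \<in> S \<inter> F. y + - w \<in> E} \<partial>count_space ?L)"
    using part by (intro nn_integral_cong) simp
  also have "\<dots> = (\<integral>\<^sup>+w. emeasure (vol n) {y \<in> S \<inter> F. y + w \<in> E} \<partial>count_space ?L)"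
  proof (rule nn_integral_bij_count_space)
    show "bij_betw uminus ?L ?L"
      by (rule bij_betwI[where g = uminus]) auto
  qed
  also have "\<dots> = emeasure (vol n) (S \<inter> F)"
    using S(1) borel Rn by (intro emeasure_vol_split_fundamental_domain[symmetric] E) auto
  finally show ?thesis .
qed

lemma measure_periodic_translate:
  assumes l: "l > 0" and t: "t \<in> Rn n" and S: "S \<in> sets borel" "periodic n l S"
  shows "measure (vol n) ({x. t + x \<in> S} \<inter> hbox n 0 l) = measure (vol n) (S \<inter> hbox n 0 l)"
proof -
  let ?E = "{y. - t + y \<in> hbox n 0 l}"
  have "fundamental_domain n l ?E"
    using l t by (intro fundamental_domain_translate fundamental_domain_hbox) auto
  then have "emeasure (vol n) (S \<inter> ?E) = emeasure (vol n) (S \<inter> hbox n 0 l)"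
    using S by (intro emeasure_periodic_fundamental_domain[where l = l] fundamental_domain_hbox l)
  moreover have "emeasure (vol n) {x. t + x \<in> S \<inter> ?E} = emeasure (vol n) (S \<inter> ?E)"
    using S(1) by (intro emeasure_vol_translate t sets.Int borel_translate_preimage borel_hbox)
  moreover have "{x. t + x \<in> S} \<inter> hbox n 0 l = {x. t + x \<in> S \<inter> ?E}"
    by auto
  ultimately show ?thesis
    by (simp add: measure_def)
qed

section \<open>Greedy selection\<close>

lemma exists_point_in_many_sets:
  fixes h :: real
  assumes fin: "finite X" and V: "V \<in> fmeasurable M" "measure M V > 0"
    and A: "\<And>x. x \<in> X \<Longrightarrow> A x \<in> sets M"
    and h: "\<And>x. x \<in> X \<Longrightarrow> h * measure M V \<le> measure M (A x \<inter> V)"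
  shows "\<exists>v\<in>V. h * card X \<le> card {x \<in> X. v \<in> A x}"
proof -
  let ?count = "\<lambda>v. card {x \<in> X. v \<in> A x}"
  have "V \<noteq> {}"
    using V(2) by auto
  then obtain v0 where "v0 \<in> V"
    by blast
  moreover have "?count u < Suc (card X)" for u
    using fin by (auto simp: less_Suc_eq_le intro: card_mono)
  ultimately obtain v where v: "v \<in> V" and max: "\<And>u. u \<in> V \<Longrightarrow> ?count u \<le> ?count v"
    using ex_has_greatest_nat[of "\<lambda>v. v \<in> V" v0 ?count "Suc (card X)"] by blast
  have AV: "A x \<inter> V \<in> fmeasurable M" if "x \<in> X" for x
    using V A[OF that] by (simp add: fmeasurable_Int_fmeasurable Int_commute)
  have integrable: "integrable M (indicat_real W)" "integral\<^sup>L M (indicat_real W) = measure M W"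
    if "W \<in> fmeasurable M" for W
    using that by (auto simp: integrable_indicator_iff fmeasurable_def sets.Int_space_eq2)
  have "h * card X * measure M V = (\<Sum>x\<in>X. h * measure M V)"
    by simp
  also have "\<dots> \<le> (\<Sum>x\<in>X. measure M (A x \<inter> V))"
    using h by (rule sum_mono)
  also have "\<dots> = integral\<^sup>L M (\<lambda>u. \<Sum>x\<in>X. indicat_real (A x \<inter> V) u)"
    using integrable[OF AV] by (simp add: Bochner_Integration.integral_sum)
  also have "\<dots> \<le> integral\<^sup>L M (\<lambda>u. ?count v * indicat_real V u)"
  proof (rule integral_mono)
    fix u
    have "(\<Sum>x\<in>X. indicat_real (A x \<inter> V) u) = ?count u * indicat_real V u"
      using fin by (simp add: indicator_def sum.If_cases Int_def conj_commute)
    then show "(\<Sum>x\<in>X. indicat_real (A x \<inter> V) u) \<le> ?count v * indicat_real V u"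
      using max[of u] by (simp add: indicator_def)
  qed (use integrable[OF AV] integrable[OF V(1)] in auto)
  also have "\<dots> = ?count v * measure M V"
    using integrable[OF V(1)] by simp
  finally have "h * card X \<le> ?count v"
    using V(2) by simp
  with v show ?thesis
    by blast
qed

lemma exists_partial_hitting_set:
  fixes h :: real and j :: nat
  assumes fin: "finite X" and V: "V \<in> fmeasurable M" "measure M V > 0"
    and A: "\<And>x. x \<in> X \<Longrightarrow> A x \<in> sets M"
    and h: "\<And>x. x \<in> X \<Longrightarrow> h * measure M V \<le> measure M (A x \<inter> V)"
  shows "\<exists>W. finite W \<and> W \<subseteq> V \<and> card W \<le> j \<and> card {x \<in> X. W \<inter> A x = {}} \<le> exp (- h) ^ j * card X"
proof (induction j)
  case 0
  then show ?case
    by (intro exI[of _ "{}"]) simp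
next
  case (Suc j)
  define missed where "missed W = {x \<in> X. W \<inter> A x = {}}" for W
  have finite_missed: "finite (missed W)" for W
    using fin by (simp add: missed_def)
  obtain W where W: "finite W" "W \<subseteq> V" "card W \<le> j" "card (missed W) \<le> exp (- h) ^ j * card X"
    using Suc unfolding missed_def by blast
  obtain v where v: "v \<in> V" "h * card (missed W) \<le> card {x \<in> missed W. v \<in> A x}"
    using exists_point_in_many_sets[OF finite_missed V, of W A h] A h by (auto simp: missed_def)
  have "missed W = missed (insert v W) \<union> {x \<in> missed W. v \<in> A x}"
    "missed (insert v W) \<inter> {x \<in> missed W. v \<in> A x} = {}"
    by (auto simp: missed_def)
  then have "card (missed W) = card (missed (insert v W)) + card {x \<in> missed W. v \<in> A x}"
    using finite_missed by (metis (no_types, lifting) card_Un_disjoint finite_Un)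
  with v(2) have "card (missed (insert v W)) \<le> (1 - h) * card (missed W)"
    by (simp add: left_diff_distrib)
  also have "\<dots> \<le> exp (- h) * card (missed W)"
    using exp_ge_add_one_self[of "- h"] by (intro mult_right_mono) auto
  also have "\<dots> \<le> exp (- h) * (exp (- h) ^ j * card X)"
    using W(4) by (intro mult_left_mono) auto
  finally have "card (missed (insert v W)) \<le> exp (- h) ^ Suc j * card X"
    by (simp add: mult.assoc)
  moreover have "card (insert v W) \<le> Suc j"
    using W(1,3) by (simp add: card_insert_if)
  ultimately show ?case
    using W v unfolding missed_def by (intro exI[of _ "insert v W"]) simp
qed

lemma greedy_hitting_set:
  fixes h :: real and m :: nat
  assumes fin: "finite X" and V: "V \<in> fmeasurable M" "measure M V > 0"
    and A: "\<And>x. x \<in> X \<Longrightarrow> A x \<in> sets M"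
    and h: "\<And>x. x \<in> X \<Longrightarrow> h * measure M V \<le> measure M (A x \<inter> V)"
    and m: "card X < exp (h * m)"
  obtains W where "finite W" "W \<subseteq> V" "card W \<le> m" "\<And>x. x \<in> X \<Longrightarrow> \<exists>v\<in>W. v \<in> A x"
proof -
  obtain W where W: "finite W" "W \<subseteq> V" "card W \<le> m"
    and missed: "card {x \<in> X. W \<inter> A x = {}} \<le> exp (- h) ^ m * card X"
    using exists_partial_hitting_set[OF fin V, where A = A and h = h and j = m] A h by blast
  have "exp (- h) ^ m * card X = card X / exp (h * m)"
    by (simp add: exp_minus exp_of_nat_mult[symmetric] mult.commute divide_inverse power_inverse)
  also have "\<dots> < 1"
    using m by simp
  finally have "card {x \<in> X. W \<inter> A x = {}} = 0"
    using missed by linarith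
  then have "{x \<in> X. W \<inter> A x = {}} = {}"
    using fin by simp
  then show ?thesis
    by (intro that[OF W]) auto
qed

lemma measure_UNION_ge_pairwise:
  fixes k e :: real
  assumes fin: "finite T" and V: "V \<in> fmeasurable M"
    and A: "\<And>p. p \<in> T \<Longrightarrow> A p \<in> sets M"
    and single: "\<And>p. p \<in> T \<Longrightarrow> k \<le> measure M (A p \<inter> V)"
    and pair: "\<And>p q. p \<in> T \<Longrightarrow> q \<in> T \<Longrightarrow> p \<noteq> q \<Longrightarrow> measure M (A p \<inter> A q \<inter> V) \<le> e" and e: "e \<ge> 0"
  shows "card T * (k - card T * e) \<le> measure M ((\<Union>p\<in>T. A p) \<inter> V)"
  using fin A single pair
proof (induction T rule: finite_induct)
  case (insert q T)
  let ?W = "(\<Union>p\<in>T. A p) \<inter> V"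
  have W: "?W \<in> fmeasurable M" and Aq: "A q \<inter> V \<in> fmeasurable M"
    using insert.hyps(1) insert.prems(1) V
    by (auto simp: Int_commute[of _ V] intro!: fmeasurable_Int_fmeasurable sets.finite_UN)
  have "measure M (A q \<inter> V \<inter> ?W) = measure M (\<Union>p\<in>T. A p \<inter> A q \<inter> V)"
    by (rule arg_cong[of _ _ "measure M"]) auto
  also have "\<dots> \<le> (\<Sum>p\<in>T. measure M (A p \<inter> A q \<inter> V))"
    using insert.hyps(1) insert.prems(1) V by (intro measure_UNION_le sets.Int) auto
  also have "\<dots> \<le> (\<Sum>p\<in>T. e)"
    using insert.prems(3) insert.hyps(2) by (intro sum_mono) auto
  finally have overlap: "measure M (A q \<inter> V \<inter> ?W) \<le> card T * e"
    by simp
  have "card (insert q T) * (k - card (insert q T) * e)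
      = k + card T * (k - card T * e) - card T * e - (1 + card T) * e"
    using insert.hyps by (simp add: algebra_simps)
  also have "\<dots> \<le> k + card T * (k - card T * e) - card T * e"
    using e by simp
  also have "\<dots> \<le> measure M (A q \<inter> V) + measure M ?W - measure M (A q \<inter> V \<inter> ?W)"
  proof -
    have "card T * (k - card T * e) \<le> measure M ?W"
      using insert.prems by (intro insert.IH) auto
    then show ?thesis
      using overlap insert.prems(2)[of q] by simp
  qed
  also have "\<dots> = measure M ((\<Union>p\<in>insert q T. A p) \<inter> V)"
    using measure_Un3[OF Aq W] by (simp add: Int_Un_distrib2)
  finally show ?case .
qed simp

lemma greedy_coloring:
  fixes E :: "'v \<Rightarrow> 'v \<Rightarrow> bool" and m :: nat
  assumes sym: "\<And>x y. E x y \<Longrightarrow> E y x" and irrefl: "\<And>x. \<not> E x x"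
    and degree: "\<And>x. finite {y. E x y}" "\<And>x. card {y. E x y} < m"
  obtains c :: "'v \<Rightarrow> nat" where "\<And>x. c x < m" "\<And>x y. E x y \<Longrightarrow> c x \<noteq> c y"
proof -
  obtain r :: "'v rel" where r: "Well_order r" "Field r = UNIV"
    using well_ordering by (elim exE conjE)
  let ?ok = "\<lambda>c x k. k < m \<and> (\<forall>y. (y, x) \<in> r - Id \<longrightarrow> E x y \<longrightarrow> c y \<noteq> k)"
  have "\<exists>c. \<forall>x. ?ok c x (c x)"
  proof (rule dependent_wf_choice[of "r - Id" ?ok])
    show "wf (r - Id)"
      using r by (simp add: well_order_on_def)
    show "?ok c x k = ?ok c' x k"
      if "\<And>z. (z, x) \<in> r - Id \<Longrightarrow> c z = c' z" for c c' :: "'v \<Rightarrow> nat" and k x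
      using that by auto
    fix x and c :: "'v \<Rightarrow> nat"
    have "card (c ` {y. E x y}) < card {..<m}"
      using card_image_le[OF degree(1), of c x] degree(2)[of x] by simp
    then obtain k where "k < m" "k \<notin> c ` {y. E x y}"
      using card_mono[OF finite_imageI[OF degree(1)], of "{..<m}" c x] by (auto simp: not_le)
    then show "\<exists>k. ?ok c x k"
      by blast
  qed
  then obtain c where c: "\<And>x. ?ok c x (c x)"
    by blast
  have "c x \<noteq> c y" if "E x y" for x y
  proof -
    have "x \<noteq> y"
      using that irrefl by blast
    then have "(x, y) \<in> r - Id \<or> (y, x) \<in> r - Id"
      using r unfolding well_order_on_def linear_order_on_def total_on_def by auto
    then show ?thesis
      using c that sym by metis
  qed
  with c show ?thesis
    by (intro that[of c]) auto
qed

lemma exists_maximal_separated_set: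
  fixes R :: "'a \<Rightarrow> 'a \<Rightarrow> bool"
  assumes sym: "\<And>x y. R x y \<Longrightarrow> R y x"
  obtains F where "F \<subseteq> Z" "pairwise R F" "\<And>z. z \<in> Z - F \<Longrightarrow> \<exists>p\<in>F. \<not> R z p"
proof -
  let ?\<S> = "{F. F \<subseteq> Z \<and> pairwise R F}"
  have "\<exists>F\<in>?\<S>. \<forall>G\<in>?\<S>. F \<subseteq> G \<longrightarrow> G = F"
  proof (rule subset_Zorn')
    fix \<C> assume "subset.chain ?\<S> \<C>"
    then have "\<And>F. F \<in> \<C> \<Longrightarrow> F \<subseteq> Z" "\<And>F. F \<in> \<C> \<Longrightarrow> pairwise R F" "chain\<^sub>\<subseteq> \<C>"
      by (auto simp: subset_chain_def chain_subset_def)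
    then show "\<Union> \<C> \<in> ?\<S>"
      using pairwise_chain_Union[of \<C> R] by blast
  qed
  then obtain F where F: "F \<subseteq> Z" "pairwise R F"
    and maximal: "\<And>G. G \<subseteq> Z \<Longrightarrow> pairwise R G \<Longrightarrow> F \<subseteq> G \<Longrightarrow> G = F"
    by auto
  have "\<exists>p\<in>F. \<not> R z p" if z: "z \<in> Z - F" for z
  proof (rule ccontr)
    assume "\<not> ?thesis"
    then have "pairwise R (insert z F)"
      using F(2) sym by (auto simp: pairwise_insert)
    then show False
      using maximal[of "insert z F"] F(1) z by auto
  qed
  with F show ?thesis
    by (rule that)
qed

section \<open>Covering by translates of a periodic set\<close>

lemma card_subsets_of_card_le:
  fixes b :: real
  assumes "finite A" "card A \<le> b"
  shows "card {T. T \<subseteq> A \<and> card T = t} \<le> b ^ t"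
proof -
  have "card {T. T \<subseteq> A \<and> card T = t} = card A choose t"
    using assms(1) by (rule n_subsets)
  also have "\<dots> \<le> card A ^ t"
    by (cases "t \<le> card A") (auto simp: binomial_le_pow binomial_eq_0)
  finally have "real (card {T. T \<subseteq> A \<and> card T = t}) \<le> real (card A) ^ t"
    by (simp flip: of_nat_power)
  also have "\<dots> \<le> b ^ t"
    using assms(2) by (intro power_mono) auto
  finally show ?thesis .
qed

lemma card_UN_subsets_of_card_le:
  fixes b :: real
  assumes Q: "finite Q" and F: "\<And>c. c \<in> Q \<Longrightarrow> finite (F c)" "\<And>c. c \<in> Q \<Longrightarrow> card (F c) \<le> b"
  shows "card (\<Union>c\<in>Q. {T. T \<subseteq> F c \<and> card T = t}) \<le> card Q * b ^ t"
proof -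
  have "real (card (\<Union>c\<in>Q. {T. T \<subseteq> F c \<and> card T = t})) \<le> (\<Sum>c\<in>Q. card {T. T \<subseteq> F c \<and> card T = t})"
    using card_UN_le[OF Q] by (simp only: of_nat_le_iff)
  also have "\<dots> = (\<Sum>c\<in>Q. real (card {T. T \<subseteq> F c \<and> card T = t}))"
    by simp
  also have "\<dots> \<le> (\<Sum>c\<in>Q. b ^ t)"
    using F by (intro sum_mono card_subsets_of_card_le)
  finally show ?thesis
    by simp
qed

lemma subset_image_lessThan:
  assumes "finite V" "card V \<le> k"
  shows "\<exists>e. V \<subseteq> e ` {..<k}"
proof -
  obtain e where "V = e ` {..<card V}"
    using ex_bij_betw_nat_finite[OF assms(1)] by (auto simp: bij_betw_def atLeast0LessThan)
  then show ?thesis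
    using assms(2) by (intro exI[of _ e]) fastforce
qed

locale periodic_set =
  fixes n :: nat and l :: real and S :: "rvec set"
  assumes l_pos: "0 < l" and S_borel: "S \<in> sets borel" and S_periodic: "periodic n l S"
begin

definition period_measure :: real where
  "period_measure = measure (vol n) (S \<inter> hbox n 0 l)"

definition hitting :: "rvec \<Rightarrow> rvec set" where
  "hitting p = {z. p + z \<in> S}"

definition overlap :: "rvec \<Rightarrow> rvec \<Rightarrow> real" where
  "overlap p q = measure (vol n) (hitting p \<inter> hitting q \<inter> hbox n 0 l)"

definition weakly_correlated :: "real \<Rightarrow> rvec set \<Rightarrow> bool" where
  "weakly_correlated \<tau> T \<longleftrightarrow> pairwise (\<lambda>p q. overlap p q \<le> \<tau> * period_measure) T"

lemma hitting_borel [measurable]: "hitting p \<in> sets borel"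
  unfolding hitting_def using S_borel by (rule borel_translate_preimage)

lemma measure_hitting: "p \<in> Rn n \<Longrightarrow> measure (vol n) (hitting p \<inter> hbox n 0 l) = period_measure"
  unfolding hitting_def period_measure_def
  by (rule measure_periodic_translate[OF l_pos _ S_borel S_periodic])

lemma overlap_self: "p \<in> Rn n \<Longrightarrow> overlap p p = period_measure"
  by (simp add: overlap_def measure_hitting)

lemma overlap_commute: "overlap p q = overlap q p"
  by (simp add: overlap_def Int_commute)

lemma measure_hitting_diff:
  assumes "p \<in> Rn n" "q \<in> Rn n"
  shows "measure (vol n) (hitting (q - p) \<inter> (S \<inter> hbox n 0 l)) = overlap p q"
proof -
  have "periodic n l (S \<inter> hitting (q - p))"
    unfolding periodic_def
  proof (intro ballI)
    fix y w assume "y \<in> Rn n" "w \<in> period_lattice n l"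
    then have "y + w \<in> S \<longleftrightarrow> y \<in> S" "((q - p) + y) + w \<in> S \<longleftrightarrow> (q - p) + y \<in> S"
      using S_periodic assms unfolding periodic_def by (meson Rn_add Rn_diff)+
    then show "y + w \<in> S \<inter> hitting (q - p) \<longleftrightarrow> y \<in> S \<inter> hitting (q - p)"
      by (simp add: hitting_def add.assoc)
  qed
  then have "measure (vol n) ({x. p + x \<in> S \<inter> hitting (q - p)} \<inter> hbox n 0 l)
      = measure (vol n) (S \<inter> hitting (q - p) \<inter> hbox n 0 l)"
    using l_pos assms(1) S_borel by (intro measure_periodic_translate) auto
  moreover have "{x. p + x \<in> S \<inter> hitting (q - p)} \<inter> hbox n 0 l = hitting p \<inter> hitting q \<inter> hbox n 0 l"
    by (auto simp: hitting_def)
  ultimately show ?thesis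
    by (simp add: overlap_def Int_ac)
qed

lemma cover_by_translates:
  fixes h :: real and m :: nat
  assumes h: "h * l ^ n \<le> period_measure"
    and X: "finite X" "X \<subseteq> Rn n" "card X < exp (h * m)"
  obtains W where "finite W" "W \<subseteq> hbox n 0 l" "card W \<le> m" "\<And>x. x \<in> X \<Longrightarrow> \<exists>z\<in>W. x + z \<in> S"
proof (rule greedy_hitting_set[of X "hbox n 0 l" "vol n" hitting h m])
  show "h * measure (vol n) (hbox n 0 l) \<le> measure (vol n) (hitting x \<inter> hbox n 0 l)" if "x \<in> X" for x
    using that X(2) h l_pos by (auto simp: measure_hitting measure_hbox)
  fix W assume "finite W" "W \<subseteq> hbox n 0 l" "card W \<le> m" "\<And>x. x \<in> X \<Longrightarrow> \<exists>z\<in>W. z \<in> hitting x"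
  then show thesis
    by (intro that[of W]) (auto simp: hitting_def)
qed (use X l_pos in \<open>auto simp: measure_hbox\<close>)

lemma meet_weakly_correlated_sets:
  fixes h \<tau> :: real and m t :: nat
  assumes h: "h * l ^ n \<le> period_measure" and t: "t \<ge> 1" and \<tau>: "0 < \<tau>" "t * \<tau> < 1"
    and \<T>: "finite \<T>" "card \<T> < exp (t * (1 - t * \<tau>) * h * m)"
    and T: "\<And>T. T \<in> \<T> \<Longrightarrow> T \<subseteq> Rn n" "\<And>T. T \<in> \<T> \<Longrightarrow> card T = t"
      "\<And>T. T \<in> \<T> \<Longrightarrow> weakly_correlated \<tau> T"
  obtains W where "finite W" "W \<subseteq> hbox n 0 l" "card W \<le> m"
    "\<And>T. T \<in> \<T> \<Longrightarrow> \<exists>z\<in>W. \<exists>p\<in>T. p + z \<in> S"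
proof (rule greedy_hitting_set[of \<T> "hbox n 0 l" "vol n" "\<lambda>T. \<Union>p\<in>T. hitting p" "t * (1 - t * \<tau>) * h" m])
  have fin: "finite T" if "T \<in> \<T>" for T
    using T(2)[OF that] t by (intro card_ge_0_finite) simp
  then show "(\<Union>p\<in>T. hitting p) \<in> sets (vol n)" if "T \<in> \<T>" for T
    using that by (intro sets.finite_UN) simp_all
  fix T assume "T \<in> \<T>"
  have "t * (1 - t * \<tau>) * h * measure (vol n) (hbox n 0 l) = t * (1 - t * \<tau>) * (h * l ^ n)"
    using l_pos by (simp add: measure_hbox)
  also have "\<dots> \<le> t * (1 - t * \<tau>) * period_measure"
    using h \<tau> by (intro mult_left_mono) auto
  also have "\<dots> = card T * (period_measure - card T * (\<tau> * period_measure))"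
    using T(2)[OF \<open>T \<in> \<T>\<close>] by (simp add: algebra_simps)
  also have "\<dots> \<le> measure (vol n) ((\<Union>p\<in>T. hitting p) \<inter> hbox n 0 l)"
  proof (rule measure_UNION_ge_pairwise)
    show "period_measure \<le> measure (vol n) (hitting p \<inter> hbox n 0 l)" if "p \<in> T" for p
      using measure_hitting T(1)[OF \<open>T \<in> \<T>\<close>] that by auto
    show "measure (vol n) (hitting p \<inter> hitting q \<inter> hbox n 0 l) \<le> \<tau> * period_measure"
      if "p \<in> T" "q \<in> T" "p \<noteq> q" for p q
      using T(3)[OF \<open>T \<in> \<T>\<close>] that by (simp add: weakly_correlated_def pairwise_def overlap_def)
  qed (use fin \<open>T \<in> \<T>\<close> \<tau> in \<open>auto simp: period_measure_def\<close>)
  finally show "t * (1 - t * \<tau>) * h * measure (vol n) (hbox n 0 l)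
      \<le> measure (vol n) ((\<Union>p\<in>T. hitting p) \<inter> hbox n 0 l)" .
next
  fix W assume W: "finite W" "W \<subseteq> hbox n 0 l" "card W \<le> m"
    "\<And>T. T \<in> \<T> \<Longrightarrow> \<exists>z\<in>W. z \<in> (\<Union>p\<in>T. hitting p)"
  show thesis
    using W by (intro that[of W]) (auto simp: hitting_def)
qed (use \<T> l_pos in \<open>auto simp: measure_hbox\<close>)

lemma cover_strongly_correlated:
  fixes \<tau> :: real and J :: nat
  assumes pos: "0 < period_measure" "0 < \<tau>" and p: "p \<in> Rn n"
    and X: "finite X" "X \<subseteq> Rn n" "card X < exp (\<tau> * J)"
    and strong: "\<And>q. q \<in> X \<Longrightarrow> \<tau> * period_measure < overlap p q"
  shows "\<exists>V. finite V \<and> card V \<le> J \<and> (\<forall>q\<in>X. \<exists>v\<in>V. q + v \<in> S)"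
proof -
  obtain W where W: "finite W" "W \<subseteq> S \<inter> hbox n 0 l" "card W \<le> J"
    "\<And>q. q \<in> X \<Longrightarrow> \<exists>v\<in>W. v \<in> hitting (q - p)"
  proof (rule greedy_hitting_set[of X "S \<inter> hbox n 0 l" "vol n" "\<lambda>q. hitting (q - p)" \<tau> J])
    show "S \<inter> hbox n 0 l \<in> fmeasurable (vol n)"
      using S_borel by (intro fmeasurable_if_subset_hbox[of _ n 0 l]) auto
    show "\<tau> * measure (vol n) (S \<inter> hbox n 0 l) \<le> measure (vol n) (hitting (q - p) \<inter> (S \<inter> hbox n 0 l))"
      if "q \<in> X" for q
      using that X(2) p strong[OF that] measure_hitting_diff[of p q] by (auto simp: period_measure_def)
  qed (use X pos in \<open>auto simp: period_measure_def\<close>)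
  show ?thesis
  proof (intro exI[of _ "(\<lambda>v. v - p) ` W"] conjI ballI)
    show "card ((\<lambda>v. v - p) ` W) \<le> J"
      using W(1,3) card_image_le order_trans by blast
    show "\<exists>v\<in>(\<lambda>v. v - p) ` W. q + v \<in> S" if "q \<in> X" for q
      using W(4)[OF that] by (auto simp: hitting_def algebra_simps)
  qed (use W p hbox_Rn in auto)
qed

lemma exists_maximal_weakly_correlated:
  assumes U: "U \<subseteq> Rn n" and pos: "0 < period_measure" and \<tau>: "\<tau> < 1"
  obtains P where "P \<subseteq> U" "weakly_correlated \<tau> P" "\<And>q. q \<in> U \<Longrightarrow> \<exists>p\<in>P. \<tau> * period_measure < overlap p q"
proof -
  let ?R = "\<lambda>p q. overlap p q \<le> \<tau> * period_measure"
  have "?R q p" if "?R p q" for p q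
    using that by (simp add: overlap_commute[of q p])
  then obtain P where P: "P \<subseteq> U" "pairwise ?R P" "\<And>q. q \<in> U - P \<Longrightarrow> \<exists>p\<in>P. \<not> ?R q p"
    using exists_maximal_separated_set[of ?R U] by blast
  have "\<exists>p\<in>P. \<tau> * period_measure < overlap p q" if q: "q \<in> U" for q
  proof (cases "q \<in> P")
    case True
    have "\<tau> * period_measure < overlap q q"
      using q U pos \<tau> by (simp add: overlap_self subset_iff)
    with True show ?thesis
      by blast
  next
    case False
    then show ?thesis
      using P(3)[of q] q by (auto simp: not_le overlap_commute[of q])
  qed
  with P(1,2) show ?thesis
    by (intro that) (auto simp: weakly_correlated_def)
qed

lemma cover_without_weakly_correlated_subset:
  fixes \<tau> :: real and t J :: nat
  assumes U: "finite U" "U \<subseteq> Rn n" "card U < exp (\<tau> * J)" and pos: "0 < period_measure"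
    and \<tau>: "0 < \<tau>" "\<tau> < 1"
    and none: "\<And>T. T \<subseteq> U \<Longrightarrow> weakly_correlated \<tau> T \<Longrightarrow> card T \<noteq> t"
  shows "\<exists>V. finite V \<and> card V \<le> t * J \<and> (\<forall>q\<in>U. \<exists>v\<in>V. q + v \<in> S)"
proof -
  obtain P where P: "P \<subseteq> U" "weakly_correlated \<tau> P"
    "\<And>q. q \<in> U \<Longrightarrow> \<exists>p\<in>P. \<tau> * period_measure < overlap p q"
    using exists_maximal_weakly_correlated[OF U(2) pos \<tau>(2)] by blast
  have "card P \<le> t"
  proof (rule ccontr)
    assume "\<not> card P \<le> t"
    then obtain T where T: "T \<subseteq> P" "card T = t"
      using obtain_subset_with_card_n[of t P] by auto
    then have "weakly_correlated \<tau> T"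
      using P(2) unfolding weakly_correlated_def by (meson pairwise_subset)
    then show False
      using none[of T] T P(1) by blast
  qed
  have "\<exists>V. finite V \<and> card V \<le> J \<and>
      (\<forall>q\<in>{q \<in> U. \<tau> * period_measure < overlap p q}. \<exists>v\<in>V. q + v \<in> S)" if "p \<in> P" for p
  proof (rule cover_strongly_correlated[OF pos \<tau>(1), of p])
    have "card {q \<in> U. \<tau> * period_measure < overlap p q} \<le> card U"
      using U(1) by (intro card_mono) auto
    then show "card {q \<in> U. \<tau> * period_measure < overlap p q} < exp (\<tau> * J)"
      using U(3) by linarith
  qed (use that P(1) U in auto)
  then obtain V where V: "\<And>p. p \<in> P \<Longrightarrow> finite (V p) \<and> card (V p) \<le> J \<and>
      (\<forall>q\<in>{q \<in> U. \<tau> * period_measure < overlap p q}. \<exists>v\<in>V p. q + v \<in> S)"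
    by metis
  have "finite P"
    using P(1) U(1) by (rule finite_subset)
  then have "card (\<Union>p\<in>P. V p) \<le> (\<Sum>p\<in>P. card (V p))"
    by (rule card_UN_le)
  also have "\<dots> \<le> card P * J"
    using sum_bounded_above[of P "\<lambda>p. card (V p)" J] V by simp
  also have "\<dots> \<le> t * J"
    using \<open>card P \<le> t\<close> by simp
  finally have "card (\<Union>p\<in>P. V p) \<le> t * J" .
  moreover have "\<exists>v\<in>\<Union>p\<in>P. V p. q + v \<in> S" if "q \<in> U" for q
    using P(3)[OF that] V that by blast
  ultimately show ?thesis
    using V \<open>finite P\<close> by (intro exI[of _ "\<Union>p\<in>P. V p"]) auto
qed

lemma meet_weakly_correlated_subsets:
  fixes h \<tau> b :: real and m t :: nat
  assumes h: "h * l ^ n \<le> period_measure" and t: "t \<ge> 1" and \<tau>: "0 < \<tau>" "t * \<tau> < 1"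
    and F: "finite Q" "\<And>c. c \<in> Q \<Longrightarrow> finite (F c)" "\<And>c. c \<in> Q \<Longrightarrow> F c \<subseteq> Rn n" "\<And>c. c \<in> Q \<Longrightarrow> card (F c) \<le> b"
    and m: "card Q * b ^ t < exp (t * (1 - t * \<tau>) * h * m)"
  obtains W where "finite W" "W \<subseteq> hbox n 0 l" "card W \<le> m"
    "\<And>c T. c \<in> Q \<Longrightarrow> T \<subseteq> F c \<Longrightarrow> card T = t \<Longrightarrow> weakly_correlated \<tau> T \<Longrightarrow> \<exists>z\<in>W. \<exists>p\<in>T. p + z \<in> S"
proof -
  let ?subsets = "\<Union>c\<in>Q. {T. T \<subseteq> F c \<and> card T = t}"
  define \<T> where "\<T> = {T \<in> ?subsets. weakly_correlated \<tau> T}"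
  have "finite ?subsets"
    using F(1,2) by auto
  moreover have "\<T> \<subseteq> ?subsets"
    unfolding \<T>_def by (rule Collect_restrict)
  ultimately have "finite \<T>" "card \<T> \<le> card ?subsets"
    using finite_subset card_mono by blast+
  then have "card \<T> < exp (t * (1 - t * \<tau>) * h * m)"
    using card_UN_subsets_of_card_le[where F = F and t = t, OF F(1,2,4)] m by linarith
  then obtain W where W: "finite W" "W \<subseteq> hbox n 0 l" "card W \<le> m"
    "\<And>T. T \<in> \<T> \<Longrightarrow> \<exists>z\<in>W. \<exists>p\<in>T. p + z \<in> S"
    using \<open>finite \<T>\<close> F(3) unfolding \<T>_def
    by (elim meet_weakly_correlated_sets[OF h t \<tau>, rotated -1]) auto
  then show ?thesis
    by (intro that[OF W(1-3)] W(4)) (auto simp: \<T>_def)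
qed

lemma two_stage_cover:
  fixes h \<tau> b :: real and m t J :: nat
  assumes h: "h * l ^ n \<le> period_measure" "0 < h" and t: "t \<ge> 1" and \<tau>: "0 < \<tau>" "t * \<tau> < 1"
    and F: "finite Q" "\<And>c. c \<in> Q \<Longrightarrow> finite (F c)" "\<And>c. c \<in> Q \<Longrightarrow> F c \<subseteq> Rn n" "\<And>c. c \<in> Q \<Longrightarrow> card (F c) \<le> b"
    and m: "card Q * b ^ t < exp (t * (1 - t * \<tau>) * h * m)" and J: "b < exp (\<tau> * J)"
  obtains W e where "finite W" "W \<subseteq> hbox n 0 l" "card W \<le> m"
    "\<And>c q. c \<in> Q \<Longrightarrow> q \<in> F c \<Longrightarrow> \<exists>z\<in>W \<union> e c ` {..<t * J}. q + z \<in> S"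
proof -
  have pos: "0 < period_measure"
    using h l_pos by (meson less_le_trans mult_pos_pos zero_less_power)
  have "\<tau> \<le> t * \<tau>"
    using t \<tau>(1) by simp
  with \<tau> have "\<tau> < 1"
    by linarith
  obtain W where W: "finite W" "W \<subseteq> hbox n 0 l" "card W \<le> m"
    "\<And>c T. c \<in> Q \<Longrightarrow> T \<subseteq> F c \<Longrightarrow> card T = t \<Longrightarrow> weakly_correlated \<tau> T \<Longrightarrow> \<exists>z\<in>W. \<exists>p\<in>T. p + z \<in> S"
    using meet_weakly_correlated_subsets[where F = F, OF h(1) t \<tau> F m] by blast
  have "\<exists>e. \<forall>q\<in>F c. \<exists>z\<in>W \<union> e ` {..<t * J}. q + z \<in> S" if c: "c \<in> Q" for c
  proof -
    let ?U = "{q \<in> F c. \<forall>z\<in>W. q + z \<notin> S}"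
    have "card ?U \<le> card (F c)"
      using F(2)[OF c] by (intro card_mono) auto
    then have "card ?U < exp (\<tau> * J)"
      using F(4)[OF c] J by linarith
    moreover have "card T \<noteq> t" if "T \<subseteq> ?U" "weakly_correlated \<tau> T" for T
      using W(4)[OF c, of T] that by blast
    moreover have "finite ?U" "?U \<subseteq> Rn n"
      using F(2,3)[OF c] by auto
    ultimately obtain V where V: "finite V" "card V \<le> t * J" "\<forall>q\<in>?U. \<exists>v\<in>V. q + v \<in> S"
      using cover_without_weakly_correlated_subset[of ?U \<tau> J t] pos \<tau>(1) \<open>\<tau> < 1\<close> by blast
    obtain e where e: "V \<subseteq> e ` {..<t * J}"
      using subset_image_lessThan[OF V(1,2)] by blast
    have "\<exists>z\<in>W \<union> V. q + z \<in> S" if "q \<in> F c" for q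
      using V(3) that by blast
    then show ?thesis
      using e by (meson Un_mono order_refl subsetD)
  qed
  then have "\<forall>c\<in>Q. \<exists>e. \<forall>q\<in>F c. \<exists>z\<in>W \<union> e ` {..<t * J}. q + z \<in> S" ..
  from bchoice[OF this] obtain e where
    e: "\<forall>c\<in>Q. \<forall>q\<in>F c. \<exists>z\<in>W \<union> e c ` {..<t * J}. q + z \<in> S" ..
  show ?thesis
    by (rule that[OF W(1-3)]) (rule bspec[OF bspec[OF e]])
qed

end

section \<open>Norms on the coordinate space\<close>

locale coord_norm =
  fixes n :: nat and N :: "rvec \<Rightarrow> real" and C :: real
  assumes n_pos: "n \<ge> 1"
    and N_triangle: "N (x + y) \<le> N x + N y"
    and N_scaleR: "N (r *\<^sub>R x) = \<bar>r\<bar> * N x"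
    and N_upper: "N x \<le> (\<Sum>i<n. \<bar>coord x i\<bar>)"
    and N_lower: "i < n \<Longrightarrow> \<bar>coord x i\<bar> \<le> C * N x"
begin

lemma N_zero [simp]: "N 0 = 0"
  using N_scaleR[of 0 0] by simp

lemma N_uminus [simp]: "N (- x) = N x"
  using N_scaleR[of "-1" x] by simp

lemma N_minus_commute: "N (x - y) = N (y - x)"
  using N_uminus[of "x - y"] by simp

lemma N_nonneg [simp]: "0 \<le> N x"
  using N_triangle[of x "- x"] by simp

lemma N_diff_triangle: "N (x - z) \<le> N (x - y) + N (y - z)"
  using N_triangle[of "x - y" "y - z"] by simp

lemma N_midpoint:
  "N (x + (1 / 2) *\<^sub>R (y - x) - x) = N (x - y) / 2"
  "N (x + (1 / 2) *\<^sub>R (y - x) - y) = N (x - y) / 2"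
proof -
  show "N (x + (1 / 2) *\<^sub>R (y - x) - x) = N (x - y) / 2"
    using N_minus_commute[of y x] by (simp add: N_scaleR)
  have "x + (1 / 2) *\<^sub>R (y - x) - y = (1 / 2 - 1) *\<^sub>R (y - x)"
    unfolding scaleR_left_diff_distrib by simp
  also have "\<dots> = (1 / 2) *\<^sub>R (x - y)"
    by (simp add: scaleR_diff_right)
  finally have "x + (1 / 2) *\<^sub>R (y - x) - y = (1 / 2) *\<^sub>R (x - y)" .
  then show "N (x + (1 / 2) *\<^sub>R (y - x) - y) = N (x - y) / 2"
    using N_scaleR[of "1 / 2" "x - y"] by simp
qed

lemma N_eq_0_iff:
  assumes "x \<in> Rn n"
  shows "N x = 0 \<longleftrightarrow> x = 0"
proof
  assume "N x = 0"
  then have "coord x i = 0" if "i < n" for i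
    using N_lower[OF that, of x] by simp
  then show "x = 0"
    using assms by (intro Rn_eqI[of x n 0]) auto
qed simp

lemma C_ge_1: "1 \<le> C"
proof (rule ccontr)
  assume "\<not> 1 \<le> C"
  obtain i where i: "i < n"
    using n_pos by (auto simp: Suc_le_eq)
  have "(\<Sum>j<n. \<bar>coord (unit_vec i) j\<bar>) = (\<Sum>j<n. if i = j then 1 else 0)"
    by (intro sum.cong) (simp_all add: coord_unit_vec)
  then have upper: "N (unit_vec i) \<le> 1"
    using N_upper[of "unit_vec i"] i by simp
  have "1 \<le> C * N (unit_vec i)"
    using N_lower[OF i, of "unit_vec i"] by (simp add: coord_unit_vec)
  also have "\<dots> \<le> max C 0 * 1"
    using upper by (intro mult_mono) auto
  finally show False
    using \<open>\<not> 1 \<le> C\<close> by simp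
qed

lemma N_lipschitz: "\<bar>N x - N y\<bar> \<le> norm (x - y)"
proof -
  have "N x \<le> N (x - y) + N y" "N y \<le> N (y - x) + N x"
    using N_triangle[of "x - y" y] N_triangle[of "y - x" x] by auto
  moreover have "N (x - y) \<le> norm (x - y)"
    using N_upper sum_coord_le_norm order_trans by blast
  ultimately show ?thesis
    using N_minus_commute[of x y] by linarith
qed

lemma continuous_on_N [continuous_intros]:
  assumes "continuous_on A f"
  shows "continuous_on A (\<lambda>x. N (f x))"
proof -
  have "continuous_on UNIV N"
    unfolding continuous_on_iff dist_real_def dist_norm
    using N_lipschitz by (meson le_less_trans)
  then show ?thesis
    using assms continuous_on_compose2 by blast
qed

definition nball :: "rvec \<Rightarrow> real \<Rightarrow> rvec set" where
  "nball x r = {y \<in> Rn n. N (y - x) < r}"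

definition unit_vol :: real where
  "unit_vol = measure (vol n) (nball 0 1)"

lemma nball_eq_Int: "nball x r = Rn n \<inter> {y. N (y - x) < r}"
  by (auto simp: nball_def)

lemma open_N_less: "open {y. N (y - x) < r}"
  by (intro open_Collect_less continuous_intros)

lemma openin_nball: "openin (top_of_set (Rn n)) (nball x r)"
  unfolding nball_eq_Int using open_N_less by (simp add: openin_open_Int)

lemma borel_nball [measurable]: "nball x r \<in> sets borel"
  unfolding nball_eq_Int using closed_Rn open_N_less by (intro sets.Int borel_closed borel_open)

lemma nball_subset_hbox:
  assumes "x \<in> hbox n a b"
  shows "nball x r \<subseteq> hbox n (a - C * r) (b + C * r)"
proof
  fix y assume y: "y \<in> nball x r"
  have "a - C * r \<le> coord y i \<and> coord y i < b + C * r" if i: "i < n" for i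
  proof -
    have "\<bar>coord (y - x) i\<bar> \<le> C * N (y - x)"
      by (rule N_lower[OF i])
    also have "\<dots> \<le> C * r"
      using y C_ge_1 by (intro mult_left_mono) (auto simp: nball_def)
    finally have "\<bar>coord y i - coord x i\<bar> \<le> C * r"
      by (simp add: lookup_minus)
    moreover have "a \<le> coord x i" "coord x i < b"
      using i assms by (auto simp: hbox_def)
    ultimately show ?thesis
      by linarith
  qed
  then show "y \<in> hbox n (a - C * r) (b + C * r)"
    using y by (auto simp: hbox_def nball_def)
qed

lemma nball_fmeasurable [simp]:
  assumes "x \<in> Rn n"
  shows "nball x r \<in> fmeasurable (vol n)"
proof -
  define c where "c = norm x + 1"
  have "\<bar>coord x i\<bar> < c" for i
    using abs_coord_le_norm[of x i] by (simp add: c_def)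
  then have "x \<in> hbox n (- c) c"
    using assms by (simp add: hbox_def abs_less_iff) (meson less_imp_le minus_less_iff)
  from nball_subset_hbox[OF this] show ?thesis
    by (rule fmeasurable_if_subset_hbox[OF borel_nball])
qed

lemma nball_eq_image:
  assumes "x \<in> Rn n" "r > 0"
  shows "nball x r = (\<lambda>y. x + r *\<^sub>R y) ` nball 0 1"
proof (intro set_eqI iffI)
  fix y assume y: "y \<in> nball x r"
  have "(1 / r) *\<^sub>R (y - x) \<in> nball 0 1"
    using y assms by (auto simp: nball_def N_scaleR)
  moreover have "y = x + r *\<^sub>R ((1 / r) *\<^sub>R (y - x))"
    using assms by simp
  ultimately show "y \<in> (\<lambda>y. x + r *\<^sub>R y) ` nball 0 1"
    by blast
qed (use assms in \<open>auto simp: nball_def N_scaleR\<close>)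

lemma measure_nball:
  assumes "x \<in> Rn n" "r > 0"
  shows "measure (vol n) (nball x r) = r ^ n * unit_vol"
  unfolding nball_eq_image[OF assms] unit_vol_def
  using assms by (intro measure_vol_affine_image) auto

lemma unit_vol_lower: "(1 / n) ^ n \<le> unit_vol"
proof -
  have "hbox n 0 (1 / n) \<subseteq> nball 0 1"
  proof
    fix x assume x: "x \<in> hbox n 0 (1 / n)"
    have "N x \<le> (\<Sum>i<n. \<bar>coord x i\<bar>)"
      by (rule N_upper)
    also have "\<dots> < (\<Sum>i<n. 1 / n)"
      using x n_pos by (intro sum_strict_mono) (auto simp: hbox_def lessThan_empty_iff)
    also have "\<dots> = 1"
      using n_pos by simp
    finally show "x \<in> nball 0 1"
      using x by (simp add: nball_def hbox_def)
  qed
  then have "measure (vol n) (hbox n 0 (1 / n)) \<le> unit_vol"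
    unfolding unit_vol_def by (intro measure_mono_fmeasurable) auto
  then show ?thesis
    by (simp add: measure_hbox)
qed

lemma unit_vol_pos: "unit_vol > 0"
proof -
  have "0 < (1 / real n) ^ n"
    using n_pos by simp
  with unit_vol_lower show ?thesis
    by linarith
qed

lemma le_power_if_mult_unit_vol_le:
  fixes k l :: real
  assumes "r > 0" "0 \<le> k" "k * (r ^ n * unit_vol) \<le> l ^ n"
  shows "k \<le> (l * n / r) ^ n"
proof -
  have n0: "real n > 0"
    using n_pos by simp
  have "k * (r / n) ^ n = k * (r ^ n * (1 / n) ^ n)"
    by (simp add: power_divide)
  also have "\<dots> \<le> k * (r ^ n * unit_vol)"
    using assms unit_vol_lower by (intro mult_left_mono) auto
  finally have "k * (r / n) ^ n \<le> l ^ n"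
    using assms(3) by linarith
  moreover have "(r / n) ^ n > 0"
    using assms(1) n0 by simp
  ultimately have "k \<le> l ^ n / (r / n) ^ n"
    by (simp add: pos_le_divide_eq)
  also have "\<dots> = (l * n / r) ^ n"
    by (simp add: power_divide[symmetric])
  finally show ?thesis .
qed

lemma card_disjoint_nballs_le:
  assumes P: "P \<subseteq> Rn n" and r: "r > 0" and B: "B \<in> fmeasurable (vol n)"
    and sub: "\<And>p. p \<in> P \<Longrightarrow> nball p r \<subseteq> B"
    and disj: "pairwise (\<lambda>p q. disjnt (nball p r) (nball q r)) P"
  shows "finite P" "card P * (r ^ n * unit_vol) \<le> measure (vol n) B"
proof -
  have pos: "r ^ n * unit_vol > 0"
    using r unit_vol_pos by simp
  have "card Q * (r ^ n * unit_vol) \<le> measure (vol n) B" if Q: "Q \<subseteq> P" "finite Q" for Q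
  proof -
    have "card Q * (r ^ n * unit_vol) = (\<Sum>p\<in>Q. measure (vol n) (nball p r))"
      using Q P r by (simp add: measure_nball subset_iff)
    also have "\<dots> = measure (vol n) (\<Union>p\<in>Q. nball p r)"
      using Q P by (intro measure_UNION'[symmetric] pairwise_subset[OF disj]) auto
    also have "\<dots> \<le> measure (vol n) B"
      using Q sub B by (intro measure_mono_fmeasurable) (auto intro!: sets.finite_UN)
    finally show ?thesis .
  qed
  then have "card Q \<le> nat \<lfloor>measure (vol n) B / (r ^ n * unit_vol)\<rfloor>" if "Q \<subseteq> P" "finite Q" for Q
    using that pos by (intro le_nat_floor) (simp add: pos_le_divide_eq)
  then have "finite P" "card P \<le> nat \<lfloor>measure (vol n) B / (r ^ n * unit_vol)\<rfloor>"
    using finite_if_finite_subsets_card_bdd[of P] by auto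
  then have "card P \<le> measure (vol n) B / (r ^ n * unit_vol)"
    using pos by (simp add: le_nat_iff le_floor_iff)
  then show "card P * (r ^ n * unit_vol) \<le> measure (vol n) B"
    using pos by (simp add: pos_le_divide_eq)
  show "finite P"
    by fact
qed

definition separated :: "real \<Rightarrow> rvec set \<Rightarrow> bool" where
  "separated d F \<longleftrightarrow> pairwise (\<lambda>p q. d \<le> N (p - q)) F"

lemma disjoint_nballs_if_separated:
  assumes "separated d F"
  shows "pairwise (\<lambda>p q. disjnt (nball p (d / 2)) (nball q (d / 2))) F"
proof (rule pairwiseI)
  fix p q assume pq: "p \<in> F" "q \<in> F" "p \<noteq> q"
  have False if "y \<in> nball p (d / 2)" "y \<in> nball q (d / 2)" for y
  proof -
    have "N (p - q) \<le> N (p - y) + N (y - q)"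
      by (rule N_diff_triangle)
    also have "\<dots> < d / 2 + d / 2"
      using that N_minus_commute[of p y] by (auto simp: nball_def)
    finally show False
      using assms pq by (fastforce simp: separated_def pairwise_def)
  qed
  then show "disjnt (nball p (d / 2)) (nball q (d / 2))"
    by (auto simp: disjnt_def)
qed

lemma exists_separated_net:
  obtains F where "F \<subseteq> Z" "separated d F" "\<And>z. z \<in> Z \<Longrightarrow> z \<in> F \<or> (\<exists>p\<in>F. N (z - p) < d)"
proof -
  have "d \<le> N (q - p)" if "d \<le> N (p - q)" for p q
    using that by (simp add: N_minus_commute[of q p])
  then obtain F where F: "F \<subseteq> Z" "pairwise (\<lambda>p q. d \<le> N (p - q)) F"
    "\<And>z. z \<in> Z - F \<Longrightarrow> \<exists>p\<in>F. \<not> d \<le> N (z - p)"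
    using exists_maximal_separated_set[of "\<lambda>p q. d \<le> N (p - q)" Z] by blast
  show ?thesis
  proof (rule that[of F])
    show "z \<in> F \<or> (\<exists>p\<in>F. N (z - p) < d)" if "z \<in> Z" for z
      using F(3)[of z] that by (auto simp: not_le)
  qed (use F in \<open>auto simp: separated_def\<close>)
qed

lemma exists_finite_net:
  assumes Z: "Z \<subseteq> Rn n" and d: "d > 0" and B: "B \<in> fmeasurable (vol n)"
    and sub: "\<And>p. p \<in> Z \<Longrightarrow> nball p (d / 2) \<subseteq> B"
  obtains F where "finite F" "F \<subseteq> Z" "card F * ((d / 2) ^ n * unit_vol) \<le> measure (vol n) B"
    and "\<And>z. z \<in> Z \<Longrightarrow> \<exists>p\<in>F. N (z - p) < d"
proof -
  obtain F where F: "F \<subseteq> Z" "separated d F" "\<And>z. z \<in> Z \<Longrightarrow> z \<in> F \<or> (\<exists>p\<in>F. N (z - p) < d)"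
    using exists_separated_net by blast
  have "\<exists>p\<in>F. N (z - p) < d" if "z \<in> Z" for z
    using F(3)[OF that] d by force
  moreover have "finite F" "card F * ((d / 2) ^ n * unit_vol) \<le> measure (vol n) B"
    using card_disjoint_nballs_le[OF _ _ B _ disjoint_nballs_if_separated[OF F(2)]] F(1) Z d sub
    by (meson half_gt_zero subset_iff)+
  ultimately show ?thesis
    using F(1) by (intro that)
qed

lemma hbox_net:
  fixes d l :: real
  assumes d: "0 < d" "d \<le> 1" and l: "C \<le> l"
  obtains X where "finite X" "X \<subseteq> Rn n" "card X \<le> (4 * l * n / d) ^ n"
    "\<And>y. y \<in> hbox n 0 l \<Longrightarrow> \<exists>x\<in>X. N (y - x) < d"
proof -
  let ?B = "hbox n (0 - C * (d / 2)) (l + C * (d / 2))"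
  obtain X where X: "finite X" "X \<subseteq> hbox n 0 l" "card X * ((d / 2) ^ n * unit_vol) \<le> measure (vol n) ?B"
    "\<And>y. y \<in> hbox n 0 l \<Longrightarrow> \<exists>x\<in>X. N (y - x) < d"
  proof (rule exists_finite_net[of "hbox n 0 l" d ?B])
    show "nball p (d / 2) \<subseteq> ?B" if "p \<in> hbox n 0 l" for p
      by (rule nball_subset_hbox[OF that])
  qed (use d hbox_Rn in auto)
  have "0 \<le> C * d" "C * d \<le> C * 1"
    using d C_ge_1 by (auto intro!: mult_left_mono)
  then have "measure (vol n) ?B = (l + C * d) ^ n"
    using l C_ge_1 by (subst measure_hbox) (auto simp: add.commute)
  also have "\<dots> \<le> (2 * l) ^ n"
    using \<open>0 \<le> C * d\<close> \<open>C * d \<le> C * 1\<close> l C_ge_1 by (intro power_mono) linarith+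
  finally have "card X \<le> (2 * l * n / (d / 2)) ^ n"
    using X(3) d by (intro le_power_if_mult_unit_vol_le) auto
  then have "card X \<le> (4 * l * n / d) ^ n"
    by (simp add: mult.assoc)
  with X show ?thesis
    by (intro that[of X]) (auto simp: hbox_def)
qed

lemma unit_ball_net:
  assumes d: "0 < d" and c: "c \<in> Rn n"
  obtains F where "finite F" "F \<subseteq> Rn n" "card F \<le> (2 / d + 1) ^ n"
    "\<And>y. y \<in> Rn n \<Longrightarrow> N (y - c) \<le> 1 \<Longrightarrow> \<exists>q\<in>F. N (y - q) < d"
proof -
  let ?Z = "{y \<in> Rn n. N (y - c) \<le> 1}"
  obtain F where F: "finite F" "F \<subseteq> ?Z"
    "card F * ((d / 2) ^ n * unit_vol) \<le> measure (vol n) (nball c (1 + d / 2))"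
    "\<And>y. y \<in> ?Z \<Longrightarrow> \<exists>q\<in>F. N (y - q) < d"
  proof (rule exists_finite_net[of ?Z d "nball c (1 + d / 2)"])
    show "nball p (d / 2) \<subseteq> nball c (1 + d / 2)" if "p \<in> ?Z" for p
    proof
      fix y assume "y \<in> nball p (d / 2)"
      then show "y \<in> nball c (1 + d / 2)"
        using that N_diff_triangle[of y c p] by (simp add: nball_def)
    qed
  qed (use d c in auto)
  have "card F * (d / 2) ^ n * unit_vol \<le> (1 + d / 2) ^ n * unit_vol"
    using F(3) d c by (simp add: measure_nball mult_ac)
  then have "card F * (d / 2) ^ n \<le> (1 + d / 2) ^ n"
    using unit_vol_pos by simp
  then have "card F \<le> (1 + d / 2) ^ n / (d / 2) ^ n"
    using d by (simp add: pos_le_divide_eq)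
  also have "\<dots> = ((1 + d / 2) / (d / 2)) ^ n"
    by (simp only: power_divide)
  also have "(1 + d / 2) / (d / 2) = 2 / d + 1"
    using d by (simp add: field_simps)
  finally show ?thesis
    using F by (intro that[of F]) auto
qed

end

section \<open>Colourings and sets avoiding the distance 1\<close>

definition shift_set :: "nat \<Rightarrow> rvec \<Rightarrow> rvec set \<Rightarrow> rvec set" where
  "shift_set n z S = {q \<in> Rn n. q + z \<in> S}"

lemma periodic_shift_set:
  assumes "periodic n l S" "z \<in> Rn n"
  shows "periodic n l (shift_set n z S)"
  unfolding periodic_def
proof (intro ballI)
  fix y w assume yw: "y \<in> Rn n" "w \<in> period_lattice n l"
  then have "(y + z) + w \<in> S \<longleftrightarrow> y + z \<in> S"
    using assms unfolding periodic_def by (meson Rn_add)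
  then show "y + w \<in> shift_set n z S \<longleftrightarrow> y \<in> shift_set n z S"
    using yw period_lattice_Rn[OF yw(2)] by (simp add: shift_set_def add_ac)
qed

context coord_norm
begin

definition avoids_one :: "rvec set \<Rightarrow> bool" where
  "avoids_one B \<longleftrightarrow> (\<forall>x\<in>B. \<forall>y\<in>B. N (x - y) \<noteq> 1)"

definition colorable :: "nat \<Rightarrow> bool" where
  "colorable m \<longleftrightarrow> (\<exists>c :: rvec \<Rightarrow> nat. c ` Rn n \<subseteq> {..<m} \<and>
     (\<forall>x\<in>Rn n. \<forall>y\<in>Rn n. N (x - y) = 1 \<longrightarrow> c x \<noteq> c y))"

definition thicken :: "real \<Rightarrow> rvec set \<Rightarrow> rvec set" where
  "thicken \<delta> S = {y \<in> Rn n. \<exists>q\<in>S. N (y - q) < \<delta>}"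

lemma colorable_if_cover:
  assumes \<B>: "finite \<B>" "card \<B> \<le> m" and cover: "Rn n \<subseteq> \<Union>\<B>" and avoids: "\<And>B. B \<in> \<B> \<Longrightarrow> avoids_one B"
  shows "colorable m"
proof -
  obtain f where f: "bij_betw f \<B> {..<card \<B>}"
    using ex_bij_betw_finite_nat[OF \<B>(1)] by (auto simp: atLeast0LessThan)
  have "\<forall>y\<in>Rn n. \<exists>B. B \<in> \<B> \<and> y \<in> B"
    using cover by blast
  then obtain B where B: "\<And>y. y \<in> Rn n \<Longrightarrow> B y \<in> \<B> \<and> y \<in> B y"
    by metis
  have "f (B y) < card \<B>" if "y \<in> Rn n" for y
    using bij_betwE[OF f] B[OF that] by blast
  moreover have "f (B x) \<noteq> f (B y)" if "x \<in> Rn n" "y \<in> Rn n" "N (x - y) = 1" for x y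
  proof
    assume "f (B x) = f (B y)"
    then have "B x = B y"
      using inj_onD[OF bij_betw_imp_inj_on[OF f]] B that(1,2) by blast
    then show False
      using avoids[of "B x"] B[of x] B[of y] that unfolding avoids_one_def by metis
  qed
  ultimately show ?thesis
    using \<B>(2) unfolding colorable_def
    by (intro exI[of _ "\<lambda>y. f (B y)"]) (auto intro: less_le_trans)
qed

section \<open>A bound for all dimensions\<close>

lemma card_separated_near_le:
  assumes F: "F \<subseteq> Rn n" "separated (1 / 2) F" and p: "p \<in> Rn n"
    and near: "\<And>q. q \<in> F \<Longrightarrow> N (q - p) < 2"
  shows "finite F" "card F \<le> 9 ^ n"
proof -
  have sub: "nball q (1 / 2 / 2) \<subseteq> nball p (9 / 4)" if "q \<in> F" for q
  proof
    fix y assume "y \<in> nball q (1 / 2 / 2)"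
    then show "y \<in> nball p (9 / 4)"
      using near[OF that] N_diff_triangle[of y p q] by (simp add: nball_def)
  qed
  have "(0::real) < 1 / 2 / 2"
    by simp
  note bound = card_disjoint_nballs_le[OF F(1) this nball_fmeasurable[OF p] sub
      disjoint_nballs_if_separated[OF F(2)]]
  show "finite F"
    using bound(1) by blast
  have "card F * (1 / 4) ^ n * unit_vol \<le> (9 / 4) ^ n * unit_vol"
    using bound(2) p by (simp add: measure_nball mult_ac)
  then have "card F * (1 / 4) ^ n \<le> (9 * (1 / 4)) ^ n"
    using unit_vol_pos by simp
  then have "card F \<le> (9 :: real) ^ n"
    unfolding power_mult_distrib by simp
  then show "card F \<le> 9 ^ n"
    by (simp flip: of_nat_le_iff)
qed

lemma separated_coloring:
  assumes F: "F \<subseteq> Rn n" "separated (1 / 2) F"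
  obtains c :: "rvec \<Rightarrow> nat" where "\<And>p. c p < 9 ^ n" "\<And>k. separated 2 {p \<in> F. c p = k}"
proof -
  define conflict where "conflict p q \<longleftrightarrow> p \<in> F \<and> q \<in> F \<and> p \<noteq> q \<and> N (q - p) < 2" for p q
  have degree: "finite {q. conflict p q} \<and> card {q. conflict p q} < 9 ^ n" for p
  proof (cases "p \<in> F")
    case True
    let ?near = "{q \<in> F. N (q - p) < 2}"
    have near: "?near \<subseteq> Rn n" "separated (1 / 2) ?near" "p \<in> Rn n" "p \<in> ?near"
      using F(1) pairwise_subset[OF F(2)[unfolded separated_def], of ?near] True
      by (auto simp: separated_def)
    then have card_near: "finite ?near" "card ?near \<le> 9 ^ n"
      using card_separated_near_le[OF near(1-3)] by blast+
    have conflict_p: "{q. conflict p q} = ?near - {p}"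
      using True by (auto simp: conflict_def)
    have "card {q. conflict p q} < card ?near"
      unfolding conflict_p by (intro card_Diff1_less card_near(1) near(4))
    with card_near show ?thesis
      unfolding conflict_p by simp
  qed (simp add: conflict_def)
  obtain c :: "rvec \<Rightarrow> nat" where c: "\<And>p. c p < 9 ^ n" "\<And>p q. conflict p q \<Longrightarrow> c p \<noteq> c q"
  proof (rule greedy_coloring[of conflict "9 ^ n"])
    show "conflict q p" if "conflict p q" for p q
      using that N_minus_commute[of p q] by (auto simp: conflict_def)
  qed (use degree in \<open>auto simp: conflict_def\<close>)
  have "separated 2 {p \<in> F. c p = k}" for k
    unfolding separated_def
  proof (rule pairwiseI)
    fix p q assume "p \<in> {p \<in> F. c p = k}" "q \<in> {p \<in> F. c p = k}" "p \<noteq> q"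
    then have "\<not> conflict q p" "p \<in> F" "q \<in> F"
      using c(2)[of q p] by auto
    with \<open>p \<noteq> q\<close> show "2 \<le> N (p - q)"
      by (simp add: conflict_def)
  qed
  with c(1) show ?thesis
    by (rule that)
qed

lemma avoids_one_thicken_separated:
  assumes "separated 2 F"
  shows "avoids_one (thicken (1 / 2) F)"
  unfolding avoids_one_def
proof (intro ballI)
  fix x y assume "x \<in> thicken (1 / 2) F" "y \<in> thicken (1 / 2) F"
  then obtain p q where pq: "p \<in> F" "N (x - p) < 1 / 2" "q \<in> F" "N (y - q) < 1 / 2"
    unfolding thicken_def by blast
  show "N (x - y) \<noteq> 1"
  proof (cases "p = q")
    case True
    then show ?thesis
      using pq N_diff_triangle[of x y p] N_minus_commute[of p y] by simp
  next
    case False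
    then have "2 \<le> N (p - q)"
      using assms pq by (auto simp: separated_def pairwise_def)
    also have "\<dots> \<le> N (p - x) + (N (x - y) + N (y - q))"
      using N_diff_triangle[of p q x] N_diff_triangle[of x q y] by linarith
    finally show ?thesis
      using pq N_minus_commute[of p x] by auto
  qed
qed

lemma colorable_9_pow: "colorable (9 ^ n)"
proof -
  obtain F where F: "F \<subseteq> Rn n" "separated (1 / 2) F"
    "\<And>z. z \<in> Rn n \<Longrightarrow> z \<in> F \<or> (\<exists>p\<in>F. N (z - p) < 1 / 2)"
    using exists_separated_net by blast
  obtain c :: "rvec \<Rightarrow> nat" where c: "\<And>p. c p < 9 ^ n" "\<And>k. separated 2 {p \<in> F. c p = k}"
    using separated_coloring[OF F(1,2)] by blast
  let ?B = "\<lambda>k. thicken (1 / 2) {p \<in> F. c p = k}"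
  show ?thesis
  proof (rule colorable_if_cover)
    show "finite (?B ` {..<9 ^ n})" "card (?B ` {..<9 ^ n}) \<le> 9 ^ n"
      using card_image_le[of "{..<9 ^ n}" ?B] by auto
    show "avoids_one B" if "B \<in> ?B ` {..<9 ^ n}" for B
      using that avoids_one_thicken_separated[OF c(2)] by blast
    show "Rn n \<subseteq> \<Union> (?B ` {..<9 ^ n})"
    proof
      fix y assume y: "y \<in> Rn n"
      then obtain p where "p \<in> F" "N (y - p) < 1 / 2"
        using F(3)[OF y] by force
      then have "y \<in> ?B (c p)"
        using y by (auto simp: thicken_def)
      then show "y \<in> \<Union> (?B ` {..<9 ^ n})"
        using c(1) by blast
    qed
  qed
qed

section \<open>Sets with a gap around the distance 1\<close>

definition gap_set :: "real \<Rightarrow> rvec set \<Rightarrow> bool" where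
  "gap_set \<delta> S \<longleftrightarrow> (\<forall>x\<in>S. \<forall>y\<in>S. N (x - y) \<le> 1 - 2 * \<delta> \<or> 1 + 2 * \<delta> \<le> N (x - y))"

lemma gap_set_shift_set:
  assumes "gap_set \<delta> S"
  shows "gap_set \<delta> (shift_set n z S)"
  unfolding gap_set_def
proof (intro ballI)
  fix x y assume "x \<in> shift_set n z S" "y \<in> shift_set n z S"
  then show "N (x - y) \<le> 1 - 2 * \<delta> \<or> 1 + 2 * \<delta> \<le> N (x - y)"
    using assms unfolding gap_set_def shift_set_def
    by (metis (no_types, lifting) add_diff_cancel_right mem_Collect_eq)
qed

lemma avoids_one_thicken:
  assumes "gap_set \<delta> S"
  shows "avoids_one (thicken \<delta> S)"
  unfolding avoids_one_def
proof (intro ballI)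
  fix x y assume "x \<in> thicken \<delta> S" "y \<in> thicken \<delta> S"
  then obtain p q where pq: "p \<in> S" "N (x - p) < \<delta>" "q \<in> S" "N (y - q) < \<delta>"
    by (auto simp: thicken_def)
  then have "N (p - q) \<le> 1 - 2 * \<delta> \<or> 1 + 2 * \<delta> \<le> N (p - q)"
    using assms unfolding gap_set_def by blast
  moreover have "N (p - q) \<le> N (p - x) + N (x - y) + N (y - q)"
    using N_diff_triangle[of p q x] N_diff_triangle[of x q y] by linarith
  moreover have "N (x - y) \<le> N (x - p) + N (p - q) + N (q - y)"
    using N_diff_triangle[of x y p] N_diff_triangle[of p y q] by linarith
  ultimately show "N (x - y) \<noteq> 1"
    using pq N_minus_commute[of p x] N_minus_commute[of q y] by linarith
qed

lemma periodic_thicken: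
  assumes S: "periodic n l S" "S \<subseteq> Rn n"
  shows "periodic n l (thicken \<delta> S)"
proof -
  have add: "y + w \<in> thicken \<delta> S" if y: "y \<in> thicken \<delta> S" and w: "w \<in> period_lattice n l" for y w
  proof -
    obtain q where q: "y \<in> Rn n" "q \<in> S" "N (y - q) < \<delta>"
      using y by (auto simp: thicken_def)
    then have "q + w \<in> S"
      using S w unfolding periodic_def by blast
    then show ?thesis
      using q w period_lattice_Rn by (auto simp: thicken_def intro!: bexI[of _ "q + w"])
  qed
  show ?thesis
    unfolding periodic_def
  proof (intro ballI iffI)
    fix y w assume "y \<in> Rn n" and w: "w \<in> period_lattice n l"
    show "y \<in> thicken \<delta> S" if "y + w \<in> thicken \<delta> S"
      using add[OF that period_lattice_uminus[OF w]] by simp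
  qed (rule add)
qed

end

section \<open>Systems of separated cells\<close>

locale cell_system = coord_norm n N C for n N C +
  fixes l :: real and I :: "rvec set" and cell :: "rvec \<Rightarrow> rvec set" and r s :: real
  assumes l_pos: "0 < l" and finite_I: "finite I" and I_Rn: "I \<subseteq> Rn n" and s_pos: "0 < s"
    and cell_borel: "i \<in> I \<Longrightarrow> cell i \<in> sets borel"
    and cell_hbox: "i \<in> I \<Longrightarrow> cell i \<subseteq> hbox n 0 l"
    and cell_radius: "i \<in> I \<Longrightarrow> a \<in> cell i \<Longrightarrow> N (a - i) \<le> r"
    and cell_separation: "i \<in> I \<Longrightarrow> j \<in> I \<Longrightarrow> w \<in> period_lattice n l \<Longrightarrow> i \<noteq> j \<or> w \<noteq> 0 \<Longrightarrow>
      a \<in> cell i \<Longrightarrow> b \<in> cell j \<Longrightarrow> s \<le> N (a + w - b)"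
begin

definition cells :: "rvec set" where
  "cells = (\<Union>i\<in>I. \<Union>w\<in>period_lattice n l. (+) w ` cell i)"

lemma mem_cells: "y \<in> cells \<longleftrightarrow> (\<exists>i\<in>I. \<exists>w\<in>period_lattice n l. \<exists>a\<in>cell i. y = a + w)"
  by (auto simp: cells_def add.commute)

lemma cells_borel: "cells \<in> sets borel"
proof -
  have "(+) w ` cell i \<in> sets borel" if "i \<in> I" for i w
    using borel_affine_image[OF cell_borel[OF that], of 1 w] by simp
  then show ?thesis
    unfolding cells_def by (intro sets.finite_UN finite_I sets.countable_UN'' countable_period_lattice)
qed

lemma periodic_cells: "periodic n l cells"
proof -
  have add: "y + w \<in> cells" if "y \<in> cells" "w \<in> period_lattice n l" for y w
    using that unfolding mem_cells by (metis add.assoc period_lattice_add)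
  show ?thesis
    unfolding periodic_def
  proof (intro ballI iffI)
    fix y w assume "w \<in> period_lattice n l" "y + w \<in> cells"
    then show "y \<in> cells"
      using add[of "y + w" "- w"] by simp
  qed (rule add)
qed

sublocale cells: periodic_set n l cells
  using l_pos cells_borel periodic_cells by unfold_locales

lemma disjoint_cells: "pairwise (\<lambda>i j. disjnt (cell i) (cell j)) I"
proof (rule pairwiseI)
  fix i j assume "i \<in> I" "j \<in> I" "i \<noteq> j"
  then have "s \<le> 0" if "a \<in> cell i" "a \<in> cell j" for a
    using that cell_separation[of i j 0 a a] by simp
  then show "disjnt (cell i) (cell j)"
    using s_pos by (fastforce simp: disjnt_def)
qed

lemma sum_measure_cell_le: "(\<Sum>i\<in>I. measure (vol n) (cell i)) \<le> cells.period_measure"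
proof -
  have "(\<Sum>i\<in>I. measure (vol n) (cell i)) = measure (vol n) (\<Union>i\<in>I. cell i)"
    using cell_borel cell_hbox
    by (intro measure_UNION'[symmetric] finite_I disjoint_cells fmeasurable_if_subset_hbox)
  also have "\<dots> \<le> measure (vol n) (cells \<inter> hbox n 0 l)"
  proof (rule measure_mono_fmeasurable)
    show "(\<Union>i\<in>I. cell i) \<subseteq> cells \<inter> hbox n 0 l"
      using cell_hbox by (fastforce simp: mem_cells intro: bexI[of _ 0])
    show "(\<Union>i\<in>I. cell i) \<in> sets (vol n)"
      using finite_I cell_borel by (auto intro!: sets.finite_UN)
    show "cells \<inter> hbox n 0 l \<in> fmeasurable (vol n)"
      using cells_borel by (intro fmeasurable_if_subset_hbox[of _ n 0 l]) auto
  qed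
  finally show ?thesis
    by (simp add: cells.period_measure_def)
qed

lemma gap_set_cells:
  assumes \<delta>: "2 * r \<le> 1 - 2 * \<delta>" "1 + 2 * \<delta> \<le> s"
  shows "gap_set \<delta> cells"
  unfolding gap_set_def
proof (intro ballI)
  fix x y assume "x \<in> cells" "y \<in> cells"
  then obtain i v a j w b where i: "i \<in> I" "v \<in> period_lattice n l" "a \<in> cell i" "x = a + v"
    and j: "j \<in> I" "w \<in> period_lattice n l" "b \<in> cell j" "y = b + w"
    unfolding mem_cells by blast
  have xy: "x - y = a + (v - w) - b"
    using i j by (simp add: algebra_simps)
  show "N (x - y) \<le> 1 - 2 * \<delta> \<or> 1 + 2 * \<delta> \<le> N (x - y)"
  proof (cases "i = j \<and> v = w")
    case True
    then have "N (x - y) \<le> N (a - i) + N (b - i)"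
      using N_diff_triangle[of a b i] N_minus_commute[of i b] xy by simp
    then show ?thesis
      using cell_radius[OF i(1,3)] cell_radius[OF j(1,3)] True \<delta>(1) by simp
  next
    case False
    then have "s \<le> N (a + (v - w) - b)"
      using i j by (intro cell_separation) auto
    then show ?thesis
      using \<delta>(2) xy by simp
  qed
qed

lemma thicken_cell_radius:
  assumes "i \<in> I" "u \<in> thicken \<delta> (cell i)"
  shows "N (u - i) \<le> r + \<delta>"
proof -
  obtain a where "a \<in> cell i" "N (u - a) < \<delta>"
    using assms(2) by (auto simp: thicken_def)
  then show ?thesis
    using cell_radius[OF assms(1)] N_diff_triangle[of u i a] by fastforce
qed

lemma thicken_cell_separation:
  assumes "i \<in> I" "j \<in> I" "w \<in> period_lattice n l" "i \<noteq> j \<or> w \<noteq> 0"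
    and "u \<in> thicken \<delta> (cell i)" "v \<in> thicken \<delta> (cell j)"
  shows "s - 2 * \<delta> < N (u + w - v)"
proof -
  obtain a b where ab: "a \<in> cell i" "N (u - a) < \<delta>" "b \<in> cell j" "N (v - b) < \<delta>"
    using assms(5,6) by (auto simp: thicken_def)
  have "s \<le> N (a + w - b)"
    using assms(1-4) ab(1,3) by (rule cell_separation)
  also have "\<dots> \<le> N ((a + w) - (u + w)) + (N (u + w - v) + N (v - b))"
    using N_diff_triangle[of "a + w" b "u + w"] N_diff_triangle[of "u + w" b v] by linarith
  also have "N ((a + w) - (u + w)) = N (u - a)"
    by (simp add: N_minus_commute)
  finally show ?thesis
    using ab by linarith
qed

definition cellwise :: "real \<Rightarrow> rvec \<Rightarrow> (rvec \<Rightarrow> rvec set) \<Rightarrow> rvec set" where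
  "cellwise \<delta> g B =
     {y \<in> Rn n. \<exists>i\<in>I. \<exists>w\<in>period_lattice n l. y + w + g \<in> thicken \<delta> (cell i) \<and> y + w \<in> B i}"

lemma avoids_one_cellwise:
  assumes s: "1 + 2 * \<delta> \<le> s" and B: "\<And>i. i \<in> I \<Longrightarrow> avoids_one (B i)"
  shows "avoids_one (cellwise \<delta> g B)"
  unfolding avoids_one_def
proof (intro ballI)
  fix x y assume "x \<in> cellwise \<delta> g B" "y \<in> cellwise \<delta> g B"
  then obtain i v j w where i: "i \<in> I" "v \<in> period_lattice n l" "x + v + g \<in> thicken \<delta> (cell i)"
      "x + v \<in> B i"
    and j: "j \<in> I" "w \<in> period_lattice n l" "y + w + g \<in> thicken \<delta> (cell j)" "y + w \<in> B j"
    unfolding cellwise_def by blast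
  show "N (x - y) \<noteq> 1"
  proof (cases "i = j \<and> v = w")
    case True
    then have "N ((x + v) - (y + v)) \<noteq> 1"
      using B[OF i(1)] i(4) j(4) unfolding avoids_one_def by blast
    then show ?thesis
      by simp
  next
    case False
    then have "s - 2 * \<delta> < N ((x + v + g) + (w - v) - (y + w + g))"
      using i j by (intro thicken_cell_separation[of i j]) auto
    also have "(x + v + g) + (w - v) - (y + w + g) = x - y"
      by simp
    finally show ?thesis
      using s by linarith
  qed
qed

end

section \<open>Colourings on two scales\<close>

lemma (in coord_norm) cover_unit_balls:
  fixes m t J :: nat and h \<tau> \<delta> :: real
  assumes S: "periodic_set n l S" and \<delta>: "0 < \<delta>"
    and h: "h * l ^ n \<le> periodic_set.period_measure n l S" "0 < h"
    and t: "t \<ge> 1" and \<tau>: "0 < \<tau>" "t * \<tau> < 1" and Q: "finite Q" "Q \<subseteq> Rn n"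
    and m: "card Q * ((2 / \<delta> + 1) ^ n) ^ t < exp (t * (1 - t * \<tau>) * h * m)"
    and J: "(2 / \<delta> + 1) ^ n < exp (\<tau> * J)"
  obtains W e where "finite W" "W \<subseteq> hbox n 0 l" "card W \<le> m"
    "\<And>c y. c \<in> Q \<Longrightarrow> y \<in> Rn n \<Longrightarrow> N (y - c) \<le> 1 \<Longrightarrow>
      \<exists>z\<in>W \<union> e c ` {..<t * J}. y \<in> thicken \<delta> (shift_set n z S)"
proof -
  interpret S: periodic_set n l S
    by (rule S)
  have "\<exists>F. finite F \<and> F \<subseteq> Rn n \<and> card F \<le> (2 / \<delta> + 1) ^ n \<and>
      (\<forall>y\<in>Rn n. N (y - c) \<le> 1 \<longrightarrow> (\<exists>q\<in>F. N (y - q) < \<delta>))" if "c \<in> Q" for c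
    using unit_ball_net[OF \<delta>, of c] Q(2) that by (metis subsetD)
  then obtain F where F: "\<And>c. c \<in> Q \<Longrightarrow> finite (F c) \<and> F c \<subseteq> Rn n \<and> card (F c) \<le> (2 / \<delta> + 1) ^ n \<and>
      (\<forall>y\<in>Rn n. N (y - c) \<le> 1 \<longrightarrow> (\<exists>q\<in>F c. N (y - q) < \<delta>))"
    by metis
  obtain W e where W: "finite W" "W \<subseteq> hbox n 0 l" "card W \<le> m"
    and cover: "\<And>c q. c \<in> Q \<Longrightarrow> q \<in> F c \<Longrightarrow> \<exists>z\<in>W \<union> e c ` {..<t * J}. q + z \<in> S"
    by (rule S.two_stage_cover[OF h t \<tau> Q(1) _ _ _ m J, of F]) (use F in auto)
  show ?thesis
  proof (rule that[OF W])
    fix c y assume c: "c \<in> Q" and y: "y \<in> Rn n" "N (y - c) \<le> 1"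
    then obtain q where q: "q \<in> F c" "N (y - q) < \<delta>"
      using F[OF c] by blast
    then obtain z where z: "z \<in> W \<union> e c ` {..<t * J}" "q + z \<in> S"
      using cover[OF c] by blast
    have "q \<in> Rn n"
      using F[OF c] q(1) by blast
    then have "y \<in> thicken \<delta> (shift_set n z S)"
      using q(2) z(2) y(1) by (auto simp: thicken_def shift_set_def)
    with z(1) show "\<exists>z\<in>W \<union> e c ` {..<t * J}. y \<in> thicken \<delta> (shift_set n z S)" ..
  qed
qed

context cell_system
begin

lemma translated_cells_cover:
  fixes h \<delta> :: real and G :: nat
  assumes h: "h * l ^ n \<le> cells.period_measure"
    and X: "finite X" "X \<subseteq> Rn n" "card X < exp (h * G)"
    and net: "\<And>y. y \<in> hbox n 0 l \<Longrightarrow> \<exists>x\<in>X. N (y - x) < \<delta>"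
  obtains Z where "finite Z" "Z \<subseteq> hbox n 0 l" "card Z \<le> G"
    "\<And>y. y \<in> Rn n \<Longrightarrow> \<exists>g\<in>Z. \<exists>i\<in>I. \<exists>w\<in>period_lattice n l. y + w + g \<in> thicken \<delta> (cell i)"
proof -
  obtain Z where Z: "finite Z" "Z \<subseteq> hbox n 0 l" "card Z \<le> G" "\<And>x. x \<in> X \<Longrightarrow> \<exists>z\<in>Z. x + z \<in> cells"
    using cells.cover_by_translates[OF h X] by blast
  have "\<exists>g\<in>Z. \<exists>i\<in>I. \<exists>w\<in>period_lattice n l. y + w + g \<in> thicken \<delta> (cell i)" if y: "y \<in> Rn n" for y
  proof -
    obtain w where w: "w \<in> period_lattice n l" "y + w \<in> hbox n 0 l"
      using period_reduce[OF l_pos y] by blast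
    obtain x where x: "x \<in> X" "N (y + w - x) < \<delta>"
      using net[OF w(2)] by blast
    obtain g where g: "g \<in> Z" "x + g \<in> cells"
      using Z(4)[OF x(1)] by blast
    then obtain i v a where i: "i \<in> I" "v \<in> period_lattice n l" "a \<in> cell i" "x + g = a + v"
      by (auto simp: mem_cells)
    have "y + (w - v) + g \<in> Rn n"
      using y w i(2) g Z(2) by (auto simp: period_lattice_Rn hbox_Rn)
    moreover have diff: "y + (w - v) + g - a = y + w - x"
      using i(4) by (simp add: algebra_simps)
    have "N (y + (w - v) + g - a) < \<delta>"
      unfolding diff by (rule x(2))
    ultimately have "y + (w - v) + g \<in> thicken \<delta> (cell i)"
      using i(3) unfolding thicken_def by blast
    then show ?thesis
      using g(1) i w(1) by (blast intro: period_lattice_diff)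
  qed
  with Z(1-3) show ?thesis
    by (rule that)
qed

lemma mem_thicken_or_cellwise:
  fixes m :: nat
  assumes S: "periodic n l S" and W: "W \<subseteq> Rn n" and y: "y \<in> Rn n"
    and i: "i \<in> I" "w \<in> period_lattice n l" "y + w + g \<in> thicken \<delta>' (cell i)"
    and z: "z \<in> W \<union> e i ` {..<m}" "y + w \<in> thicken \<delta> (shift_set n z S)"
  shows "(\<exists>z\<in>W. y \<in> thicken \<delta> (shift_set n z S)) \<or>
    (\<exists>k<m. y \<in> cellwise \<delta>' g (\<lambda>i. thicken \<delta> (shift_set n (e i k) S)))"
proof (cases "z \<in> W")
  case True
  then have "periodic n l (thicken \<delta> (shift_set n z S))"
    using W S by (intro periodic_thicken periodic_shift_set) (auto simp: shift_set_def)
  then have "y \<in> thicken \<delta> (shift_set n z S)"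
    using z(2) y i(2) unfolding periodic_def by blast
  with True show ?thesis
    by blast
next
  case False
  then obtain k where "k < m" "z = e i k"
    using z(1) by blast
  then have "y \<in> cellwise \<delta>' g (\<lambda>i. thicken \<delta> (shift_set n (e i k) S))"
    using y i z(2) unfolding cellwise_def by blast
  with \<open>k < m\<close> show ?thesis
    by blast
qed

lemma two_scale_cover:
  fixes m G t J :: nat and h h' \<tau> \<delta> \<delta>' :: real
  assumes S: "periodic_set n l S" and \<delta>: "0 < \<delta>"
    and h: "h * l ^ n \<le> periodic_set.period_measure n l S" "0 < h"
    and \<delta>': "r + \<delta>' \<le> 1" and h': "h' * l ^ n \<le> cells.period_measure"
    and X: "finite X" "X \<subseteq> Rn n" "card X < exp (h' * G)"
    and net: "\<And>y. y \<in> hbox n 0 l \<Longrightarrow> \<exists>x\<in>X. N (y - x) < \<delta>'"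
    and t: "t \<ge> 1" and \<tau>: "0 < \<tau>" "t * \<tau> < 1"
    and m: "card I * G * ((2 / \<delta> + 1) ^ n) ^ t < exp (t * (1 - t * \<tau>) * h * m)"
    and J: "(2 / \<delta> + 1) ^ n < exp (\<tau> * J)"
  obtains Z W e where "finite Z" "card Z \<le> G" "finite W" "card W \<le> m"
    "\<And>y. y \<in> Rn n \<Longrightarrow> (\<exists>z\<in>W. y \<in> thicken \<delta> (shift_set n z S)) \<or>
      (\<exists>g\<in>Z. \<exists>k<t * J. y \<in> cellwise \<delta>' g (\<lambda>i. thicken \<delta> (shift_set n (e (i - g) k) S)))"
proof -
  obtain Z where Z: "finite Z" "Z \<subseteq> hbox n 0 l" "card Z \<le> G"
    "\<And>y. y \<in> Rn n \<Longrightarrow> \<exists>g\<in>Z. \<exists>i\<in>I. \<exists>w\<in>period_lattice n l. y + w + g \<in> thicken \<delta>' (cell i)"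
    using translated_cells_cover[OF h' X net] by blast
  define Q where "Q = (\<lambda>(i, g). i - g) ` (I \<times> Z)"
  have Q: "finite Q" "Q \<subseteq> Rn n"
    using finite_I Z(1,2) I_Rn hbox_Rn by (auto simp: Q_def intro!: Rn_diff)
  have "card Q \<le> card (I \<times> Z)"
    unfolding Q_def using finite_I Z(1) by (intro card_image_le) simp
  also have "\<dots> \<le> card I * G"
    using Z(3) by (simp add: card_cartesian_product)
  finally have "real (card Q) * ((2 / \<delta> + 1) ^ n) ^ t \<le> real (card I * G) * ((2 / \<delta> + 1) ^ n) ^ t"
    using \<delta> by (intro mult_right_mono) (simp_all only: of_nat_le_iff, simp)
  with m have card_Q: "card Q * ((2 / \<delta> + 1) ^ n) ^ t < exp (t * (1 - t * \<tau>) * h * m)"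
    by simp
  obtain W e where W: "finite W" "W \<subseteq> hbox n 0 l" "card W \<le> m"
    "\<And>c y. c \<in> Q \<Longrightarrow> y \<in> Rn n \<Longrightarrow> N (y - c) \<le> 1 \<Longrightarrow>
      \<exists>z\<in>W \<union> e c ` {..<t * J}. y \<in> thicken \<delta> (shift_set n z S)"
    using cover_unit_balls[OF S \<delta> h t \<tau> Q card_Q J] by blast
  show ?thesis
  proof (rule that[OF Z(1,3) W(1,3)])
    fix y assume y: "y \<in> Rn n"
    obtain g i w where g: "g \<in> Z" "i \<in> I" "w \<in> period_lattice n l" "y + w + g \<in> thicken \<delta>' (cell i)"
      using Z(4)[OF y] by blast
    have "i - g \<in> Q" "y + w \<in> Rn n"
      using g y by (auto simp: Q_def period_lattice_Rn)
    moreover have "N (y + w - (i - g)) \<le> 1"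
      using thicken_cell_radius[OF g(2,4)] \<delta>' by (simp add: algebra_simps)
    ultimately obtain z where z: "z \<in> W \<union> e (i - g) ` {..<t * J}" "y + w \<in> thicken \<delta> (shift_set n z S)"
      using W(4) by blast
    have "W \<subseteq> Rn n"
      using W(2) hbox_Rn by blast
    then show "(\<exists>z\<in>W. y \<in> thicken \<delta> (shift_set n z S)) \<or>
      (\<exists>g\<in>Z. \<exists>k<t * J. y \<in> cellwise \<delta>' g (\<lambda>i. thicken \<delta> (shift_set n (e (i - g) k) S)))"
      using mem_thicken_or_cellwise[OF periodic_set.S_periodic[OF S] _ y g(2-4),
          where W = W and e = "\<lambda>i. e (i - g)"] z g(1)
      by blast
  qed
qed

lemma colorable_two_scale:
  fixes m G t J :: nat and h h' \<tau> \<delta> \<delta>' :: real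
  assumes S: "periodic_set n l S" "gap_set \<delta> S" and \<delta>: "0 < \<delta>"
    and h: "h * l ^ n \<le> periodic_set.period_measure n l S" "0 < h"
    and \<delta>': "r + \<delta>' \<le> 1" "1 + 2 * \<delta>' \<le> s"
    and h': "h' * l ^ n \<le> cells.period_measure"
    and X: "finite X" "X \<subseteq> Rn n" "card X < exp (h' * G)"
    and net: "\<And>y. y \<in> hbox n 0 l \<Longrightarrow> \<exists>x\<in>X. N (y - x) < \<delta>'"
    and t: "t \<ge> 1" and \<tau>: "0 < \<tau>" "t * \<tau> < 1"
    and m: "card I * G * ((2 / \<delta> + 1) ^ n) ^ t < exp (t * (1 - t * \<tau>) * h * m)"
    and J: "(2 / \<delta> + 1) ^ n < exp (\<tau> * J)"
  shows "colorable (m + G * (t * J))"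
proof -
  obtain Z W e where Z: "finite Z" "card Z \<le> G" and W: "finite W" "card W \<le> m"
    and cover: "\<And>y. y \<in> Rn n \<Longrightarrow> (\<exists>z\<in>W. y \<in> thicken \<delta> (shift_set n z S)) \<or>
      (\<exists>g\<in>Z. \<exists>k<t * J. y \<in> cellwise \<delta>' g (\<lambda>i. thicken \<delta> (shift_set n (e (i - g) k) S)))"
    using two_scale_cover[OF S(1) \<delta> h \<delta>'(1) h' X net t \<tau> m J] by blast
  let ?fine = "\<lambda>z. thicken \<delta> (shift_set n z S)"
  let ?residual = "\<lambda>(g, k). cellwise \<delta>' g (\<lambda>i. ?fine (e (i - g) k))"
  have fine: "avoids_one (?fine z)" for z
    using S(2) by (intro avoids_one_thicken gap_set_shift_set)
  show ?thesis
  proof (rule colorable_if_cover)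
    let ?\<B> = "?fine ` W \<union> ?residual ` (Z \<times> {..<t * J})"
    show "finite ?\<B>"
      using Z W by simp
    have "card ?\<B> \<le> card W + card (Z \<times> {..<t * J})"
      using Z W by (intro order_trans[OF card_Un_le] add_mono card_image_le) auto
    also have "\<dots> \<le> m + G * (t * J)"
      using Z(2) W(2) by (intro add_mono) (auto simp: card_cartesian_product)
    finally show "card ?\<B> \<le> m + G * (t * J)" .
    show "Rn n \<subseteq> \<Union>?\<B>"
      using cover by fastforce
    show "avoids_one B" if "B \<in> ?\<B>" for B
      using that fine avoids_one_cellwise[OF \<delta>'(2)] by auto
  qed
qed

end

section \<open>Convex tilings\<close>

lemma one_minus_inverse_mult_power_le:
  fixes l q :: real
  assumes n: "n \<ge> 1" and l: "l > 0" and q: "0 \<le> q" "real n ^ 2 * q \<le> l"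
  shows "(1 - 1 / n) * l ^ n \<le> (l - q) ^ n"
proof -
  have "1 * q \<le> real n ^ 2 * q"
    using q(1) n by (intro mult_right_mono one_le_power) auto
  then have "q \<le> l"
    using q(2) by linarith
  then have "1 + real n * (- (q / l)) \<le> (1 + (- (q / l))) ^ n"
    using l by (intro Bernoulli_inequality) (simp add: field_simps)
  moreover have "real n * (q / l) \<le> 1 / n"
    using q l n by (simp add: field_simps power2_eq_square)
  ultimately have "1 - 1 / n \<le> (1 - q / l) ^ n"
    by simp
  then have "(1 - 1 / n) * l ^ n \<le> (1 - q / l) ^ n * l ^ n"
    using l by (intro mult_right_mono) auto
  also have "\<dots> = (l - q) ^ n"
    using l by (simp add: power_mult_distrib[symmetric] algebra_simps)
  finally show ?thesis .
qed

lemma Rn_interior_iff: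
  "z \<in> Rn_interior n P \<longleftrightarrow> z \<in> Rn n \<and> (\<exists>e>0. \<forall>y\<in>Rn n. dist y z < e \<longrightarrow> y \<in> P)"
proof
  assume "z \<in> Rn_interior n P"
  then obtain T where T: "openin (top_of_set (Rn n)) T" "z \<in> T" "T \<subseteq> P"
    by (auto simp: Rn_interior_def interior_of_def)
  then have "T \<subseteq> Rn n" "\<exists>e>0. \<forall>y\<in>Rn n. dist y z < e \<longrightarrow> y \<in> T"
    unfolding openin_euclidean_subtopology_iff by blast+
  then show "z \<in> Rn n \<and> (\<exists>e>0. \<forall>y\<in>Rn n. dist y z < e \<longrightarrow> y \<in> P)"
    using T by blast
next
  assume "z \<in> Rn n \<and> (\<exists>e>0. \<forall>y\<in>Rn n. dist y z < e \<longrightarrow> y \<in> P)"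
  then obtain e where e: "z \<in> Rn n" "e > 0" "\<forall>y\<in>Rn n. dist y z < e \<longrightarrow> y \<in> P"
    by blast
  have "Rn n \<inter> ball z e \<subseteq> Rn_interior n P"
    unfolding Rn_interior_def using e by (intro interior_of_maximal) (auto simp: dist_commute)
  then show "z \<in> Rn_interior n P"
    using e by auto
qed

lemma Rn_interior_maximal: "openin (top_of_set (Rn n)) U \<Longrightarrow> U \<subseteq> P \<Longrightarrow> U \<subseteq> Rn_interior n P"
  unfolding Rn_interior_def by (simp add: interior_of_maximal)

lemma Rn_interior_pullback:
  assumes T: "linear T" "bij_betw T (Rn n) (Rn n)" and z: "z \<in> Rn_interior n {y \<in> Rn n. T y \<in> P}"
  shows "T z \<in> Rn_interior n P"
proof -
  obtain U where U: "openin (top_of_set (Rn n)) U" "z \<in> U" "U \<subseteq> {y \<in> Rn n. T y \<in> P}"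
    using z by (auto simp: Rn_interior_def interior_of_def)
  have "span (Rn n) = Rn n"
    using subspace_Rn by (rule span_eq_iff[THEN iffD2])
  then obtain g where g: "linear g" "\<And>x. x \<in> Rn n \<Longrightarrow> g (T x) = x"
    using linear_inj_on_left_inverse[OF T(1), of "Rn n"] bij_betw_imp_inj_on[OF T(2)] by metis
  have image: "T ` Rn n = Rn n"
    using T(2) by (simp add: bij_betw_def)
  have "g \<in> Rn n \<rightarrow> Rn n"
  proof
    fix y assume "y \<in> Rn n"
    then obtain x where "x \<in> Rn n" "y = T x"
      using image by blast
    then show "g y \<in> Rn n"
      using g(2) by simp
  qed
  then have "openin (top_of_set (Rn n)) (Rn n \<inter> g -` U)"
    using U(1) by (intro continuous_openin_preimage[OF linear_continuous_on_Rn[OF g(1)]])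
  moreover have "Rn n \<inter> g -` U \<subseteq> P"
  proof
    fix y assume y: "y \<in> Rn n \<inter> g -` U"
    then obtain x where "x \<in> Rn n" "y = T x"
      using image by blast
    then show "y \<in> P"
      using y g(2) U(3) by auto
  qed
  moreover have "z \<in> Rn n"
    using U(2,3) by blast
  then have "T z \<in> Rn n \<inter> g -` U"
    using U(2) g(2) image by auto
  ultimately show ?thesis
    using Rn_interior_maximal by blast
qed

lemma closed_linear_vimage_Rn:
  fixes T :: "rvec \<Rightarrow> 'a::real_normed_vector"
  assumes "linear T" "closed P"
  shows "closed {y \<in> Rn n. T y \<in> P}"
proof -
  have "{y \<in> Rn n. T y \<in> P} = Rn n \<inter> T -` P"
    by auto
  then show ?thesis
    using continuous_closed_preimage[OF linear_continuous_on_Rn[OF assms(1)] closed_Rn assms(2)] by simp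
qed

lemma convex_linear_vimage_Rn:
  assumes "linear T" "convex P"
  shows "convex {y \<in> Rn n. T y \<in> P}"
proof -
  have "{y \<in> Rn n. T y \<in> P} = Rn n \<inter> T -` P"
    by auto
  then show ?thesis
    using assms by (simp add: convex_Int subspace_imp_convex subspace_Rn convex_linear_vimage)
qed

locale convex_tiling =
  fixes n :: nat and N :: "rvec \<Rightarrow> real" and \<alpha> \<beta> :: real and \<Phi> :: "rvec set" and \<psi> :: "rvec \<Rightarrow> rvec set"
  assumes \<alpha>_pos: "0 < \<alpha>" and centres_Rn: "\<Phi> \<subseteq> Rn n" and tiles_cover: "Rn n \<subseteq> (\<Union>x\<in>\<Phi>. \<psi> x)"
    and tile_closed: "x \<in> \<Phi> \<Longrightarrow> closed (\<psi> x)" and tile_convex: "x \<in> \<Phi> \<Longrightarrow> convex (\<psi> x)"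
    and tile_Rn: "x \<in> \<Phi> \<Longrightarrow> \<psi> x \<subseteq> Rn n"
    and tile_inner: "x \<in> \<Phi> \<Longrightarrow> y \<in> Rn n \<Longrightarrow> N (y - x) \<le> \<alpha> \<Longrightarrow> y \<in> \<psi> x"
    and tile_outer: "x \<in> \<Phi> \<Longrightarrow> y \<in> \<psi> x \<Longrightarrow> N (y - x) \<le> \<beta>"
    and tiles_disjoint: "x \<in> \<Phi> \<Longrightarrow> x' \<in> \<Phi> \<Longrightarrow> z \<in> Rn_interior n (\<psi> x) \<Longrightarrow>
      z \<in> Rn_interior n (\<psi> x') \<Longrightarrow> x = x'"

lemma convex_tiling_pullback:
  assumes tiling: "convex_tiling n N \<alpha> \<beta> \<Phi> \<psi>" and T: "linear T" "bij_betw T (Rn n) (Rn n)"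
    and norm: "\<And>x. x \<in> Rn n \<Longrightarrow> N (T x) = N' x / c" and c: "0 < c"
  shows "convex_tiling n N' (c * \<alpha>) (c * \<beta>) {x \<in> Rn n. T x \<in> \<Phi>} (\<lambda>x. {y \<in> Rn n. T y \<in> \<psi> (T x)})"
proof -
  interpret convex_tiling n N \<alpha> \<beta> \<Phi> \<psi>
    by (rule tiling)
  have T_Rn: "T x \<in> Rn n" if "x \<in> Rn n" for x
    using T(2) that bij_betwE by blast
  have norm_diff: "N' (y - x) \<le> c * t \<longleftrightarrow> N (T y - T x) \<le> t" if "x \<in> Rn n" "y \<in> Rn n" for x y t
    using norm[of "y - x"] that c by (simp add: linear_diff[OF T(1)] pos_divide_le_eq mult.commute)
  show ?thesis
  proof
    show "0 < c * \<alpha>"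
      using \<alpha>_pos c by simp
    show "Rn n \<subseteq> (\<Union>x\<in>{x \<in> Rn n. T x \<in> \<Phi>}. {y \<in> Rn n. T y \<in> \<psi> (T x)})"
    proof
      fix y assume y: "y \<in> Rn n"
      then obtain x where x: "x \<in> \<Phi>" "T y \<in> \<psi> x"
        using tiles_cover T_Rn by blast
      moreover obtain x' where "x' \<in> Rn n" "x = T x'"
        using T(2) x(1) centres_Rn by (auto simp: bij_betw_def)
      ultimately show "y \<in> (\<Union>x\<in>{x \<in> Rn n. T x \<in> \<Phi>}. {y \<in> Rn n. T y \<in> \<psi> (T x)})"
        using y by auto
    qed
  next
    fix x assume x: "x \<in> {x \<in> Rn n. T x \<in> \<Phi>}"
    show "closed {y \<in> Rn n. T y \<in> \<psi> (T x)}" "convex {y \<in> Rn n. T y \<in> \<psi> (T x)}"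
      using x by (auto intro!: closed_linear_vimage_Rn convex_linear_vimage_Rn T(1) tile_closed tile_convex)
    show "y \<in> {y \<in> Rn n. T y \<in> \<psi> (T x)}" if "y \<in> Rn n" "N' (y - x) \<le> c * \<alpha>" for y
      using that x T_Rn tile_inner norm_diff[of x y] by auto
    show "N' (y - x) \<le> c * \<beta>" if "y \<in> {y \<in> Rn n. T y \<in> \<psi> (T x)}" for y
      using that x tile_outer norm_diff[of x y] by auto
    fix x' z assume x': "x' \<in> {x \<in> Rn n. T x \<in> \<Phi>}"
      and z: "z \<in> Rn_interior n {y \<in> Rn n. T y \<in> \<psi> (T x)}" "z \<in> Rn_interior n {y \<in> Rn n. T y \<in> \<psi> (T x')}"
    have "T x = T x'"
      using x x' by (intro tiles_disjoint[of _ _ "T z"] Rn_interior_pullback[OF T] z) auto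
    then show "x = x'"
      using x x' T(2) by (auto simp: bij_betw_def inj_on_def)
  qed auto
qed

locale normed_tiling = coord_norm n N C + convex_tiling n N \<alpha> \<beta> \<Phi> \<psi> for n N C \<alpha> \<beta> \<Phi> \<psi>
begin

lemma normed_tiling_scale:
  assumes c: "0 < c"
  shows "normed_tiling n N C (c * \<alpha>) (c * \<beta>) {x \<in> Rn n. (1 / c) *\<^sub>R x \<in> \<Phi>}
    (\<lambda>x. {y \<in> Rn n. (1 / c) *\<^sub>R y \<in> \<psi> ((1 / c) *\<^sub>R x)})"
proof -
  have "bij_betw ((*\<^sub>R) (1 / c)) (Rn n) (Rn n)"
    using c by (intro bij_betwI[where g = "(*\<^sub>R) c"]) auto
  moreover have "N ((1 / c) *\<^sub>R x) = N x / c" for x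
    using c by (simp add: N_scaleR)
  ultimately have "convex_tiling n N (c * \<alpha>) (c * \<beta>) {x \<in> Rn n. (1 / c) *\<^sub>R x \<in> \<Phi>}
      (\<lambda>x. {y \<in> Rn n. (1 / c) *\<^sub>R y \<in> \<psi> ((1 / c) *\<^sub>R x)})"
    by (intro convex_tiling_pullback[OF convex_tiling_axioms _ _ _ c] linear_scaleR)
  then show ?thesis
    by (intro normed_tiling.intro coord_norm_axioms)
qed

lemma centres_eq_if_common_nball:
  assumes x: "x \<in> \<Phi>" "x' \<in> \<Phi>" and z: "z \<in> Rn n" "0 < \<epsilon>" and sub: "nball z \<epsilon> \<subseteq> \<psi> x" "nball z \<epsilon> \<subseteq> \<psi> x'"
  shows "x = x'"
proof -
  have "z \<in> nball z \<epsilon>"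
    using z by (simp add: nball_def)
  then show ?thesis
    using tiles_disjoint[OF x] Rn_interior_maximal[OF openin_nball] sub by blast
qed

lemma disjoint_inner_nballs: "pairwise (\<lambda>x x'. disjnt (nball x \<alpha>) (nball x' \<alpha>)) \<Phi>"
proof (rule pairwiseI)
  fix x x' assume x: "x \<in> \<Phi>" "x' \<in> \<Phi>" "x \<noteq> x'"
  have False if y: "y \<in> nball x \<alpha>" "y \<in> nball x' \<alpha>" for y
  proof -
    define \<epsilon> where "\<epsilon> = min (\<alpha> - N (y - x)) (\<alpha> - N (y - x'))"
    have "nball y \<epsilon> \<subseteq> \<psi> p" if "p \<in> {x, x'}" for p
    proof
      fix u assume "u \<in> nball y \<epsilon>"
      then have "u \<in> Rn n" "N (u - p) \<le> \<alpha>"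
        using that N_diff_triangle[of u p y] by (auto simp: nball_def \<epsilon>_def)
      then show "u \<in> \<psi> p"
        using that x by (auto intro: tile_inner)
    qed
    then have "x = x'"
      using y x(1,2) by (intro centres_eq_if_common_nball[of x x' y \<epsilon>]) (auto simp: nball_def \<epsilon>_def)
    with x(3) show False ..
  qed
  then show "disjnt (nball x \<alpha>) (nball x' \<alpha>)"
    by (auto simp: disjnt_def)
qed

definition shrunk_tile :: "real \<Rightarrow> rvec \<Rightarrow> rvec set" where
  "shrunk_tile \<rho> x = (\<lambda>y. (1 - \<rho>) *\<^sub>R x + \<rho> *\<^sub>R y) ` \<psi> x"

lemma shrunk_tile_Rn: "x \<in> \<Phi> \<Longrightarrow> shrunk_tile \<rho> x \<subseteq> Rn n"
  using tile_Rn centres_Rn by (auto simp: shrunk_tile_def intro!: Rn_add Rn_scaleR)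

lemma shrunk_tile_depth:
  assumes \<rho>: "0 < \<rho>" "\<rho> < 1" and x: "x \<in> \<Phi>" and y: "y \<in> shrunk_tile \<rho> x"
    and u: "u \<in> Rn n" "N (u - y) \<le> (1 - \<rho>) * \<alpha>"
  shows "u \<in> \<psi> x"
proof -
  obtain p where p: "p \<in> \<psi> x" "y = (1 - \<rho>) *\<^sub>R x + \<rho> *\<^sub>R p"
    using y by (auto simp: shrunk_tile_def)
  define q where "q = x + (1 / (1 - \<rho>)) *\<^sub>R (u - y)"
  have "x \<in> Rn n" "y \<in> Rn n"
    using x y centres_Rn shrunk_tile_Rn by blast+
  moreover have "N (q - x) \<le> \<alpha>"
    using u \<rho> by (simp add: q_def N_scaleR divide_le_eq mult.commute)
  ultimately have "q \<in> \<psi> x"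
    using x u(1) by (intro tile_inner) (simp_all add: q_def)
  then have "(1 - \<rho>) *\<^sub>R q + \<rho> *\<^sub>R p \<in> \<psi> x"
    using p(1) \<rho> by (intro convexD tile_convex[OF x]) auto
  moreover have "(1 - \<rho>) *\<^sub>R q + \<rho> *\<^sub>R p = u"
    using \<rho> by (simp add: q_def p scaleR_add_right)
  ultimately show ?thesis
    by simp
qed

lemma shrunk_tile_subset:
  assumes "0 < \<rho>" "\<rho> < 1" "x \<in> \<Phi>"
  shows "shrunk_tile \<rho> x \<subseteq> \<psi> x"
proof
  fix y assume y: "y \<in> shrunk_tile \<rho> x"
  then have "y \<in> Rn n"
    using shrunk_tile_Rn[OF assms(3)] by blast
  moreover have "N (y - y) \<le> (1 - \<rho>) * \<alpha>"
    using assms \<alpha>_pos by simp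
  ultimately show "y \<in> \<psi> x"
    using shrunk_tile_depth[OF assms y] by blast
qed

lemma shrunk_tile_borel:
  assumes "0 < \<rho>" "x \<in> \<Phi>"
  shows "shrunk_tile \<rho> x \<in> sets borel"
  unfolding shrunk_tile_def using assms tile_closed by (intro borel_affine_image) auto

lemma measure_shrunk_tile:
  assumes "0 < \<rho>" "x \<in> \<Phi>"
  shows "measure (vol n) (shrunk_tile \<rho> x) = \<rho> ^ n * measure (vol n) (\<psi> x)"
  unfolding shrunk_tile_def using assms tile_closed centres_Rn by (intro measure_vol_affine_image) auto

lemma shrunk_tile_radius:
  assumes "0 < \<rho>" "x \<in> \<Phi>" "a \<in> shrunk_tile \<rho> x"
  shows "N (a - x) \<le> \<rho> * \<beta>"
proof -
  obtain y where y: "y \<in> \<psi> x" "a = (1 - \<rho>) *\<^sub>R x + \<rho> *\<^sub>R y"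
    using assms(3) by (auto simp: shrunk_tile_def)
  have "a - x = \<rho> *\<^sub>R (y - x)"
    using y(2) by (simp add: algebra_simps)
  then show ?thesis
    using assms(1) tile_outer[OF assms(2) y(1)] by (simp add: N_scaleR)
qed

definition inner_centres :: "real \<Rightarrow> rvec set" where
  "inner_centres l = {x \<in> \<Phi>. \<psi> x \<subseteq> hbox n 0 l}"

lemma inner_centresD: "x \<in> inner_centres l \<Longrightarrow> x \<in> \<Phi>" "x \<in> inner_centres l \<Longrightarrow> \<psi> x \<subseteq> hbox n 0 l"
  by (auto simp: inner_centres_def)

lemma card_inner_centres:
  fixes l :: real
  assumes l: "0 < l"
  shows "finite (inner_centres l)" "card (inner_centres l) \<le> (l * n / \<alpha>) ^ n"
proof -
  have sub: "nball x \<alpha> \<subseteq> hbox n 0 l" if "x \<in> inner_centres l" for x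
    using inner_centresD[OF that] tile_inner by (fastforce simp: nball_def)
  have "inner_centres l \<subseteq> Rn n"
    using inner_centresD(1) centres_Rn by blast
  moreover have "pairwise (\<lambda>x x'. disjnt (nball x \<alpha>) (nball x' \<alpha>)) (inner_centres l)"
    using inner_centresD(1) by (blast intro: pairwise_subset[OF disjoint_inner_nballs])
  ultimately have packing: "finite (inner_centres l)"
    "card (inner_centres l) * (\<alpha> ^ n * unit_vol) \<le> measure (vol n) (hbox n 0 l)"
    using card_disjoint_nballs_le[OF _ \<alpha>_pos hbox_fmeasurable sub] by blast+
  then show "finite (inner_centres l)"
    by blast
  show "card (inner_centres l) \<le> (l * n / \<alpha>) ^ n"
    using packing(2) l by (intro le_power_if_mult_unit_vol_le \<alpha>_pos) (simp_all add: measure_hbox)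
qed

lemma shrunk_tile_separation:
  assumes \<rho>: "0 < \<rho>" "\<rho> < 1" and l: "0 < l" and x: "x \<in> inner_centres l" "x' \<in> inner_centres l"
    and w: "w \<in> period_lattice n l" "x \<noteq> x' \<or> w \<noteq> 0"
    and ab: "a \<in> shrunk_tile \<rho> x" "b \<in> shrunk_tile \<rho> x'"
  shows "2 * (1 - \<rho>) * \<alpha> \<le> N (a + w - b)"
proof (rule ccontr)
  assume less: "\<not> ?thesis"
  define z where "z = a + w + (1 / 2) *\<^sub>R (b - (a + w))"
  define \<epsilon> where "\<epsilon> = (1 - \<rho>) * \<alpha> - N (a + w - b) / 2"
  have \<epsilon>: "\<epsilon> > 0"
    using less by (simp add: \<epsilon>_def algebra_simps)
  have centres: "x \<in> \<Phi>" "x' \<in> \<Phi>"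
    using x inner_centresD by blast+
  have wR: "w \<in> Rn n"
    using w(1) by (rule period_lattice_Rn)
  then have zR: "z \<in> Rn n"
    using ab centres shrunk_tile_Rn unfolding z_def by (meson Rn_add Rn_diff Rn_scaleR subsetD)
  have mid: "N (z - (a + w)) = N (a + w - b) / 2" "N (z - b) = N (a + w - b) / 2"
    unfolding z_def by (rule N_midpoint)+
  have in_tiles: "u - w \<in> \<psi> x" "u \<in> \<psi> x'" if u: "u \<in> Rn n" "N (u - z) < \<epsilon>" for u
  proof -
    have "N (u - w - a) \<le> N (u - z) + N (z - (a + w))"
      using N_diff_triangle[of u "a + w" z] by (simp add: diff_diff_eq add.commute)
    then show "u - w \<in> \<psi> x"
      using u mid(1) wR by (intro shrunk_tile_depth[OF \<rho> centres(1) ab(1)]) (auto simp: \<epsilon>_def)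
    show "u \<in> \<psi> x'"
      using u mid(2) N_diff_triangle[of u b z]
      by (intro shrunk_tile_depth[OF \<rho> centres(2) ab(2)]) (auto simp: \<epsilon>_def)
  qed
  have "z - w \<in> \<psi> x" "z \<in> \<psi> x'"
    using in_tiles[OF zR] \<epsilon> by auto
  then have "z + (- w) \<in> hbox n 0 l" "z + 0 \<in> hbox n 0 l"
    using inner_centresD(2) x by auto
  then have "- w = 0"
    using period_unique[OF l period_lattice_uminus[OF w(1)] _ period_lattice_zero] by blast
  then have "w = 0"
    by simp
  then have "nball z \<epsilon> \<subseteq> \<psi> x" "nball z \<epsilon> \<subseteq> \<psi> x'"
    using in_tiles by (auto simp: nball_def)
  then have "x = x'"
    using centres_eq_if_common_nball[OF centres zR \<epsilon>] by blast
  with w(2) \<open>w = 0\<close> show False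
    by blast
qed

lemma cell_system_shrunk_tiles:
  assumes \<rho>: "0 < \<rho>" "\<rho> < 1" and l: "0 < l"
  shows "cell_system n N C l (inner_centres l) (shrunk_tile \<rho>) (\<rho> * \<beta>) (2 * (1 - \<rho>) * \<alpha>)"
proof
  show "inner_centres l \<subseteq> Rn n"
    using inner_centresD(1) centres_Rn by blast
  show "0 < 2 * (1 - \<rho>) * \<alpha>"
    using \<rho> \<alpha>_pos by simp
  show "shrunk_tile \<rho> x \<subseteq> hbox n 0 l" if "x \<in> inner_centres l" for x
    using shrunk_tile_subset[OF \<rho>] inner_centresD[OF that] by blast
  show "shrunk_tile \<rho> x \<in> sets borel" if "x \<in> inner_centres l" for x
    using \<rho>(1) inner_centresD(1)[OF that] by (rule shrunk_tile_borel)
  show "N (a - x) \<le> \<rho> * \<beta>" if "x \<in> inner_centres l" "a \<in> shrunk_tile \<rho> x" for x a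
    using \<rho>(1) inner_centresD(1)[OF that(1)] that(2) by (rule shrunk_tile_radius)
qed (use l card_inner_centres shrunk_tile_separation[OF \<rho> l] in blast)+

lemma hbox_subset_inner_tiles: "hbox n (2 * \<beta> * C) (l - 2 * \<beta> * C) \<subseteq> (\<Union>x\<in>inner_centres l. \<psi> x)"
proof
  fix y assume y: "y \<in> hbox n (2 * \<beta> * C) (l - 2 * \<beta> * C)"
  then obtain x where x: "x \<in> \<Phi>" "y \<in> \<psi> x"
    using tiles_cover hbox_Rn by blast
  have "u \<in> hbox n 0 l" if u: "u \<in> \<psi> x" for u
  proof -
    have "N (u - y) \<le> N (u - x) + N (x - y)"
      by (rule N_diff_triangle)
    also have "\<dots> \<le> 2 * \<beta>"
      using tile_outer[OF x(1) u] tile_outer[OF x] N_minus_commute[of x y] by simp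
    finally have "C * N (u - y) \<le> C * (2 * \<beta>)"
      using C_ge_1 by (intro mult_left_mono) auto
    then have "\<bar>coord u i - coord y i\<bar> \<le> 2 * \<beta> * C" if "i < n" for i
      using N_lower[OF that, of "u - y"] by (simp add: lookup_minus mult_ac)
    moreover have "2 * \<beta> * C \<le> coord y i" "coord y i < l - 2 * \<beta> * C" if "i < n" for i
      using y that by (auto simp: hbox_def)
    ultimately have "0 \<le> coord u i \<and> coord u i < l" if "i < n" for i
      using that by (smt (verit))
    then show ?thesis
      using tile_Rn[OF x(1)] u by (auto simp: hbox_def)
  qed
  then show "y \<in> (\<Union>x\<in>inner_centres l. \<psi> x)"
    using x by (auto simp: inner_centres_def)
qed

lemma sum_measure_shrunk_tiles:
  assumes \<rho>: "0 < \<rho>" and l: "0 < l" "4 * \<beta> * C \<le> l"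
  shows "\<rho> ^ n * (l - 4 * \<beta> * C) ^ n \<le> (\<Sum>x\<in>inner_centres l. measure (vol n) (shrunk_tile \<rho> x))"
proof -
  let ?D = "hbox n (2 * \<beta> * C) (l - 2 * \<beta> * C)" and ?I = "inner_centres l"
  have tile: "\<psi> x \<in> fmeasurable (vol n)" if "x \<in> ?I" for x
    using tile_closed inner_centresD[OF that] by (intro fmeasurable_if_subset_hbox) auto
  have "measure (vol n) ?D = (l - 2 * \<beta> * C - 2 * \<beta> * C) ^ n"
    using l(2) by (intro measure_hbox) linarith
  then have "(l - 4 * \<beta> * C) ^ n = measure (vol n) ?D"
    by (simp add: mult_ac)
  also have "\<dots> \<le> measure (vol n) (\<Union>x\<in>?I. \<psi> x)"
    using card_inner_centres(1)[OF l(1)] hbox_subset_inner_tiles tile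
    by (intro measure_mono_fmeasurable fmeasurable.finite_UN) auto
  also have "\<dots> \<le> (\<Sum>x\<in>?I. measure (vol n) (\<psi> x))"
    using card_inner_centres(1)[OF l(1)] fmeasurableD[OF tile] by (intro measure_UNION_le) auto
  finally have "\<rho> ^ n * (l - 4 * \<beta> * C) ^ n \<le> \<rho> ^ n * (\<Sum>x\<in>?I. measure (vol n) (\<psi> x))"
    using \<rho> by (intro mult_left_mono) auto
  also have "\<dots> = (\<Sum>x\<in>?I. measure (vol n) (shrunk_tile \<rho> x))"
    using \<rho> inner_centresD(1) by (simp add: sum_distrib_left measure_shrunk_tile)
  finally show ?thesis .
qed

lemma exists_scaled_cell_system:
  fixes B \<gamma> \<rho> l :: real
  assumes \<gamma>: "\<beta> = \<gamma> * \<alpha>" "0 < \<gamma>" and \<rho>: "0 < \<rho>" "\<rho> < 1" and B: "0 < B"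
    and l: "0 < l" "4 * B * (real n ^ 2 * C) \<le> l"
  obtains I cell where "cell_system n N C l I cell (\<rho> * B) (2 * (B - \<rho> * B) / \<gamma>)"
    "\<rho> ^ n * (1 - 1 / n) * l ^ n \<le> periodic_set.period_measure n l (cell_system.cells n l I cell)"
    "card I \<le> (l * n / (B / \<gamma>)) ^ n"
proof -
  define c where "c = B / (\<gamma> * \<alpha>)"
  have c: "0 < c" "c * \<alpha> = B / \<gamma>" "c * \<beta> = B"
    using \<gamma> B \<alpha>_pos by (simp_all add: c_def)
  interpret scaled: normed_tiling n N C "B / \<gamma>" B "{x \<in> Rn n. (1 / c) *\<^sub>R x \<in> \<Phi>}"
      "\<lambda>x. {y \<in> Rn n. (1 / c) *\<^sub>R y \<in> \<psi> ((1 / c) *\<^sub>R x)}"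
    using normed_tiling_scale[OF c(1)] unfolding c(2,3) .
  have separation: "2 * (1 - \<rho>) * (B / \<gamma>) = 2 * (B - \<rho> * B) / \<gamma>"
    by (simp add: left_diff_distrib right_diff_distrib diff_divide_distrib)
  interpret tiles: cell_system n N C l "scaled.inner_centres l" "scaled.shrunk_tile \<rho>" "\<rho> * B"
      "2 * (B - \<rho> * B) / \<gamma>"
    using scaled.cell_system_shrunk_tiles[OF \<rho> l(1)] unfolding separation .
  have BC: "0 \<le> 4 * B * C" "real n ^ 2 * (4 * B * C) \<le> l"
    using B C_ge_1 l(2) by (simp_all add: mult_ac)
  have "1 * (4 * B * C) \<le> real n ^ 2 * (4 * B * C)"
    using n_pos BC(1) by (intro mult_right_mono one_le_power) auto
  then have "4 * B * C \<le> l"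
    using BC(2) by linarith
  have "\<rho> ^ n * ((1 - 1 / n) * l ^ n) \<le> \<rho> ^ n * (l - 4 * B * C) ^ n"
    using one_minus_inverse_mult_power_le[OF n_pos l(1) BC] \<rho> by (intro mult_left_mono) auto
  also have "\<dots> \<le> (\<Sum>x\<in>scaled.inner_centres l. measure (vol n) (scaled.shrunk_tile \<rho> x))"
    using \<rho>(1) l(1) \<open>4 * B * C \<le> l\<close> by (rule scaled.sum_measure_shrunk_tiles)
  also have "\<dots> \<le> tiles.cells.period_measure"
    by (rule tiles.sum_measure_cell_le)
  finally have "\<rho> ^ n * (1 - 1 / n) * l ^ n \<le> tiles.cells.period_measure"
    by (simp add: mult.assoc)
  then show ?thesis
    by (rule that[OF tiles.cell_system_axioms _ scaled.card_inner_centres(2)[OF l(1)]])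
qed

lemma exists_fine_gap_set:
  fixes \<eta> \<gamma> l :: real
  assumes \<gamma>: "\<beta> = \<gamma> * \<alpha>" "1 \<le> \<gamma>" and \<eta>: "0 < \<eta>" "\<eta> < 1"
    and l: "0 < l" "2 * (1 + \<gamma>) * (real n ^ 2 * C) \<le> l"
  obtains S where "periodic_set n l S" "gap_set (\<eta> / (2 * \<gamma>)) S"
    "((1 - \<eta>) / (1 + \<gamma>)) ^ n * (1 - 1 / n) * l ^ n \<le> periodic_set.period_measure n l S"
proof -
  define \<rho> where "\<rho> = (1 - \<eta>) / (1 + \<gamma>)"
  define B where "B = (1 + \<gamma>) / 2"
  have \<rho>: "0 < \<rho>" "\<rho> < 1" and B: "0 < B"
    using \<eta> \<gamma>(2) by (auto simp: \<rho>_def B_def)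
  have \<rho>B: "\<rho> * B = (1 - \<eta>) / 2"
    using \<gamma>(2) by (simp add: \<rho>_def B_def)
  have separation: "2 * (B - \<rho> * B) / \<gamma> = 1 + 2 * (\<eta> / (2 * \<gamma>))"
    unfolding \<rho>B using \<gamma>(2) by (simp add: B_def field_simps)
  have "4 * B = 2 * (1 + \<gamma>)"
    by (simp add: B_def)
  then have "4 * B * (real n ^ 2 * C) \<le> l"
    using l(2) by (simp only:)
  then obtain I cell where sys: "cell_system n N C l I cell (\<rho> * B) (2 * (B - \<rho> * B) / \<gamma>)"
    and dens: "\<rho> ^ n * (1 - 1 / n) * l ^ n \<le> periodic_set.period_measure n l (cell_system.cells n l I cell)"
    using exists_scaled_cell_system[OF \<gamma>(1) _ \<rho> B l(1)] \<gamma>(2) by (metis zero_less_one less_le_trans)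
  interpret tiles: cell_system n N C l I cell "\<rho> * B" "2 * (B - \<rho> * B) / \<gamma>"
    by (rule sys)
  have "2 * (\<eta> / (2 * \<gamma>)) \<le> \<eta>"
    using \<gamma>(2) \<eta>(1) by (simp add: divide_le_eq)
  then have "gap_set (\<eta> / (2 * \<gamma>)) tiles.cells"
    using separation by (intro tiles.gap_set_cells) (simp_all add: \<rho>B)
  then show ?thesis
    using that[OF tiles.cells.periodic_set_axioms] dens by (simp add: \<rho>_def)
qed

text \<open>The scale is chosen such that the separation exceeds 1 and the radius stays below 1, each by
  enough to thicken the cells by \<open>1 / 20\<close>, while the density remains exponentially larger than
  \<open>(1 + \<gamma>)\<^sup>-\<^sup>n\<close>.\<close>

lemma exists_coarse_cell_system:
  fixes \<gamma> l :: real
  assumes \<gamma>: "\<beta> = \<gamma> * \<alpha>" "1 \<le> \<gamma>" and l: "0 < l" "14 / 5 * (1 + \<gamma>) * (real n ^ 2 * C) \<le> l"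
  obtains I cell s where "cell_system n N C l I cell (21 / 25) s" "28 / 25 \<le> s"
    "(6 / (5 * (1 + \<gamma>))) ^ n * (1 - 1 / n) * l ^ n
      \<le> periodic_set.period_measure n l (cell_system.cells n l I cell)"
    "card I \<le> (2 * l * n) ^ n"
proof -
  define \<theta> where "\<theta> = 6 / (5 * (1 + \<gamma>))"
  define B where "B = 7 / 10 * (1 + \<gamma>)"
  have \<theta>: "0 < \<theta>" "\<theta> < 1" and B: "0 < B"
    using \<gamma>(2) by (auto simp: \<theta>_def B_def)
  have \<theta>B: "\<theta> * B = 21 / 25"
  proof -
    have "6 / (5 * g) * (7 / 10 * g) = 21 / 25" if "g \<noteq> 0" for g :: real
      using that by simp
    then show ?thesis
      using \<gamma>(2) by (simp only: \<theta>_def B_def)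
  qed
  have separation: "28 / 25 \<le> 2 * (B - \<theta> * B) / \<gamma>"
    unfolding \<theta>B using \<gamma>(2) by (simp add: B_def field_simps)
  have "4 * B = 14 / 5 * (1 + \<gamma>)"
    by (simp add: B_def)
  then have "4 * B * (real n ^ 2 * C) \<le> l"
    using l(2) by (simp only:)
  then obtain I cell where sys: "cell_system n N C l I cell (\<theta> * B) (2 * (B - \<theta> * B) / \<gamma>)"
    and dens: "\<theta> ^ n * (1 - 1 / n) * l ^ n \<le> periodic_set.period_measure n l (cell_system.cells n l I cell)"
    and card: "card I \<le> (l * n / (B / \<gamma>)) ^ n"
    using exists_scaled_cell_system[OF \<gamma>(1) _ \<theta> B l(1)] \<gamma>(2) by (metis zero_less_one less_le_trans)
  have "1 / 2 \<le> B / \<gamma>"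
    using \<gamma>(2) by (simp add: B_def pos_le_divide_eq)
  then have "l * n / (B / \<gamma>) \<le> l * n / (1 / 2)"
    using l(1) B \<gamma>(2) by (intro divide_left_mono) auto
  then have "(l * n / (B / \<gamma>)) ^ n \<le> (2 * l * n) ^ n"
    using l(1) B \<gamma>(2) by (intro power_mono) auto
  then show ?thesis
    using that[OF sys[unfolded \<theta>B] separation[unfolded \<theta>B]] dens card by (simp add: \<theta>_def)
qed

lemma colorable_tiling:
  fixes m G t J :: nat and \<tau> \<eta> \<gamma> l :: real
  assumes \<gamma>: "\<beta> = \<gamma> * \<alpha>" "1 \<le> \<gamma>" and n: "n \<ge> 2" and \<eta>: "0 < \<eta>" "\<eta> < 1"
    and l: "3 * (1 + \<gamma>) * (real n ^ 2 * C) \<le> l"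
    and G: "(80 * l * n) ^ n < exp ((6 / (5 * (1 + \<gamma>))) ^ n * (1 - 1 / n) * G)"
    and t: "t \<ge> 1" and \<tau>: "0 < \<tau>" "t * \<tau> < 1"
    and m: "(2 * l * n) ^ n * G * ((4 * \<gamma> / \<eta> + 1) ^ n) ^ t
      < exp (t * (1 - t * \<tau>) * (((1 - \<eta>) / (1 + \<gamma>)) ^ n * (1 - 1 / n)) * m)"
    and J: "(4 * \<gamma> / \<eta> + 1) ^ n < exp (\<tau> * J)"
  shows "colorable (m + G * (t * J))"
proof -
  define L where "L = (1 + \<gamma>) * (real n ^ 2 * C)"
  have "1 * C \<le> real n ^ 2 * C" "1 * (real n ^ 2 * C) \<le> L"
    using \<gamma>(2) n C_ge_1 unfolding L_def by (intro mult_right_mono one_le_power; simp)+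
  moreover have "3 * L \<le> l" "2 * (1 + \<gamma>) * (real n ^ 2 * C) = 2 * L"
    "14 / 5 * (1 + \<gamma>) * (real n ^ 2 * C) = 14 / 5 * L"
    using l by (simp_all only: L_def mult.assoc)
  ultimately have l_bounds: "0 < l" "C \<le> l" "2 * (1 + \<gamma>) * (real n ^ 2 * C) \<le> l"
    "14 / 5 * (1 + \<gamma>) * (real n ^ 2 * C) \<le> l"
    using C_ge_1 by linarith+
  have n_inv: "0 < 1 - 1 / real n"
    using n by simp
  let ?\<delta> = "\<eta> / (2 * \<gamma>)"
  have \<delta>: "0 < ?\<delta>" "2 / ?\<delta> + 1 = 4 * \<gamma> / \<eta> + 1"
    using \<eta> \<gamma>(2) by simp_all
  obtain S where S: "periodic_set n l S" "gap_set ?\<delta> S"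
    and fine: "((1 - \<eta>) / (1 + \<gamma>)) ^ n * (1 - 1 / n) * l ^ n \<le> periodic_set.period_measure n l S"
    using exists_fine_gap_set[OF \<gamma> \<eta> l_bounds(1,3)] by blast
  obtain I cell s where sys: "cell_system n N C l I cell (21 / 25) s" and s: "28 / 25 \<le> s"
    and coarse: "(6 / (5 * (1 + \<gamma>))) ^ n * (1 - 1 / n) * l ^ n
      \<le> periodic_set.period_measure n l (cell_system.cells n l I cell)"
    and card_I: "card I \<le> (2 * l * n) ^ n"
    using exists_coarse_cell_system[OF \<gamma> l_bounds(1,4)] by blast
  have twentieth: "0 < (1::real) / 20" "(1::real) / 20 \<le> 1"
    by auto
  obtain X where X: "finite X" "X \<subseteq> Rn n" "card X \<le> (4 * l * n / (1 / 20)) ^ n"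
    "\<And>y. y \<in> hbox n 0 l \<Longrightarrow> \<exists>x\<in>X. N (y - x) < 1 / 20"
    using hbox_net[OF twentieth l_bounds(2)] by blast
  have "card I * G * ((4 * \<gamma> / \<eta> + 1) ^ n) ^ t \<le> (2 * l * n) ^ n * G * ((4 * \<gamma> / \<eta> + 1) ^ n) ^ t"
    unfolding of_nat_mult using card_I \<gamma>(2) \<eta>(1) by (intro mult_right_mono) auto
  with m have m': "card I * G * ((2 / ?\<delta> + 1) ^ n) ^ t
      < exp (t * (1 - t * \<tau>) * (((1 - \<eta>) / (1 + \<gamma>)) ^ n * (1 - 1 / n)) * m)"
    unfolding \<delta>(2) by linarith
  show ?thesis
    by (rule cell_system.colorable_two_scale[OF sys S \<delta>(1) fine _ _ _ coarse X(1,2) _ X(4) t \<tau> m'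
          J[folded \<delta>(2)]])
      (use X(3) G s \<eta> \<gamma>(2) n_inv in \<open>auto simp: mult_ac\<close>)
qed

end

section \<open>The norm of a symmetric convex body\<close>

lemma eq_if_le_iff_pos:
  fixes a b :: real
  assumes "0 \<le> a" "0 \<le> b" "\<And>s. s > 0 \<Longrightarrow> a \<le> s \<longleftrightarrow> b \<le> s"
  shows "a = b"
proof (rule antisym)
  show "a \<le> b"
    by (rule field_le_epsilon) (use assms in \<open>auto simp: add_nonneg_pos\<close>)
  show "b \<le> a"
    by (rule field_le_epsilon) (use assms(3)[symmetric] assms(1,2) in \<open>auto simp: add_nonneg_pos\<close>)
qed

locale sym_body =
  fixes n :: nat and K :: "rvec set"
  assumes n_pos: "n \<ge> 1" and body: "symmetric_convex_body n K"
begin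

lemma K_Rn: "K \<subseteq> Rn n" and K_closed: "closed K" and K_bounded: "bounded K" and K_convex: "convex K"
  and K_uminus: "x \<in> K \<Longrightarrow> - x \<in> K"
  using body by (auto simp: symmetric_convex_body_def)

lemma K_inner_ball:
  obtains r where "r > 0" "\<And>y. y \<in> Rn n \<Longrightarrow> norm y \<le> r \<Longrightarrow> y \<in> K"
proof -
  obtain x where x: "x \<in> Rn_interior n K"
    using body by (auto simp: symmetric_convex_body_def)
  then obtain e where e: "e > 0" "\<And>y. y \<in> Rn n \<Longrightarrow> dist y x < e \<Longrightarrow> y \<in> K" and xR: "x \<in> Rn n"
    unfolding Rn_interior_iff by blast
  show ?thesis
  proof (rule that[of "e / 2"])
    show "e / 2 > 0"
      using e by simp
    fix y assume y: "y \<in> Rn n" "norm y \<le> e / 2"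
    have xy: "x + y \<in> K" "x - y \<in> K"
      using e y xR by (auto simp: dist_norm)
    have "(1 / 2) *\<^sub>R (x + y) + (1 / 2) *\<^sub>R (- (x - y)) \<in> K"
      by (rule convexD[OF K_convex xy(1) K_uminus[OF xy(2)]]) simp_all
    also have "(1 / 2) *\<^sub>R (x + y) + (1 / 2) *\<^sub>R (- (x - y)) = (1 / 2) *\<^sub>R (2 *\<^sub>R y)"
      unfolding scaleR_add_right[symmetric] by (simp add: scaleR_2)
    finally show "y \<in> K"
      by simp
  qed
qed

lemma zero_in_K: "0 \<in> K"
  using K_inner_ball by (metis Rn_zero less_imp_le norm_zero)

lemma K_scale: "x \<in> K \<Longrightarrow> 0 \<le> c \<Longrightarrow> c \<le> 1 \<Longrightarrow> c *\<^sub>R x \<in> K"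
  using convexD[OF K_convex, of x 0 c "1 - c"] zero_in_K by simp

lemma gauge_set: "0 < t \<Longrightarrow> x \<in> (\<lambda>y. t *\<^sub>R y) ` K \<longleftrightarrow> (1 / t) *\<^sub>R x \<in> K"
  by (auto intro!: image_eqI[of _ _ "(1 / t) *\<^sub>R x"])

lemma body_norm_eq: "body_norm K x = Inf {t. 0 < t \<and> (1 / t) *\<^sub>R x \<in> K}"
  unfolding body_norm_def using gauge_set by (intro arg_cong[of _ _ Inf]) auto

lemma gauge_bdd: "bdd_below {t. 0 < t \<and> (1 / t) *\<^sub>R x \<in> K}"
  by (auto intro: bdd_belowI[of _ 0])

lemma gauge_nonempty:
  assumes "x \<in> Rn n"
  shows "{t. 0 < t \<and> (1 / t) *\<^sub>R x \<in> K} \<noteq> {}"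
proof -
  obtain r where r: "r > 0" "\<And>y. y \<in> Rn n \<Longrightarrow> norm y \<le> r \<Longrightarrow> y \<in> K"
    using K_inner_ball by blast
  define t where "t = norm x / r + 1"
  have t: "t > 0"
    using r by (auto simp: t_def intro: add_nonneg_pos)
  have "norm x \<le> r * t"
    using r by (simp add: t_def algebra_simps)
  then have "norm ((1 / t) *\<^sub>R x) \<le> r"
    using t by (simp add: divide_le_eq)
  then show ?thesis
    using r assms t by auto
qed

lemma body_norm_nonneg: "x \<in> Rn n \<Longrightarrow> 0 \<le> body_norm K x"
  unfolding body_norm_eq using gauge_nonempty by (intro cInf_greatest) auto

lemma body_norm_le_iff:
  assumes x: "x \<in> Rn n" and s: "s > 0"
  shows "body_norm K x \<le> s \<longleftrightarrow> (1 / s) *\<^sub>R x \<in> K"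
proof
  assume "(1 / s) *\<^sub>R x \<in> K"
  then show "body_norm K x \<le> s"
    unfolding body_norm_eq using s by (intro cInf_lower gauge_bdd) auto
next
  assume le: "body_norm K x \<le> s"
  have mem: "(1 / t) *\<^sub>R x \<in> K" if t: "t > s" for t
  proof -
    have "Inf {t. 0 < t \<and> (1 / t) *\<^sub>R x \<in> K} < t"
      using le t unfolding body_norm_eq by linarith
    then obtain u where u: "0 < u" "(1 / u) *\<^sub>R x \<in> K" "u < t"
      using cInf_lessD[OF gauge_nonempty[OF x]] by blast
    have "(u / t) *\<^sub>R ((1 / u) *\<^sub>R x) \<in> K"
      by (rule K_scale[OF u(2)]) (use u in auto)
    then show ?thesis
      using u by simp
  qed
  have "(\<lambda>k. (1 / (s + 1 / real (Suc k))) *\<^sub>R x) \<longlonglongrightarrow> (1 / (s + 0)) *\<^sub>R x"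
    using s by (intro tendsto_intros LIMSEQ_Suc[OF lim_1_over_n]) auto
  moreover have "(1 / (s + 1 / real (Suc k))) *\<^sub>R x \<in> K" for k
    by (rule mem) simp
  ultimately show "(1 / s) *\<^sub>R x \<in> K"
    using closed_sequentially[OF K_closed] by (metis (no_types, lifting) add.right_neutral)
qed

lemma body_norm_le_1: "x \<in> Rn n \<Longrightarrow> body_norm K x \<le> 1 \<longleftrightarrow> x \<in> K"
  using body_norm_le_iff[of x 1] by simp

lemma body_norm_triangle:
  assumes x: "x \<in> Rn n" and y: "y \<in> Rn n"
  shows "body_norm K (x + y) \<le> body_norm K x + body_norm K y"
proof (rule field_le_epsilon)
  fix e :: real assume e: "e > 0"
  define s t where "s = body_norm K x + e / 2" and "t = body_norm K y + e / 2"
  have st: "s > 0" "t > 0" "(1 / s) *\<^sub>R x \<in> K" "(1 / t) *\<^sub>R y \<in> K"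
    using body_norm_nonneg[OF x] body_norm_nonneg[OF y] body_norm_le_iff[OF x, of s]
      body_norm_le_iff[OF y, of t] e
    by (auto simp: s_def t_def)
  have "(s / (s + t)) *\<^sub>R ((1 / s) *\<^sub>R x) + (t / (s + t)) *\<^sub>R ((1 / t) *\<^sub>R y) \<in> K"
    using st by (intro convexD[OF K_convex]) (auto simp: add_divide_distrib[symmetric])
  then have "(1 / (s + t)) *\<^sub>R (x + y) \<in> K"
    using st by (simp add: scaleR_add_right)
  then have "body_norm K (x + y) \<le> s + t"
    using st x y by (subst body_norm_le_iff) auto
  then show "body_norm K (x + y) \<le> body_norm K x + body_norm K y + e"
    by (simp add: s_def t_def)
qed

lemma K_abs_scale: "c *\<^sub>R x \<in> K \<longleftrightarrow> \<bar>c\<bar> *\<^sub>R x \<in> K"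
  using K_uminus[of "c *\<^sub>R x"] K_uminus[of "- c *\<^sub>R x"] by (cases "c \<ge> 0") auto

lemma body_norm_scaleR:
  assumes x: "x \<in> Rn n"
  shows "body_norm K (c *\<^sub>R x) = \<bar>c\<bar> * body_norm K x"
proof (rule eq_if_le_iff_pos)
  show "0 \<le> body_norm K (c *\<^sub>R x)" "0 \<le> \<bar>c\<bar> * body_norm K x"
    using x body_norm_nonneg by auto
  fix s :: real assume s: "s > 0"
  have "body_norm K (c *\<^sub>R x) \<le> s \<longleftrightarrow> (c / s) *\<^sub>R x \<in> K"
    using x s by (subst body_norm_le_iff) auto
  also have "\<dots> \<longleftrightarrow> (\<bar>c\<bar> / s) *\<^sub>R x \<in> K"
    using K_abs_scale[of "c / s" x] s by simp
  also have "\<dots> \<longleftrightarrow> \<bar>c\<bar> * body_norm K x \<le> s"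
  proof (cases "c = 0")
    case True
    then show ?thesis
      using zero_in_K s by simp
  next
    case False
    then have "(\<bar>c\<bar> / s) *\<^sub>R x \<in> K \<longleftrightarrow> body_norm K x \<le> s / \<bar>c\<bar>"
      using s by (subst body_norm_le_iff[OF x]) auto
    then show ?thesis
      using False by (simp add: pos_le_divide_eq mult.commute)
  qed
  finally show "body_norm K (c *\<^sub>R x) \<le> s \<longleftrightarrow> \<bar>c\<bar> * body_norm K x \<le> s" .
qed

lemma body_norm_sum:
  assumes "\<And>i. i \<in> I \<Longrightarrow> f i \<in> Rn n"
  shows "body_norm K (\<Sum>i\<in>I. f i) \<le> (\<Sum>i\<in>I. body_norm K (f i))"
  using assms
proof (induction I rule: infinite_finite_induct)
  case (insert i I)
  have "body_norm K (f i + (\<Sum>i\<in>I. f i)) \<le> body_norm K (f i) + body_norm K (\<Sum>i\<in>I. f i)"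
    using insert.prems by (intro body_norm_triangle Rn_sum) auto
  also have "\<dots> \<le> body_norm K (f i) + (\<Sum>i\<in>I. body_norm K (f i))"
    using insert.IH insert.prems by simp
  finally show ?case
    using insert.hyps by simp
qed (use body_norm_scaleR[of 0 0] in auto)

lemma exists_scaled_unit_vec_in_K:
  assumes "i < n"
  shows "\<exists>r>0. r *\<^sub>R unit_vec i \<in> K"
proof -
  obtain r where r: "r > 0" "\<And>y. y \<in> Rn n \<Longrightarrow> norm y \<le> r \<Longrightarrow> y \<in> K"
    using K_inner_ball by blast
  then have "r *\<^sub>R unit_vec i \<in> K"
    using unit_vec_Rn[OF assms] by (intro r(2)) (simp_all add: norm_unit_vec)
  with r(1) show ?thesis
    by blast
qed

lemma body_norm_pos:
  assumes x: "x \<in> Rn n" "x \<noteq> 0"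
  shows "0 < body_norm K x"
proof -
  obtain B where B: "B > 0" "\<And>y. y \<in> K \<Longrightarrow> norm y \<le> B"
    using K_bounded by (auto simp: bounded_pos)
  have "norm x / B \<le> s" if s: "body_norm K x < s" for s
  proof -
    have "0 < s"
      using s body_norm_nonneg[OF x(1)] by linarith
    then have "(1 / s) *\<^sub>R x \<in> K"
      using less_imp_le[OF s] body_norm_le_iff[OF x(1)] by blast
    then have "norm ((1 / s) *\<^sub>R x) \<le> B"
      by (rule B(2))
    then show ?thesis
      using \<open>0 < s\<close> B(1) by (simp add: divide_le_eq mult.commute)
  qed
  then have "norm x / B \<le> body_norm K x"
    by (rule dense_ge)
  moreover have "0 < norm x / B"
    using x(2) B(1) by simp
  ultimately show ?thesis
    by linarith
qed

lemma exists_body_norm_1: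
  obtains u where "u \<in> Rn n" "body_norm K u = 1"
proof -
  obtain i where i: "i < n"
    using n_pos by (auto simp: Suc_le_eq)
  have "unit_vec i \<noteq> 0"
    using norm_unit_vec[of i] by force
  then have "0 < body_norm K (unit_vec i)"
    using body_norm_pos unit_vec_Rn[OF i] by blast
  then show ?thesis
    using unit_vec_Rn[OF i] by (intro that[of "(1 / body_norm K (unit_vec i)) *\<^sub>R unit_vec i"])
      (simp_all add: body_norm_scaleR)
qed

end

text \<open>Coordinates with respect to such a basis are controlled by the norm with a constant that
  depends on the dimension only. The factor 2 makes it unnecessary to attain the maximum.\<close>

locale triangular_basis = sym_body +
  fixes b :: "nat \<Rightarrow> rvec"
  assumes b_K: "i < n \<Longrightarrow> b i \<in> K"
    and b_zero: "i < n \<Longrightarrow> j < i \<Longrightarrow> coord (b i) j = 0"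
    and b_pos: "i < n \<Longrightarrow> 0 < coord (b i) i"
    and b_max: "i < n \<Longrightarrow> y \<in> K \<Longrightarrow> (\<And>j. j < i \<Longrightarrow> coord y j = 0) \<Longrightarrow> coord y i \<le> 2 * coord (b i) i"
begin

lemma b_Rn: "i < n \<Longrightarrow> b i \<in> Rn n"
  using b_K K_Rn by blast

definition combination :: "nat \<Rightarrow> rvec \<Rightarrow> rvec" where
  "combination k y = (\<Sum>i\<in>{k..<n}. coord y i *\<^sub>R b i)"

lemma combination_Rn: "combination k y \<in> Rn n"
  unfolding combination_def using b_Rn by (intro Rn_sum) auto

lemma combination_Suc: "k < n \<Longrightarrow> combination k y = coord y k *\<^sub>R b k + combination (Suc k) y"
  unfolding combination_def by (simp add: sum.atLeast_Suc_lessThan)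

lemma coord_combination_eq_0: "j < k \<Longrightarrow> coord (combination k y) j = 0"
  unfolding combination_def coord_sum using b_zero by (intro sum.neutral) auto

lemma coord_combination: "k < n \<Longrightarrow> coord (combination k y) k = coord y k * coord (b k) k"
  by (simp add: combination_Suc coord_combination_eq_0 lookup_add)

lemma linear_combination: "linear (combination k)"
  unfolding combination_def
  by (intro linearI) (auto simp: lookup_add scaleR_add_left sum.distrib scaleR_sum_right)

lemma combination_unit_vec:
  assumes "k < n"
  shows "combination 0 (unit_vec k) = b k"
proof -
  have "combination 0 (unit_vec k) = (\<Sum>i\<in>{0..<n}. if i = k then b k else 0)"
    unfolding combination_def by (intro sum.cong) (auto simp: coord_unit_vec)
  then show ?thesis
    using assms by simp
qed

lemma combination_surj:
  assumes "y \<in> Rn n"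
  shows "\<exists>x\<in>Rn n. combination 0 x = y"
proof -
  have "\<exists>x\<in>Rn n. combination 0 x = y" if "k \<le> n" "y \<in> Rn n" "\<And>j. j < k \<Longrightarrow> coord y j = 0" for k y
    using that
  proof (induction k arbitrary: y rule: inc_induct)
    case base
    then have "y = 0"
      by (intro Rn_eqI[of _ n]) auto
    then show ?case
      using linear_0[OF linear_combination] by (intro bexI[of _ 0]) auto
  next
    case (step k)
    define c where "c = coord y k / coord (b k) k"
    have "coord (y - c *\<^sub>R b k) j = 0" if "j < Suc k" for j
      using that step.prems(2) step.hyps(2) b_zero[of k j] b_pos[of k]
      by (auto simp: less_Suc_eq lookup_minus c_def)
    then obtain x where x: "x \<in> Rn n" "combination 0 x = y - c *\<^sub>R b k"
      using step.IH[of "y - c *\<^sub>R b k"] step.prems(1) step.hyps(2) b_Rn by auto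
    have "combination 0 (x + c *\<^sub>R unit_vec k) = y"
      using x(2) step.hyps(2)
      by (simp add: linear_add[OF linear_combination] linear_scale[OF linear_combination]
          combination_unit_vec)
    moreover have "x + c *\<^sub>R unit_vec k \<in> Rn n"
      using x(1) step.hyps(2) by (simp add: unit_vec_Rn)
    ultimately show ?case
      by blast
  qed
  from this[of 0 y] show ?thesis
    using assms by simp
qed

lemma body_norm_combination_upper: "body_norm K (combination 0 y) \<le> (\<Sum>i<n. \<bar>coord y i\<bar>)"
proof -
  have "body_norm K (combination 0 y) \<le> (\<Sum>i\<in>{0..<n}. body_norm K (coord y i *\<^sub>R b i))"
    unfolding combination_def using b_Rn by (intro body_norm_sum) auto
  also have "\<dots> \<le> (\<Sum>i\<in>{0..<n}. \<bar>coord y i\<bar> * 1)"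
    using b_Rn b_K body_norm_le_1
    by (intro sum_mono) (auto simp: body_norm_scaleR intro!: mult_left_le)
  finally show ?thesis
    by (simp add: atLeast0LessThan)
qed

lemma abs_coord_le_body_norm:
  assumes k: "k < n" and u: "u \<in> Rn n" "\<And>j. j < k \<Longrightarrow> coord u j = 0"
  shows "\<bar>coord u k\<bar> \<le> 2 * coord (b k) k * body_norm K u"
proof -
  have "\<bar>coord u k\<bar> / (2 * coord (b k) k) \<le> s" if s: "body_norm K u < s" for s
  proof -
    have "0 < s"
      using s body_norm_nonneg[OF u(1)] by linarith
    then have mem: "(1 / s) *\<^sub>R u \<in> K"
      using less_imp_le[OF s] body_norm_le_iff[OF u(1)] by blast
    have "coord ((1 / s) *\<^sub>R u) k \<le> 2 * coord (b k) k" "coord (- ((1 / s) *\<^sub>R u)) k \<le> 2 * coord (b k) k"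
      using u(2) by (intro b_max[OF k] mem K_uminus; simp)+
    then have "\<bar>coord u k / s\<bar> \<le> 2 * coord (b k) k"
      by (simp add: abs_le_iff)
    then show ?thesis
      using \<open>0 < s\<close> b_pos[OF k] by (simp add: divide_le_eq mult_ac)
  qed
  then have "\<bar>coord u k\<bar> / (2 * coord (b k) k) \<le> body_norm K u"
    by (rule dense_ge)
  then show ?thesis
    using b_pos[OF k] by (simp add: divide_le_eq mult_ac)
qed

lemma abs_coord_le_body_norm_combination:
  assumes "k < n"
  shows "\<bar>coord y k\<bar> \<le> 2 * body_norm K (combination k y)"
proof -
  have "\<bar>coord y k\<bar> * coord (b k) k = \<bar>coord (combination k y) k\<bar>"
    using assms b_pos[OF assms] by (simp add: coord_combination abs_mult)
  also have "\<dots> \<le> 2 * coord (b k) k * body_norm K (combination k y)"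
    using assms combination_Rn coord_combination_eq_0 by (intro abs_coord_le_body_norm) auto
  finally show ?thesis
    using b_pos[OF assms] by (simp add: mult_ac)
qed

lemma body_norm_combination_le:
  "k \<le> n \<Longrightarrow> body_norm K (combination k y) \<le> 3 ^ k * body_norm K (combination 0 y)"
proof (induction k)
  case (Suc k)
  then have k: "k < n"
    by simp
  have "combination (Suc k) y = combination k y + (- coord y k) *\<^sub>R b k"
    using combination_Suc[OF k, of y] by simp
  then have "body_norm K (combination (Suc k) y)
      \<le> body_norm K (combination k y) + \<bar>coord y k\<bar> * body_norm K (b k)"
    using body_norm_triangle[OF combination_Rn, of "(- coord y k) *\<^sub>R b k" k y] b_Rn[OF k]
    by (simp only: Rn_scaleR body_norm_scaleR abs_minus_cancel)
  also have "\<bar>coord y k\<bar> * body_norm K (b k) \<le> \<bar>coord y k\<bar>"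
    using body_norm_le_1[OF b_Rn[OF k]] b_K[OF k] by (intro mult_left_le) auto
  also have "\<bar>coord y k\<bar> \<le> 2 * body_norm K (combination k y)"
    by (rule abs_coord_le_body_norm_combination[OF k])
  finally show ?case
    using Suc.IH k by simp
qed simp

lemma body_norm_combination_lower:
  assumes "i < n"
  shows "\<bar>coord y i\<bar> \<le> 3 ^ n * body_norm K (combination 0 y)"
proof -
  have nonneg: "0 \<le> body_norm K (combination 0 y)"
    by (rule body_norm_nonneg[OF combination_Rn])
  have "\<bar>coord y i\<bar> \<le> 2 * body_norm K (combination i y)"
    by (rule abs_coord_le_body_norm_combination[OF assms])
  also have "\<dots> \<le> 2 * (3 ^ i * body_norm K (combination 0 y))"
    using body_norm_combination_le[of i y] assms by simp
  also have "\<dots> \<le> 3 ^ Suc i * body_norm K (combination 0 y)"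
    using nonneg by simp
  also have "\<dots> \<le> 3 ^ n * body_norm K (combination 0 y)"
    using assms nonneg by (intro mult_right_mono power_increasing) auto
  finally show ?thesis .
qed

lemma coord_norm_combination: "coord_norm n (\<lambda>y. body_norm K (combination 0 y)) (3 ^ n)"
proof
  show "body_norm K (combination 0 (x + y)) \<le> body_norm K (combination 0 x) + body_norm K (combination 0 y)"
    for x y
    using body_norm_triangle[OF combination_Rn combination_Rn]
    by (simp add: linear_add[OF linear_combination])
  show "body_norm K (combination 0 (r *\<^sub>R x)) = \<bar>r\<bar> * body_norm K (combination 0 x)" for r x
    using body_norm_scaleR[OF combination_Rn] by (simp add: linear_scale[OF linear_combination])
qed (use n_pos body_norm_combination_upper body_norm_combination_lower in auto)

lemma bij_betw_combination: "bij_betw (combination 0) (Rn n) (Rn n)"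
  unfolding bij_betw_def
proof
  interpret coord_norm n "\<lambda>y. body_norm K (combination 0 y)" "3 ^ n"
    by (rule coord_norm_combination)
  have "x = y" if "x \<in> Rn n" "y \<in> Rn n" "combination 0 x = combination 0 y" for x y
  proof -
    have "body_norm K (combination 0 (x - y)) = body_norm K (combination 0 0)"
      using that(3) linear_0[OF linear_combination] by (simp add: linear_diff[OF linear_combination])
    then show ?thesis
      using N_eq_0_iff[of "x - y"] that(1,2) by simp
  qed
  then show "inj_on (combination 0) (Rn n)"
    by (rule inj_onI)
  show "combination 0 ` Rn n = Rn n"
    using combination_Rn combination_surj by blast
qed

end

context sym_body
begin

lemma exists_near_maximal_coord:
  assumes i: "i < n"
  shows "\<exists>x\<in>K. (\<forall>j<i. coord x j = 0) \<and> 0 < coord x i \<and>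
    (\<forall>y\<in>K. (\<forall>j<i. coord y j = 0) \<longrightarrow> coord y i \<le> 2 * coord x i)"
proof -
  define Q where "Q = {y \<in> K. \<forall>j<i. coord y j = 0}"
  obtain B where B: "\<And>y. y \<in> K \<Longrightarrow> norm y \<le> B"
    using K_bounded by (auto simp: bounded_iff)
  have bdd: "bdd_above ((\<lambda>y. coord y i) ` Q)"
  proof (rule bdd_aboveI2)
    fix y assume "y \<in> Q"
    then have "norm y \<le> B"
      using B by (simp add: Q_def)
    with abs_coord_le_norm[of y i] show "coord y i \<le> B"
      by linarith
  qed
  obtain r where r: "r > 0" "r *\<^sub>R unit_vec i \<in> K"
    using exists_scaled_unit_vec_in_K[OF i] by blast
  then have "r *\<^sub>R unit_vec i \<in> Q"
    by (auto simp: Q_def coord_unit_vec)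
  then have "Q \<noteq> {}" and "coord (r *\<^sub>R unit_vec i) i \<le> (SUP y\<in>Q. coord y i)"
    by (blast, rule cSUP_upper[OF _ bdd])
  then have sup_pos: "0 < (SUP y\<in>Q. coord y i)"
    using r(1) by (simp add: coord_unit_vec)
  then have "(SUP y\<in>Q. coord y i) / 2 < (SUP y\<in>Q. coord y i)"
    by simp
  then obtain x where x: "x \<in> Q" "(SUP y\<in>Q. coord y i) / 2 < coord x i"
    using less_cSUP_iff[OF \<open>Q \<noteq> {}\<close> bdd] by blast
  have "coord y i \<le> 2 * coord x i" if "y \<in> Q" for y
    using cSUP_upper[OF that bdd] x(2) by simp
  then show ?thesis
    using x sup_pos by (intro bexI[of _ x]) (auto simp: Q_def)
qed

lemma exists_normalised_coordinates:
  obtains T where "linear T" "bij_betw T (Rn n) (Rn n)" "coord_norm n (\<lambda>y. body_norm K (T y)) (3 ^ n)"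
proof -
  have "\<forall>i\<in>{..<n}. \<exists>x. x \<in> K \<and> (\<forall>j<i. coord x j = 0) \<and> 0 < coord x i \<and>
    (\<forall>y\<in>K. (\<forall>j<i. coord y j = 0) \<longrightarrow> coord y i \<le> 2 * coord x i)"
    using exists_near_maximal_coord by blast
  from bchoice[OF this] obtain b where "\<forall>i\<in>{..<n}. b i \<in> K \<and> (\<forall>j<i. coord (b i) j = 0) \<and> 0 < coord (b i) i \<and>
    (\<forall>y\<in>K. (\<forall>j<i. coord y j = 0) \<longrightarrow> coord y i \<le> 2 * coord (b i) i)" ..
  then interpret triangular_basis n K b
    by unfold_locales auto
  show ?thesis
    by (rule that[OF linear_combination bij_betw_combination coord_norm_combination])
qed

lemma chromatic_number_le_if_colorable:
  assumes T: "linear T" "bij_betw T (Rn n) (Rn n)" and N: "coord_norm n (\<lambda>y. body_norm K (T y)) C"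
    and colorable: "coord_norm.colorable n (\<lambda>y. body_norm K (T y)) m"
  shows "chromatic_number n K \<le> enat m"
proof -
  obtain c :: "rvec \<Rightarrow> nat" where c: "c ` Rn n \<subseteq> {..<m}"
    "\<And>x y. x \<in> Rn n \<Longrightarrow> y \<in> Rn n \<Longrightarrow> body_norm K (T (x - y)) = 1 \<Longrightarrow> c x \<noteq> c y"
    using colorable unfolding coord_norm.colorable_def[OF N] by blast
  define R where "R = inv_into (Rn n) T"
  have R: "R y \<in> Rn n" "T (R y) = y" if "y \<in> Rn n" for y
    using T(2) that by (auto simp: R_def bij_betw_def inv_into_into f_inv_into_f)
  have "proper_coloring n K m (c \<circ> R)"
    unfolding proper_coloring_def
  proof (intro conjI ballI impI)
    show "(c \<circ> R) ` Rn n \<subseteq> {..<m}"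
      using c(1) R by auto
    fix x y assume xy: "x \<in> Rn n" "y \<in> Rn n" "body_norm K (x - y) = 1"
    then have "body_norm K (T (R x - R y)) = 1"
      using R by (simp add: linear_diff[OF T(1)])
    then show "(c \<circ> R) x \<noteq> (c \<circ> R) y"
      using R xy c(2)[of "R x" "R y"] by auto
  qed
  then show ?thesis
    unfolding chromatic_number_def by (intro Inf_lower) blast
qed

lemma chromatic_number_le_9_pow: "chromatic_number n K \<le> enat (9 ^ n)"
proof -
  obtain T where T: "linear T" "bij_betw T (Rn n) (Rn n)" "coord_norm n (\<lambda>y. body_norm K (T y)) (3 ^ n)"
    by (rule exists_normalised_coordinates)
  show ?thesis
    by (rule chromatic_number_le_if_colorable[OF T coord_norm.colorable_9_pow[OF T(3)]])
qed

lemma mem_scaled_body: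
  assumes "\<alpha> > 0" "x \<in> Rn n"
  shows "y \<in> (\<lambda>y. \<alpha> *\<^sub>R y + x) ` K \<longleftrightarrow> y \<in> Rn n \<and> body_norm K (y - x) \<le> \<alpha>"
proof
  assume "y \<in> (\<lambda>y. \<alpha> *\<^sub>R y + x) ` K"
  then obtain u where u: "u \<in> K" "y = \<alpha> *\<^sub>R u + x"
    by blast
  moreover have "u \<in> Rn n"
    using u(1) K_Rn by blast
  ultimately show "y \<in> Rn n \<and> body_norm K (y - x) \<le> \<alpha>"
    using assms by (simp add: body_norm_le_iff)
next
  assume y: "y \<in> Rn n \<and> body_norm K (y - x) \<le> \<alpha>"
  then have "(1 / \<alpha>) *\<^sub>R (y - x) \<in> K"
    using assms by (simp flip: body_norm_le_iff)
  moreover have "y = \<alpha> *\<^sub>R ((1 / \<alpha>) *\<^sub>R (y - x)) + x"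
    using assms by simp
  ultimately show "y \<in> (\<lambda>y. \<alpha> *\<^sub>R y + x) ` K"
    by blast
qed

end

section \<open>The tiling parameter\<close>

definition tiling_bounds :: "rvec set \<Rightarrow> rvec set \<Rightarrow> (rvec \<Rightarrow> rvec set) \<Rightarrow> real \<Rightarrow> real \<Rightarrow> bool" where
  "tiling_bounds K \<Phi> \<psi> \<alpha> \<beta> \<longleftrightarrow> 0 < \<alpha> \<and> 0 < \<beta> \<and>
     (\<forall>x\<in>\<Phi>. (\<lambda>y. \<alpha> *\<^sub>R y + x) ` K \<subseteq> \<psi> x \<and> \<psi> x \<subseteq> (\<lambda>y. \<beta> *\<^sub>R y + x) ` K)"

definition admissible_ratio :: "nat \<Rightarrow> rvec set \<Rightarrow> nat \<Rightarrow> real \<Rightarrow> bool" where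
  "admissible_ratio n K k \<gamma> \<longleftrightarrow> (\<exists>\<Omega> \<Phi> \<Psi> \<psi> \<alpha> \<beta>. is_multilattice n \<Omega> \<Phi> \<and> num_translates \<Omega> \<Phi> \<le> k \<and>
     is_polytope_tiling n \<Psi> \<and> associated_via n \<Phi> \<Psi> \<psi> \<and> tiling_bounds K \<Phi> \<psi> \<alpha> \<beta> \<and> \<gamma> = \<beta> / \<alpha>)"

lemma tiling_parameter_eq:
  "tiling_parameter n K \<Phi> \<Psi> = Inf {ereal (\<beta> / \<alpha>) | \<alpha> \<beta> \<psi>. associated_via n \<Phi> \<Psi> \<psi> \<and> tiling_bounds K \<Phi> \<psi> \<alpha> \<beta>}"
  unfolding tiling_parameter_def tiling_bounds_def
  by (rule arg_cong[of _ _ Inf], rule Collect_cong) (simp only: conj_ac)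

lemma min_tiling_parameter_eq:
  "min_tiling_parameter n K k = (INF \<gamma>\<in>Collect (admissible_ratio n K k). ereal \<gamma>)"
proof (rule antisym)
  show "min_tiling_parameter n K k \<le> (INF \<gamma>\<in>Collect (admissible_ratio n K k). ereal \<gamma>)"
  proof (rule INF_greatest)
    fix \<gamma> assume "\<gamma> \<in> Collect (admissible_ratio n K k)"
    then obtain \<Omega> \<Phi> \<Psi> \<psi> \<alpha> \<beta> where tiling: "is_multilattice n \<Omega> \<Phi>" "num_translates \<Omega> \<Phi> \<le> k"
      "is_polytope_tiling n \<Psi>" "associated_via n \<Phi> \<Psi> \<psi>" "tiling_bounds K \<Phi> \<psi> \<alpha> \<beta>" "\<gamma> = \<beta> / \<alpha>"
      unfolding admissible_ratio_def by auto
    then have "associated n \<Phi> \<Psi>"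
      by (auto simp: associated_def)
    then have "min_tiling_parameter n K k \<le> tiling_parameter n K \<Phi> \<Psi>"
      unfolding min_tiling_parameter_def using tiling(1,2) by (intro Inf_lower) blast
    also have "\<dots> \<le> ereal \<gamma>"
      unfolding tiling_parameter_eq using tiling(4-6) by (intro Inf_lower) blast
    finally show "min_tiling_parameter n K k \<le> ereal \<gamma>" .
  qed
  show "(INF \<gamma>\<in>Collect (admissible_ratio n K k). ereal \<gamma>) \<le> min_tiling_parameter n K k"
    unfolding min_tiling_parameter_def tiling_parameter_eq
  proof (intro Inf_greatest, elim CollectE exE conjE, simp only:, intro Inf_greatest, elim CollectE exE conjE)
    fix \<Omega> \<Phi> \<Psi> r \<psi> \<alpha> \<beta>
    assume "is_multilattice n \<Omega> \<Phi>" "num_translates \<Omega> \<Phi> \<le> k" "associated n \<Phi> \<Psi>"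
      "associated_via n \<Phi> \<Psi> \<psi>" "tiling_bounds K \<Phi> \<psi> \<alpha> \<beta>"
    then have "admissible_ratio n K k (\<beta> / \<alpha>)"
      unfolding admissible_ratio_def associated_def by blast
    moreover assume "r = ereal (\<beta> / \<alpha>)"
    ultimately show "(INF \<gamma>\<in>Collect (admissible_ratio n K k). ereal \<gamma>) \<le> r"
      by (auto intro: INF_lower)
  qed
qed

context sym_body
begin

lemma admissible_ratio_ge_1:
  assumes "admissible_ratio n K k \<gamma>"
  shows "1 \<le> \<gamma>"
proof -
  obtain \<Omega> \<Phi> \<psi> \<alpha> \<beta> where tiling: "is_multilattice n \<Omega> \<Phi>" "tiling_bounds K \<Phi> \<psi> \<alpha> \<beta>" "\<gamma> = \<beta> / \<alpha>"
    and \<Phi>_Rn: "\<And>x. x \<in> \<Phi> \<Longrightarrow> x \<in> Rn n"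
    using assms interior_of_subset_topspace unfolding admissible_ratio_def associated_via_def Rn_interior_def
    by fastforce
  have pos: "0 < \<alpha>" "0 < \<beta>"
    using tiling(2) by (auto simp: tiling_bounds_def)
  obtain B X where "\<Omega> = {(\<Sum>b\<in>B. of_int (z b) *\<^sub>R b) | z :: rvec \<Rightarrow> int. True}"
    "X \<noteq> {}" "\<Phi> = (\<Union>x\<in>X. (+) x ` \<Omega>)"
    using tiling(1) unfolding is_multilattice_def is_lattice_def by blast
  then obtain x where x: "x \<in> \<Phi>"
    by auto
  obtain u where u: "u \<in> Rn n" "body_norm K u = 1"
    by (rule exists_body_norm_1)
  have "\<alpha> *\<^sub>R u + x \<in> (\<lambda>y. \<alpha> *\<^sub>R y + x) ` K"
    using u body_norm_le_1[OF u(1)] by auto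
  then have "\<alpha> *\<^sub>R u + x \<in> (\<lambda>y. \<beta> *\<^sub>R y + x) ` K"
    using tiling(2) x unfolding tiling_bounds_def by blast
  then have "body_norm K (\<alpha> *\<^sub>R u) \<le> \<beta>"
    using pos \<Phi>_Rn[OF x] by (simp add: mem_scaled_body)
  then show ?thesis
    using pos u tiling(3) by (simp add: body_norm_scaleR)
qed

lemma convex_tiling_body_norm:
  assumes \<Psi>: "is_polytope_tiling n \<Psi>" "associated_via n \<Phi> \<Psi> \<psi>" and bounds: "tiling_bounds K \<Phi> \<psi> \<alpha> \<beta>"
  shows "convex_tiling n (body_norm K) \<alpha> \<beta> \<Phi> \<psi>"
proof -
  have \<psi>: "bij_betw \<psi> \<Phi> \<Psi>"
    using \<Psi>(2) by (simp add: associated_via_def)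
  have \<Phi>_Rn: "\<Phi> \<subseteq> Rn n"
    using \<Psi>(2) interior_of_subset_topspace[of "top_of_set (Rn n)"]
    by (auto simp: associated_via_def Rn_interior_def)
  have pos: "0 < \<alpha>" "0 < \<beta>"
    using bounds by (auto simp: tiling_bounds_def)
  have tile: "\<psi> x \<in> \<Psi>" "polytope (\<psi> x)" if "x \<in> \<Phi>" for x
    using \<Psi>(1) \<psi> that by (auto simp: is_polytope_tiling_def bij_betw_def)
  show ?thesis
  proof
    show "Rn n \<subseteq> (\<Union>x\<in>\<Phi>. \<psi> x)"
      using \<Psi>(1) \<psi> by (simp add: is_polytope_tiling_def bij_betw_def)
    show "\<psi> x \<subseteq> Rn n" if "x \<in> \<Phi>" for x
      using \<Psi>(1) tile(1)[OF that] by (auto simp: is_polytope_tiling_def)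
    show "y \<in> \<psi> x" if "x \<in> \<Phi>" "y \<in> Rn n" "body_norm K (y - x) \<le> \<alpha>" for x y
      using that bounds mem_scaled_body[OF pos(1)] \<Phi>_Rn unfolding tiling_bounds_def by blast
    show "body_norm K (y - x) \<le> \<beta>" if "x \<in> \<Phi>" "y \<in> \<psi> x" for x y
      using that bounds mem_scaled_body[OF pos(2)] \<Phi>_Rn unfolding tiling_bounds_def by blast
    fix x x' z assume x: "x \<in> \<Phi>" "x' \<in> \<Phi>" and "z \<in> Rn_interior n (\<psi> x)" "z \<in> Rn_interior n (\<psi> x')"
    then have "\<psi> x = \<psi> x'"
      using \<Psi>(1) tile(1) unfolding is_polytope_tiling_def pairwise_def by blast
    then show "x = x'"
      using \<psi> x by (auto simp: bij_betw_def inj_on_def)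
  qed (use pos \<Phi>_Rn tile(2) polytope_imp_closed polytope_imp_convex in auto)
qed

lemma chromatic_number_le_tiling:
  fixes m G t J :: nat and \<tau> \<eta> \<gamma> l :: real
  assumes adm: "admissible_ratio n K k \<gamma>" and n: "n \<ge> 2" and \<eta>: "0 < \<eta>" "\<eta> < 1"
    and l: "3 * (1 + \<gamma>) * (real n ^ 2 * 3 ^ n) \<le> l"
    and G: "(80 * l * n) ^ n < exp ((6 / (5 * (1 + \<gamma>))) ^ n * (1 - 1 / n) * G)"
    and t: "t \<ge> 1" and \<tau>: "0 < \<tau>" "t * \<tau> < 1"
    and m: "(2 * l * n) ^ n * G * ((4 * \<gamma> / \<eta> + 1) ^ n) ^ t
      < exp (t * (1 - t * \<tau>) * (((1 - \<eta>) / (1 + \<gamma>)) ^ n * (1 - 1 / n)) * m)"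
    and J: "(4 * \<gamma> / \<eta> + 1) ^ n < exp (\<tau> * J)"
  shows "chromatic_number n K \<le> enat (m + G * (t * J))"
proof -
  obtain \<Phi> \<Psi> \<psi> \<alpha> \<beta> where tiling: "is_polytope_tiling n \<Psi>" "associated_via n \<Phi> \<Psi> \<psi>"
    "tiling_bounds K \<Phi> \<psi> \<alpha> \<beta>" "\<gamma> = \<beta> / \<alpha>"
    using adm unfolding admissible_ratio_def by auto
  obtain T where T: "linear T" "bij_betw T (Rn n) (Rn n)" "coord_norm n (\<lambda>y. body_norm K (T y)) (3 ^ n)"
    by (rule exists_normalised_coordinates)
  have "convex_tiling n (\<lambda>y. body_norm K (T y)) (1 * \<alpha>) (1 * \<beta>) {x \<in> Rn n. T x \<in> \<Phi>}
      (\<lambda>x. {y \<in> Rn n. T y \<in> \<psi> (T x)})"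
    by (rule convex_tiling_pullback[OF convex_tiling_body_norm[OF tiling(1-3)] T(1,2)]) simp_all
  then interpret normed_tiling n "\<lambda>y. body_norm K (T y)" "3 ^ n" \<alpha> \<beta> "{x \<in> Rn n. T x \<in> \<Phi>}"
      "\<lambda>x. {y \<in> Rn n. T y \<in> \<psi> (T x)}"
    using T(3) by (simp add: normed_tiling_def)
  have "\<beta> = \<gamma> * \<alpha>"
    using tiling(3,4) by (simp add: tiling_bounds_def)
  then have "colorable (m + G * (t * J))"
    by (rule colorable_tiling[OF _ admissible_ratio_ge_1[OF adm] n \<eta> l G t \<tau> m J])
  then show ?thesis
    by (rule chromatic_number_le_if_colorable[OF T])
qed

end

section \<open>The tiling by unit cubes\<close>

definition unit_cube :: "nat \<Rightarrow> rvec \<Rightarrow> rvec set" where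
  "unit_cube n x = {y \<in> Rn n. \<forall>i<n. \<bar>coord y i - coord x i\<bar> \<le> 1 / 2}"

definition int_lattice :: "nat \<Rightarrow> rvec set" where
  "int_lattice n = {x \<in> Rn n. \<forall>i<n. coord x i \<in> \<int>}"

lemma polytope_set_plus:
  assumes "polytope S" "polytope T"
  shows "polytope (S + T)"
proof -
  obtain V W where "finite V" "S = convex hull V" "finite W" "T = convex hull W"
    using assms by (auto simp: polytope_def)
  then have "finite (V + W)" "S + T = convex hull (V + W)"
    by (simp_all add: finite_set_plus convex_hull_set_plus)
  then show ?thesis
    unfolding polytope_def by blast
qed

lemma unit_cube_Suc:
  "unit_cube (Suc m) 0 = unit_cube m 0 + (\<lambda>c. c *\<^sub>R unit_vec m) ` cbox (- (1 / 2)) (1 / 2)"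
proof (intro set_eqI iffI)
  fix y assume y: "y \<in> unit_cube (Suc m) 0"
  let ?c = "coord y m"
  have "y - ?c *\<^sub>R unit_vec m \<in> unit_cube m 0"
    using y by (auto simp: unit_cube_def mem_Rn lookup_minus coord_unit_vec)
  moreover have "?c *\<^sub>R unit_vec m \<in> (\<lambda>c. c *\<^sub>R unit_vec m) ` cbox (- (1 / 2)) (1 / 2)"
    using y by (intro imageI) (auto simp: unit_cube_def abs_le_iff)
  ultimately have "(y - ?c *\<^sub>R unit_vec m) + ?c *\<^sub>R unit_vec m
      \<in> unit_cube m 0 + (\<lambda>c. c *\<^sub>R unit_vec m) ` cbox (- (1 / 2)) (1 / 2)"
    by (rule set_plus_intro)
  then show "y \<in> unit_cube m 0 + (\<lambda>c. c *\<^sub>R unit_vec m) ` cbox (- (1 / 2)) (1 / 2)"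
    by simp
next
  fix y assume "y \<in> unit_cube m 0 + (\<lambda>c. c *\<^sub>R unit_vec m) ` cbox (- (1 / 2)) (1 / 2)"
  then obtain x c where "x \<in> unit_cube m 0" "- (1 / 2) \<le> c" "c \<le> 1 / 2" "y = x + c *\<^sub>R unit_vec m"
    by (auto elim!: set_plus_elim)
  then show "y \<in> unit_cube (Suc m) 0"
    by (auto simp: unit_cube_def mem_Rn lookup_add coord_unit_vec less_Suc_eq)
qed

lemma polytope_unit_cube_0: "polytope (unit_cube m 0)"
proof (induction m)
  case 0
  have "unit_cube 0 0 = {0}"
    by (auto simp: unit_cube_def intro: Rn_eqI[of _ 0])
  then show ?case
    by (simp add: polytope_sing)
next
  case (Suc m)
  have "linear (\<lambda>c::real. c *\<^sub>R unit_vec m)"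
    by (intro linearI) (simp_all add: scaleR_add_left)
  then show ?case
    unfolding unit_cube_Suc by (intro polytope_set_plus Suc polytope_linear_image polytope_interval)
qed

lemma unit_cube_translate: "x \<in> Rn n \<Longrightarrow> unit_cube n x = (+) x ` unit_cube n 0"
proof (intro set_eqI iffI)
  fix y assume "x \<in> Rn n" "y \<in> unit_cube n x"
  then have "y - x \<in> unit_cube n 0"
    by (auto simp: unit_cube_def lookup_minus)
  then show "y \<in> (+) x ` unit_cube n 0"
    by (rule image_eqI[rotated]) simp
qed (auto simp: unit_cube_def lookup_add)

lemma polytope_unit_cube: "x \<in> Rn n \<Longrightarrow> polytope (unit_cube n x)"
  by (subst unit_cube_translate) (simp_all add: polytope_translation_eq polytope_unit_cube_0)

lemma unit_cube_interior:
  assumes x: "x \<in> Rn n"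
  shows "x \<in> Rn_interior n (unit_cube n x)"
proof -
  have "y \<in> unit_cube n x" if "y \<in> Rn n" "dist y x < 1 / 2" for y
  proof -
    have "\<bar>coord y i - coord x i\<bar> \<le> 1 / 2" for i
      using abs_coord_le_norm[of "y - x" i] that by (simp add: lookup_minus dist_norm)
    then show ?thesis
      using that by (simp add: unit_cube_def)
  qed
  then show ?thesis
    using x unfolding Rn_interior_iff by (intro conjI exI[of _ "1 / 2"]) auto
qed

lemma abs_diff_less_half_if_mem_interior:
  assumes z: "z \<in> Rn_interior n (unit_cube n x)" and i: "i < n"
  shows "\<bar>coord z i - coord x i\<bar> < 1 / 2"
proof -
  obtain e where e: "e > 0" "\<And>y. y \<in> Rn n \<Longrightarrow> dist y z < e \<Longrightarrow> y \<in> unit_cube n x" and zR: "z \<in> Rn n"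
    using z unfolding Rn_interior_iff by blast
  have "z + s *\<^sub>R unit_vec i \<in> unit_cube n x" if "\<bar>s\<bar> < e" for s
    using that zR unit_vec_Rn[OF i] norm_unit_vec[of i] by (intro e(2)) (simp_all add: dist_norm)
  then have "\<bar>coord z i + s - coord x i\<bar> \<le> 1 / 2" if "\<bar>s\<bar> < e" for s
    using that i by (force simp: unit_cube_def lookup_add coord_unit_vec)
  from this[of "e / 2"] this[of "- (e / 2)"] have "\<bar>coord z i + e / 2 - coord x i\<bar> \<le> 1 / 2"
    "\<bar>coord z i - e / 2 - coord x i\<bar> \<le> 1 / 2"
    using e(1) by simp_all
  then show ?thesis
    using e(1) by linarith
qed

lemma unit_cube_interiors_disjoint:
  assumes x: "x \<in> int_lattice n" "x' \<in> int_lattice n"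
    and z: "z \<in> Rn_interior n (unit_cube n x)" "z \<in> Rn_interior n (unit_cube n x')"
  shows "x = x'"
proof (rule Rn_eqI[of _ n])
  fix i assume i: "i < n"
  have "coord x i \<in> \<int>" "coord x' i \<in> \<int>"
    using x i by (auto simp: int_lattice_def)
  then obtain y y' :: int where y: "coord x i = of_int y" "coord x' i = of_int y'"
    by (elim Ints_cases)
  have "\<bar>coord x i - coord x' i\<bar> < 1"
    using abs_diff_less_half_if_mem_interior[OF z(1) i] abs_diff_less_half_if_mem_interior[OF z(2) i]
    by linarith
  then have "y = y'"
    unfolding y by linarith
  then show "coord x i = coord x' i"
    by (simp add: y)
qed (use x in \<open>auto simp: int_lattice_def\<close>)

lemma inj_unit_vec: "inj unit_vec"
proof (rule injI)
  fix i j assume "unit_vec i = unit_vec j"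
  then have "coord (unit_vec i) j = coord (unit_vec j) j"
    by simp
  then show "i = j"
    by (simp add: coord_unit_vec split: if_splits)
qed

lemma sum_unit_vecs: "(\<Sum>b\<in>unit_vec ` {..<n}. f b *\<^sub>R b) = of_coords n (\<lambda>i. f (unit_vec i))"
  by (simp add: sum.reindex[OF inj_on_subset[OF inj_unit_vec]] of_coords_def)

lemma independent_unit_vecs: "independent (unit_vec ` {..<n})"
proof (rule real_vector.independent_if_scalars_zero)
  fix f x assume "(\<Sum>x\<in>unit_vec ` {..<n}. f x *\<^sub>R x) = 0" and "x \<in> unit_vec ` {..<n}"
  then obtain i where i: "i < n" "x = unit_vec i" and "of_coords n (\<lambda>i. f (unit_vec i)) = 0"
    unfolding sum_unit_vecs by auto
  then have "coord (of_coords n (\<lambda>i. f (unit_vec i))) i = 0"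
    by simp
  then show "f x = 0"
    using i by (simp add: coord_of_coords)
qed simp

lemma span_unit_vecs: "span (unit_vec ` {..<n}) = Rn n"
proof
  show "span (unit_vec ` {..<n}) \<subseteq> Rn n"
    by (intro span_minimal subspace_Rn) (auto intro: unit_vec_Rn)
  show "Rn n \<subseteq> span (unit_vec ` {..<n})"
  proof
    fix x assume "x \<in> Rn n"
    then have "x = (\<Sum>i<n. coord x i *\<^sub>R unit_vec i)"
      using of_coords_coord[of x n] by (simp add: of_coords_def)
    also have "\<dots> \<in> span (unit_vec ` {..<n})"
      by (intro span_sum span_scale span_base) auto
    finally show "x \<in> span (unit_vec ` {..<n})" .
  qed
qed

lemma int_lattice_eq:
  "int_lattice n = {(\<Sum>b\<in>unit_vec ` {..<n}. of_int (z b) *\<^sub>R b) | z :: rvec \<Rightarrow> int. True}"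
  unfolding sum_unit_vecs
proof (intro set_eqI iffI)
  fix x assume x: "x \<in> int_lattice n"
  define z where "z b = \<lfloor>coord x (inv unit_vec b)\<rfloor>" for b
  have "of_coords n (\<lambda>i. of_int (z (unit_vec i))) = x"
    using x by (intro Rn_eqI[of _ n])
      (auto simp: int_lattice_def coord_of_coords z_def inv_f_f[OF inj_unit_vec])
  then show "x \<in> {of_coords n (\<lambda>i. of_int (z (unit_vec i))) | z :: rvec \<Rightarrow> int. True}"
    by blast
qed (auto simp: int_lattice_def coord_of_coords)

lemma is_multilattice_int_lattice: "is_multilattice n (int_lattice n) (int_lattice n)"
proof -
  have "is_lattice n (int_lattice n)"
    unfolding is_lattice_def
    using independent_unit_vecs span_unit_vecs int_lattice_eq by (intro exI[of _ "unit_vec ` {..<n}"]) simp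
  moreover have "int_lattice n = (\<Union>x\<in>{0}. (+) x ` int_lattice n)"
    by simp
  ultimately show ?thesis
    unfolding is_multilattice_def by (intro conjI exI[of _ "{0}"]) auto
qed

lemma num_translates_int_lattice: "num_translates (int_lattice n) (int_lattice n) = 1"
proof -
  have "(+) x ` int_lattice n = int_lattice n" if x: "x \<in> int_lattice n" for x
  proof (intro set_eqI iffI)
    fix y assume "y \<in> int_lattice n"
    then have "y - x \<in> int_lattice n"
      using x by (auto simp: int_lattice_def lookup_minus)
    then show "y \<in> (+) x ` int_lattice n"
      by (rule image_eqI[rotated]) simp
  qed (use x in \<open>auto simp: int_lattice_def lookup_add\<close>)
  moreover have "0 \<in> int_lattice n"
    by (simp add: int_lattice_def)
  ultimately have "(\<lambda>x. (+) x ` int_lattice n) ` int_lattice n = {int_lattice n}"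
    by auto
  then show ?thesis
    by (simp add: num_translates_def)
qed

lemma is_polytope_tiling_unit_cubes: "is_polytope_tiling n (unit_cube n ` int_lattice n)"
  unfolding is_polytope_tiling_def
proof (intro conjI ballI)
  fix P assume "P \<in> unit_cube n ` int_lattice n"
  then obtain x where "x \<in> Rn n" "P = unit_cube n x"
    by (auto simp: int_lattice_def)
  then show "polytope P" "Rn_interior n P \<noteq> {}"
    using polytope_unit_cube unit_cube_interior by blast+
next
  show "\<Union> (unit_cube n ` int_lattice n) = Rn n"
  proof (intro set_eqI iffI)
    fix y assume y: "y \<in> Rn n"
    let ?x = "of_coords n (\<lambda>i. of_int (round (coord y i)))"
    have "?x \<in> int_lattice n"
      by (simp add: int_lattice_def coord_of_coords)
    moreover have "y \<in> unit_cube n ?x"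
      using y of_int_round_abs_le by (auto simp: unit_cube_def coord_of_coords abs_minus_commute)
    ultimately show "y \<in> \<Union> (unit_cube n ` int_lattice n)"
      by blast
  qed (auto simp: unit_cube_def)
  show "pairwise (\<lambda>P Q. Rn_interior n P \<inter> Rn_interior n Q = {}) (unit_cube n ` int_lattice n)"
    unfolding pairwise_def using unit_cube_interiors_disjoint by blast
qed

lemma associated_via_unit_cube:
  "associated_via n (int_lattice n) (unit_cube n ` int_lattice n) (unit_cube n)"
proof -
  have interior: "x \<in> Rn_interior n (unit_cube n x)" if "x \<in> int_lattice n" for x
    using that unit_cube_interior by (auto simp: int_lattice_def)
  then have "inj_on (unit_cube n) (int_lattice n)"
    by (intro inj_onI) (metis unit_cube_interiors_disjoint)
  with interior show ?thesis
    by (auto simp: associated_via_def bij_betw_def)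
qed

context sym_body
begin

lemma unit_cube_inner:
  assumes B: "B > 0" "\<And>y. y \<in> K \<Longrightarrow> norm y \<le> B" and x: "x \<in> Rn n"
  shows "(\<lambda>y. (1 / (2 * B)) *\<^sub>R y + x) ` K \<subseteq> unit_cube n x"
proof
  fix y assume "y \<in> (\<lambda>y. (1 / (2 * B)) *\<^sub>R y + x) ` K"
  then obtain u where u: "u \<in> K" "y = (1 / (2 * B)) *\<^sub>R u + x"
    by blast
  have "\<bar>coord u i\<bar> / (2 * B) \<le> 1 / 2" for i
    using order_trans[OF abs_coord_le_norm B(2)[OF u(1)], of i] B(1) by (simp add: divide_le_eq)
  moreover have "u \<in> Rn n"
    using u(1) K_Rn by blast
  ultimately show "y \<in> unit_cube n x"
    using x B(1) by (simp add: u(2) unit_cube_def lookup_add abs_mult)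
qed

lemma unit_cube_outer:
  assumes r: "r > 0" "\<And>y. y \<in> Rn n \<Longrightarrow> norm y \<le> r \<Longrightarrow> y \<in> K" and x: "x \<in> Rn n"
  shows "unit_cube n x \<subseteq> (\<lambda>y. (n / (2 * r)) *\<^sub>R y + x) ` K"
proof
  fix y assume y: "y \<in> unit_cube n x"
  define \<beta> where "\<beta> = n / (2 * r)"
  have \<beta>: "0 < \<beta>"
    using r(1) n_pos by (simp add: \<beta>_def)
  have yx: "y - x \<in> Rn n"
    using x y by (simp add: unit_cube_def)
  have "norm (y - x) = (\<Sum>i<n. \<bar>coord (y - x) i\<bar>)"
    by (rule norm_Rn[OF yx])
  also have "\<dots> \<le> (\<Sum>i<n. 1 / 2)"
    using y by (intro sum_mono) (auto simp: unit_cube_def lookup_minus)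
  also have "\<dots> = r * \<beta>"
    using r(1) by (simp add: \<beta>_def)
  finally have "norm ((1 / \<beta>) *\<^sub>R (y - x)) \<le> r"
    using \<beta> by (simp add: pos_divide_le_eq)
  then have "(1 / \<beta>) *\<^sub>R (y - x) \<in> K"
    using yx by (intro r(2)) auto
  moreover have "y = \<beta> *\<^sub>R ((1 / \<beta>) *\<^sub>R (y - x)) + x"
    using \<beta> by simp
  ultimately show "y \<in> (\<lambda>y. (n / (2 * r)) *\<^sub>R y + x) ` K"
    unfolding \<beta>_def by blast
qed

lemma exists_unit_cube_bounds: "\<exists>\<alpha> \<beta>. tiling_bounds K (int_lattice n) (unit_cube n) \<alpha> \<beta>"
proof -
  obtain B where B: "B > 0" "\<And>y. y \<in> K \<Longrightarrow> norm y \<le> B"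
    using K_bounded by (auto simp: bounded_pos)
  obtain r where r: "r > 0" "\<And>y. y \<in> Rn n \<Longrightarrow> norm y \<le> r \<Longrightarrow> y \<in> K"
    using K_inner_ball by blast
  have "0 < 1 / (2 * B)" "0 < n / (2 * r)"
    using B(1) r(1) n_pos by simp_all
  then have "tiling_bounds K (int_lattice n) (unit_cube n) (1 / (2 * B)) (n / (2 * r))"
    using unit_cube_inner[OF B] unit_cube_outer[OF r] by (simp add: tiling_bounds_def int_lattice_def)
  then show ?thesis
    by blast
qed

lemma exists_admissible_ratio:
  assumes "k \<ge> 1"
  shows "\<exists>\<gamma>. admissible_ratio n K k \<gamma>"
  using exists_unit_cube_bounds is_multilattice_int_lattice num_translates_int_lattice
    is_polytope_tiling_unit_cubes associated_via_unit_cube assms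
  unfolding admissible_ratio_def by metis

lemma min_tiling_parameter_eq_tiling_gamma:
  assumes "k \<ge> 1"
  shows "min_tiling_parameter n K k = ereal (tiling_gamma n K k)" "1 \<le> tiling_gamma n K k"
proof -
  obtain \<gamma> where "admissible_ratio n K k \<gamma>"
    using exists_admissible_ratio[OF assms] by blast
  then have upper: "min_tiling_parameter n K k \<le> ereal \<gamma>"
    unfolding min_tiling_parameter_eq by (intro INF_lower) simp
  have lower: "1 \<le> min_tiling_parameter n K k"
    unfolding min_tiling_parameter_eq
    by (intro INF_greatest) (simp add: admissible_ratio_ge_1 one_ereal_def)
  have "\<bar>min_tiling_parameter n K k\<bar> \<noteq> \<infinity>"
    using upper lower by auto
  then show eq: "min_tiling_parameter n K k = ereal (tiling_gamma n K k)"
    by (simp add: tiling_gamma_def ereal_real')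
  show "1 \<le> tiling_gamma n K k"
    using lower unfolding eq by (simp add: one_ereal_def)
qed

lemma exists_admissible_ratio_near_tiling_gamma:
  assumes k: "k \<ge> 1" and e: "e > 0"
  shows "\<exists>\<gamma>. admissible_ratio n K k \<gamma> \<and> tiling_gamma n K k \<le> \<gamma> \<and> \<gamma> < tiling_gamma n K k + e"
proof -
  have INF: "(INF \<gamma>\<in>Collect (admissible_ratio n K k). ereal \<gamma>) = ereal (tiling_gamma n K k)"
    using min_tiling_parameter_eq_tiling_gamma(1)[OF k] by (simp only: min_tiling_parameter_eq)
  then have "(INF \<gamma>\<in>Collect (admissible_ratio n K k). ereal \<gamma>) < ereal (tiling_gamma n K k + e)"
    using e by simp
  then obtain \<gamma> where \<gamma>: "admissible_ratio n K k \<gamma>" "\<gamma> < tiling_gamma n K k + e"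
    unfolding INF_less_iff by auto
  have "ereal (tiling_gamma n K k) \<le> ereal \<gamma>"
    unfolding INF[symmetric] using \<gamma>(1) by (intro INF_lower) simp
  with \<gamma> show ?thesis
    by auto
qed

end

section \<open>Choice of the parameters\<close>

definition period :: "nat \<Rightarrow> real" where
  "period n = 27 * real n ^ 2 * 3 ^ n"

definition density_loss :: "nat \<Rightarrow> real" where
  "density_loss n = 1 / ((1 - 1 / (real n * ln (real n))) ^ n * (1 - 1 / real n) ^ 2)"

definition chromatic_bound :: "nat \<Rightarrow> real \<Rightarrow> real" where
  "chromatic_bound n \<gamma> = (1 + \<gamma>) ^ n *
     (real n * ln (real n) + real n * ln (ln (real n)) + 2 * real n * (1 + ln (2 * \<gamma>)))"

locale large_dimension =
  fixes n :: nat
  assumes n_ge_2: "2 \<le> real n" and ln_n_ge_1: "1 \<le> ln (real n)"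
    and ln_box_net: "real n * ln (80 * period n * real n) < real n ^ 3"
    and ln_centres: "real n * ln (2 * period n * real n) + ln (3 * real n ^ 3) + real n * ln 8 \<le> real n ^ 3"
    and ln_ball_net: "ln (32 * real n * ln (real n) + 1) \<le> real n"
    and excess: "(density_loss n - 1) * (real n * ln (real n) + real n * ln (ln (real n)) + 4 * real n)
      + 3 * density_loss n + 1 + 9 * real n ^ 12 * (5 / 6) ^ n \<le> 2 * real n"

lemma eventually_large_dimension: "eventually large_dimension sequentially"
proof -
  have "eventually (\<lambda>n::nat. 2 \<le> real n) sequentially"
    "eventually (\<lambda>n::nat. 1 \<le> ln (real n)) sequentially"
    "eventually (\<lambda>n::nat. real n * ln (80 * (27 * real n ^ 2 * 3 ^ n) * real n) < real n ^ 3) sequentially"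
    "eventually (\<lambda>n::nat. real n * ln (2 * (27 * real n ^ 2 * 3 ^ n) * real n) + ln (3 * real n ^ 3)
      + real n * ln 8 \<le> real n ^ 3) sequentially"
    "eventually (\<lambda>n::nat. ln (32 * real n * ln (real n) + 1) \<le> real n) sequentially"
    "eventually (\<lambda>n::nat. (1 / ((1 - 1 / (real n * ln (real n))) ^ n * (1 - 1 / real n) ^ 2) - 1)
        * (real n * ln (real n) + real n * ln (ln (real n)) + 4 * real n)
      + 3 * (1 / ((1 - 1 / (real n * ln (real n))) ^ n * (1 - 1 / real n) ^ 2))
      + 1 + 9 * real n ^ 12 * (5 / 6) ^ n \<le> 2 * real n) sequentially"
    by real_asymp+
  then show ?thesis
    by eventually_elim (simp add: large_dimension_def period_def density_loss_def)
qed

lemma nat_ceiling_bounds: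
  fixes x :: real
  assumes "0 \<le> x"
  shows "x \<le> nat \<lceil>x\<rceil>" "nat \<lceil>x\<rceil> \<le> x + 1"
  using assms by linarith+

lemma power_eq_exp_ln:
  fixes x :: real
  assumes "0 < x"
  shows "x ^ n = exp (n * ln x)"
  using assms by (simp add: exp_of_nat_mult)

locale tiling_parameters = large_dimension +
  fixes \<gamma> :: real
  assumes \<gamma>: "1 \<le> \<gamma>" "\<gamma> \<le> 8"
begin

definition slack :: real where "slack = 1 / (real n * ln (real n))"
definition threshold :: real where "threshold = 1 / real n ^ 4"
definition coarse_factor :: real where "coarse_factor = 6 / (5 * (1 + \<gamma>))"
definition net_base :: real where "net_base = 4 * \<gamma> / slack + 1"
definition subset_size :: nat where "subset_size = n ^ 3"
definition num_families :: nat where "num_families = nat \<lceil>2 * real n ^ 3 * (1 / coarse_factor) ^ n\<rceil>"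
definition num_residual :: nat where "num_residual = nat \<lceil>real n ^ 4 * (n * ln net_base + 1)\<rceil>"
definition num_main :: nat where "num_main = nat \<lceil>(1 + \<gamma>) ^ n * (density_loss n * (n * ln net_base + 2))\<rceil>"

lemma n_pos: "0 < real n"
  using n_ge_2 by simp

lemma n_ln_n_ge_2: "2 \<le> real n * ln (real n)"
  using mult_mono[of 2 "real n" 1 "ln (real n)"] n_ge_2 ln_n_ge_1 by simp

lemma slack_bounds: "0 < slack" "slack \<le> 1 / 2"
  using n_ln_n_ge_2 by (auto simp: slack_def divide_simps)

lemma inverse_n_bounds: "1 / 2 \<le> 1 - 1 / real n" "1 - 1 / real n < 1"
  using n_ge_2 by (auto simp: field_simps)

lemma coarse_factor_bounds:
  "0 < coarse_factor" "1 / coarse_factor = 5 / 6 * (1 + \<gamma>)"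
  "1 \<le> 1 / coarse_factor" "1 / coarse_factor \<le> 8"
  using \<gamma> by (auto simp: coarse_factor_def)

lemma net_base_eq: "net_base = 4 * \<gamma> * (real n * ln (real n)) + 1"
  using n_ln_n_ge_2 by (simp add: net_base_def slack_def)

lemma n_le_4_\<gamma>_n_ln_n: "real n \<le> 4 * \<gamma> * (real n * ln (real n))"
proof -
  have "real n * 1 \<le> real n * ln (real n)"
    using ln_n_ge_1 by (intro mult_left_mono) auto
  also have "\<dots> = 1 * (real n * ln (real n))"
    by simp
  also have "\<dots> \<le> 4 * \<gamma> * (real n * ln (real n))"
    using \<gamma>(1) n_ln_n_ge_2 by (intro mult_right_mono) auto
  finally show ?thesis
    by simp
qed

lemma net_base_ge_1: "1 \<le> net_base"
  unfolding net_base_eq using n_le_4_\<gamma>_n_ln_n n_ge_2 by linarith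

lemma ln_net_base_nonneg: "0 \<le> ln net_base"
  using net_base_ge_1 by simp

lemma ln_net_base_le: "ln net_base \<le> n"
proof -
  have "4 * \<gamma> * (real n * ln (real n)) \<le> 32 * (real n * ln (real n))"
    using \<gamma> n_ln_n_ge_2 by (intro mult_right_mono) auto
  then have "ln net_base \<le> ln (32 * real n * ln (real n) + 1)"
    using net_base_ge_1 by (simp add: net_base_eq)
  then show ?thesis
    using ln_ball_net by linarith
qed

lemma period_ge: "3 * (1 + \<gamma>) * (real n ^ 2 * 3 ^ n) \<le> period n"
proof -
  have "3 * (1 + \<gamma>) * (real n ^ 2 * 3 ^ n) \<le> 27 * (real n ^ 2 * 3 ^ n)"
    using \<gamma>(2) by (intro mult_right_mono) auto
  then show ?thesis
    by (simp add: period_def)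
qed

lemma real_subset_size: "real subset_size = real n ^ 3"
  by (simp add: subset_size_def)

lemma subset_size_ge_1: "1 \<le> subset_size"
  using n_pos by (simp add: subset_size_def)

lemma threshold_pos: "0 < threshold"
  using n_pos by (simp add: threshold_def)

lemma subset_size_threshold: "subset_size * threshold = 1 / n"
  using n_pos by (simp add: real_subset_size threshold_def power_eq_if field_simps)

lemma subset_size_threshold_less_1: "subset_size * threshold < 1"
  unfolding subset_size_threshold using n_ge_2 by simp

lemma num_families_lower: "2 * real n ^ 3 * (1 / coarse_factor) ^ n \<le> num_families"
  unfolding num_families_def using coarse_factor_bounds(1) by (intro nat_ceiling_bounds(1)) simp

lemma num_families_upper: "num_families \<le> 3 * real n ^ 3 * (1 / coarse_factor) ^ n"
proof -
  have "num_families \<le> 2 * real n ^ 3 * (1 / coarse_factor) ^ n + 1"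
    unfolding num_families_def using coarse_factor_bounds(1) by (intro nat_ceiling_bounds(2)) simp
  moreover have "1 * 1 \<le> real n ^ 3 * (1 / coarse_factor) ^ n"
    using n_ge_2 coarse_factor_bounds(3) by (intro mult_mono one_le_power) auto
  ultimately show ?thesis
    by linarith
qed

lemma num_families_suffices:
  "(80 * period n * n) ^ n < exp (coarse_factor ^ n * (1 - 1 / n) * num_families)"
proof -
  have "(80 * period n * n) ^ n = exp (n * ln (80 * period n * n))"
    using n_pos by (intro power_eq_exp_ln) (simp add: period_def)
  also have "\<dots> < exp (real n ^ 3)"
    using ln_box_net by simp
  also have "real n ^ 3 \<le> coarse_factor ^ n * (1 - 1 / n) * num_families"
  proof -
    have "coarse_factor ^ n * (1 / coarse_factor) ^ n = 1"
      using coarse_factor_bounds(1) by (simp add: power_mult_distrib[symmetric])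
    then have "real n ^ 3 = coarse_factor ^ n * (1 / 2) * (2 * real n ^ 3 * (1 / coarse_factor) ^ n)"
      by (simp add: mult_ac)
    also have "\<dots> \<le> coarse_factor ^ n * (1 - 1 / n) * num_families"
      using inverse_n_bounds(1) coarse_factor_bounds(1) num_families_lower by (intro mult_mono) auto
    finally show ?thesis .
  qed
  finally show ?thesis
    by simp
qed

lemma num_residual_suffices: "net_base ^ n < exp (threshold * num_residual)"
proof -
  have "n * ln net_base + 1 = threshold * (real n ^ 4 * (n * ln net_base + 1))"
    using n_pos by (simp add: threshold_def)
  also have "\<dots> \<le> threshold * num_residual"
    unfolding num_residual_def using ln_net_base_nonneg threshold_pos
    by (intro mult_left_mono nat_ceiling_bounds(1)) auto
  finally have "n * ln net_base < threshold * num_residual"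
    by simp
  then show ?thesis
    using net_base_ge_1 by (simp add: power_eq_exp_ln)
qed

lemma num_residual_upper: "num_residual \<le> 3 * real n ^ 6"
proof -
  have "num_residual \<le> real n ^ 4 * (n * ln net_base + 1) + 1"
    unfolding num_residual_def using ln_net_base_nonneg by (intro nat_ceiling_bounds(2)) simp
  also have "\<dots> \<le> real n ^ 4 * (real n ^ 2 + 1) + 1"
    using mult_left_mono[OF ln_net_base_le, of n]
    by (intro add_right_mono mult_left_mono) (auto simp: power2_eq_square)
  also have "\<dots> = real n ^ 6 + real n ^ 4 + 1"
    by (simp add: distrib_left power_add[symmetric])
  also have "\<dots> \<le> real n ^ 6 + real n ^ 6 + real n ^ 6"
    using n_ge_2 by (intro add_mono order_refl power_increasing one_le_power) auto
  finally show ?thesis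
    by simp
qed

lemma density_loss_ge_1: "1 \<le> density_loss n"
proof -
  have "(1 - slack) ^ n * (1 - 1 / real n) ^ 2 \<le> 1 * 1"
    using slack_bounds inverse_n_bounds by (intro mult_mono power_le_one) auto
  moreover have "0 < (1 - slack) ^ n * (1 - 1 / real n) ^ 2"
    using slack_bounds inverse_n_bounds by simp
  ultimately show ?thesis
    by (simp add: density_loss_def slack_def)
qed

lemma num_main_bounds:
  "(1 + \<gamma>) ^ n * (density_loss n * (n * ln net_base + 2)) \<le> num_main"
  "num_main \<le> (1 + \<gamma>) ^ n * (density_loss n * (n * ln net_base + 2)) + 1"
proof -
  have "0 \<le> (1 + \<gamma>) ^ n * (density_loss n * (n * ln net_base + 2))"
    using \<gamma>(1) density_loss_ge_1 ln_net_base_nonneg by simp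
  then show "(1 + \<gamma>) ^ n * (density_loss n * (n * ln net_base + 2)) \<le> num_main"
    "num_main \<le> (1 + \<gamma>) ^ n * (density_loss n * (n * ln net_base + 2)) + 1"
    unfolding num_main_def by (rule nat_ceiling_bounds)+
qed

lemma weakly_correlated_sets_less:
  "(2 * period n * n) ^ n * num_families * (net_base ^ n) ^ subset_size
    < exp (subset_size * (n * ln net_base + 2))"
proof -
  have "(1 / coarse_factor) ^ n \<le> 8 ^ n"
    using coarse_factor_bounds(1,4) by (intro power_mono) auto
  then have "3 * real n ^ 3 * (1 / coarse_factor) ^ n \<le> exp (ln (3 * real n ^ 3)) * exp (n * ln 8)"
    using n_pos by (simp add: power_eq_exp_ln[of 8 n, symmetric])
  then have num_families_le: "num_families \<le> exp (ln (3 * real n ^ 3) + n * ln 8)"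
    using num_families_upper by (simp add: exp_add)
  have "(2 * period n * n) ^ n = exp (n * ln (2 * period n * n))"
    using n_pos by (intro power_eq_exp_ln) (simp add: period_def)
  moreover have "(net_base ^ n) ^ subset_size = exp (subset_size * (n * ln net_base))"
    using net_base_ge_1 by (simp add: power_eq_exp_ln exp_of_nat_mult[symmetric])
  ultimately have "(2 * period n * n) ^ n * num_families * (net_base ^ n) ^ subset_size
      \<le> exp (n * ln (2 * period n * n)) * exp (ln (3 * real n ^ 3) + n * ln 8)
        * exp (subset_size * (n * ln net_base))"
    using num_families_le by (intro mult_mono) auto
  also have "\<dots> = exp (n * ln (2 * period n * n) + ln (3 * real n ^ 3) + n * ln 8
      + subset_size * (n * ln net_base))"
    by (simp only: exp_add mult_ac)
  also have "\<dots> \<le> exp (subset_size * (n * ln net_base + 1))"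
    using ln_centres by (simp add: real_subset_size algebra_simps)
  also have "\<dots> < exp (subset_size * (n * ln net_base + 2))"
    using subset_size_ge_1 by simp
  finally show ?thesis .
qed

lemma num_main_suffices:
  "(2 * period n * n) ^ n * num_families * (net_base ^ n) ^ subset_size
    < exp (subset_size * (1 - subset_size * threshold)
        * (((1 - slack) / (1 + \<gamma>)) ^ n * (1 - 1 / n)) * num_main)" (is "_ < exp ?exponent")
proof -
  define c where "c = (1 - slack) ^ n * (1 - 1 / real n) ^ 2"
  have c: "0 < c" "density_loss n = 1 / c"
    using slack_bounds inverse_n_bounds by (simp_all add: c_def density_loss_def slack_def)
  have \<gamma>_pow: "0 < (1 + \<gamma>) ^ n"
    using \<gamma>(1) by simp
  have "n * ln net_base + 2 = c / (1 + \<gamma>) ^ n * ((1 + \<gamma>) ^ n * (density_loss n * (n * ln net_base + 2)))"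
    using c \<gamma>(1) by simp
  also have "\<dots> \<le> c / (1 + \<gamma>) ^ n * num_main"
    using num_main_bounds(1) c(1) \<gamma>_pow by (intro mult_left_mono) auto
  finally have "subset_size * (n * ln net_base + 2) \<le> subset_size * (c / (1 + \<gamma>) ^ n * num_main)"
    by (intro mult_left_mono) auto
  also have "\<dots> = ?exponent"
    by (simp add: subset_size_threshold c_def power_divide power2_eq_square)
  finally have "exp (subset_size * (n * ln net_base + 2)) \<le> exp ?exponent"
    by simp
  with weakly_correlated_sets_less show ?thesis
    by (rule less_le_trans)
qed

lemma n_ln_net_base_le:
  "n * ln net_base \<le> real n * ln (real n) + real n * ln (ln (real n)) + n * ln (4 * \<gamma>) + 1"
proof -
  define x where "x = 4 * \<gamma> * (real n * ln (real n))"
  have x: "real n \<le> x" "0 < x"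
    unfolding x_def using n_le_4_\<gamma>_n_ln_n n_pos by linarith+
  have "net_base = x * (1 + 1 / x)"
    using x(2) by (simp add: net_base_eq x_def[symmetric] distrib_left)
  then have "ln net_base = ln x + ln (1 + 1 / x)"
    using x(2) by (simp add: ln_mult_pos add_pos_pos)
  also have "\<dots> \<le> ln x + 1 / x"
    using x(2) ln_add_one_self_le_self[of "1 / x"] by simp
  also have "ln x = ln (4 * \<gamma>) + (ln (real n) + ln (ln (real n)))"
    using \<gamma> n_ge_2 ln_n_ge_1 by (simp add: x_def ln_mult_pos)
  finally have "n * ln net_base \<le> n * (ln (4 * \<gamma>) + (ln (real n) + ln (ln (real n))) + 1 / x)"
    by (intro mult_left_mono) auto
  moreover have "n * (1 / x) \<le> 1"
    using x by (simp add: divide_le_eq)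
  ultimately show ?thesis
    by (simp add: distrib_left)
qed

lemma residual_colours_le:
  "num_families * (real subset_size * num_residual) \<le> (1 + \<gamma>) ^ n * (9 * real n ^ 12 * (5 / 6) ^ n)"
proof -
  have "num_families * (real subset_size * num_residual)
      \<le> (3 * real n ^ 3 * (1 / coarse_factor) ^ n) * (real n ^ 3 * (3 * real n ^ 6))"
    using num_families_upper num_residual_upper coarse_factor_bounds(1)
    by (intro mult_mono) (auto simp: real_subset_size)
  also have "\<dots> = 9 * real n ^ 12 * (1 / coarse_factor) ^ n"
    by (simp add: power_add[symmetric] mult_ac)
  also have "(1 / coarse_factor) ^ n = (5 / 6) ^ n * (1 + \<gamma>) ^ n"
    unfolding coarse_factor_bounds(2) by (rule power_mult_distrib)
  finally show ?thesis
    by (simp only: mult_ac)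
qed

lemma ln_4_\<gamma>: "ln (4 * \<gamma>) \<le> 4" "ln (4 * \<gamma>) \<le> 2 * ln (2 * \<gamma>)"
proof -
  have "ln (4 * \<gamma>) \<le> ln (2 ^ 5)"
    using \<gamma> by simp
  also have "\<dots> = 5 * ln 2"
    by (simp only: ln_realpow)
  also have "\<dots> \<le> 4"
    using ln2_le_25_over_36 by simp
  finally show "ln (4 * \<gamma>) \<le> 4" .
  have "ln (4 * \<gamma>) = ln 2 + ln (2 * \<gamma>)"
    using \<gamma>(1) ln_mult_pos[of 2 "2 * \<gamma>"] by simp
  also have "\<dots> \<le> 2 * ln (2 * \<gamma>)"
    using \<gamma>(1) by simp
  finally show "ln (4 * \<gamma>) \<le> 2 * ln (2 * \<gamma>)" .
qed

lemma density_loss_mult_le: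
  "density_loss n * (n * ln net_base + 2) + 1 + 9 * real n ^ 12 * (5 / 6) ^ n
    \<le> real n * ln (real n) + real n * ln (ln (real n)) + 2 * real n * (1 + ln (2 * \<gamma>))"
proof -
  define W where "W = real n * ln (real n) + real n * ln (ln (real n))"
  define V where "V = W + n * ln (4 * \<gamma>)"
  have "V \<le> W + 4 * real n"
    using mult_left_mono[OF ln_4_\<gamma>(1), of n] by (simp add: V_def)
  then have "(density_loss n - 1) * V \<le> (density_loss n - 1) * (W + 4 * real n)"
    using density_loss_ge_1 by (intro mult_left_mono) auto
  moreover have "density_loss n * (n * ln net_base + 2) \<le> density_loss n * (V + 3)"
    using n_ln_net_base_le density_loss_ge_1 by (intro mult_left_mono) (auto simp: V_def W_def)
  moreover have "density_loss n * (V + 3) = V + (density_loss n - 1) * V + 3 * density_loss n"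
    by (simp add: algebra_simps)
  moreover have "(density_loss n - 1) * (W + 4 * real n) + 3 * density_loss n + 1
      + 9 * real n ^ 12 * (5 / 6) ^ n
      \<le> 2 * real n"
    using excess by (simp only: W_def)
  moreover have "V \<le> W + n * (2 * ln (2 * \<gamma>))"
    using mult_left_mono[OF ln_4_\<gamma>(2), of n] by (simp add: V_def)
  moreover have "2 * real n * (1 + ln (2 * \<gamma>)) = 2 * real n + n * (2 * ln (2 * \<gamma>))"
    by (simp add: algebra_simps)
  ultimately show ?thesis
    unfolding W_def by linarith
qed

lemma colours_le_chromatic_bound:
  "num_main + num_families * (subset_size * num_residual) \<le> chromatic_bound n \<gamma>"
proof -
  let ?extra = "9 * real n ^ 12 * (5 / 6) ^ n"
  have \<gamma>_pow: "1 \<le> (1 + \<gamma>) ^ n"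
    using \<gamma>(1) by (intro one_le_power) simp
  have "num_main + num_families * (real subset_size * num_residual)
      \<le> (1 + \<gamma>) ^ n * (density_loss n * (n * ln net_base + 2)) + 1 + (1 + \<gamma>) ^ n * ?extra"
    using num_main_bounds(2) residual_colours_le by linarith
  also have "\<dots> \<le> (1 + \<gamma>) ^ n * (density_loss n * (n * ln net_base + 2) + 1 + ?extra)"
    using \<gamma>_pow by (simp add: distrib_left)
  also have "\<dots> \<le> chromatic_bound n \<gamma>"
    unfolding chromatic_bound_def using density_loss_mult_le \<gamma>_pow by (intro mult_left_mono) auto
  finally show ?thesis
    by simp
qed

end

section \<open>The bounds for the chromatic number\<close>

lemma eventually_chromatic_bound_le:
  "\<forall>\<^sub>F n in sequentially. \<forall>\<gamma>\<in>{1..8}. chromatic_bound n \<gamma> \<le> (1 + \<gamma>) ^ n * real n ^ 2"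
proof -
  have "\<forall>\<^sub>F n in sequentially.
      real n * ln (real n) + real n * ln (ln (real n)) + 2 * real n * (1 + ln 16) \<le> real n ^ 2"
    by real_asymp
  then show ?thesis
  proof eventually_elim
    case (elim n)
    show ?case
    proof
      fix \<gamma> :: real assume \<gamma>: "\<gamma> \<in> {1..8}"
      then have "2 * real n * (1 + ln (2 * \<gamma>)) \<le> 2 * real n * (1 + ln 16)"
        by (intro mult_left_mono) auto
      with elim \<gamma> show "chromatic_bound n \<gamma> \<le> (1 + \<gamma>) ^ n * real n ^ 2"
        unfolding chromatic_bound_def by (intro mult_left_mono) auto
    qed
  qed
qed

text \<open>\<open>n ^ (2 / n) = 1 + o(1)\<close> absorbs the factor \<open>n\<^sup>2\<close> into the base of the power.\<close>

definition base_excess :: "nat \<Rightarrow> real" where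
  "base_excess n = 9 * (real n powr (2 / real n) - 1)"

lemma base_excess_tendsto_0: "base_excess \<longlonglongrightarrow> 0"
  unfolding base_excess_def by real_asymp

context sym_body
begin

lemma chromatic_number_le_if_admissible_ratio:
  assumes large: "large_dimension n" and adm: "admissible_ratio n K k \<gamma>" and \<gamma>: "\<gamma> \<le> 8"
  shows "\<exists>M::nat. chromatic_number n K \<le> enat M \<and> M \<le> chromatic_bound n \<gamma>"
proof -
  interpret tiling_parameters n \<gamma>
    using large admissible_ratio_ge_1[OF adm] \<gamma>
    by (simp add: tiling_parameters_def tiling_parameters_axioms_def)
  have "2 \<le> n" "slack < 1"
    using n_ge_2 slack_bounds(2) by simp_all
  then have "chromatic_number n K \<le> enat (num_main + num_families * (subset_size * num_residual))"
    using chromatic_number_le_tiling[OF adm _ slack_bounds(1) _ period_ge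
        num_families_suffices[unfolded coarse_factor_def] subset_size_ge_1 threshold_pos
        subset_size_threshold_less_1 num_main_suffices[unfolded net_base_def]
        num_residual_suffices[unfolded net_base_def]]
    by blast
  then show ?thesis
    using colours_le_chromatic_bound by blast
qed

lemma chromatic_number_le_chromatic_bound_if_less_8:
  assumes large: "large_dimension n" and k: "k \<ge> 1" and less: "tiling_gamma n K k < 8"
  shows "ereal_of_enat (chromatic_number n K) \<le> ereal (chromatic_bound n (tiling_gamma n K k))"
proof -
  let ?\<gamma> = "tiling_gamma n K k"
  obtain M where M: "chromatic_number n K = enat M"
    using chromatic_number_le_9_pow by (cases "chromatic_number n K") auto
  have "M \<le> chromatic_bound n ?\<gamma>"
  proof (rule ccontr)
    assume "\<not> ?thesis"
    moreover have "isCont (chromatic_bound n) ?\<gamma>"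
      unfolding chromatic_bound_def using min_tiling_parameter_eq_tiling_gamma(2)[OF k]
      by (intro continuous_intros) auto
    ultimately have "\<forall>\<^sub>F \<gamma> in at ?\<gamma>. chromatic_bound n \<gamma> < M"
      unfolding isCont_def by (intro order_tendstoD) auto
    then obtain d where d: "0 < d" "\<And>\<gamma>. \<bar>\<gamma> - ?\<gamma>\<bar> < d \<Longrightarrow> \<gamma> \<noteq> ?\<gamma> \<Longrightarrow> chromatic_bound n \<gamma> < M"
      unfolding eventually_at dist_real_def by blast
    obtain \<gamma> where \<gamma>: "admissible_ratio n K k \<gamma>" "?\<gamma> \<le> \<gamma>" "\<gamma> < ?\<gamma> + min d (8 - ?\<gamma>)"
      using exists_admissible_ratio_near_tiling_gamma[OF k, of "min d (8 - ?\<gamma>)"] d(1) less by auto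
    then have "\<gamma> \<le> 8"
      by linarith
    then have "M \<le> chromatic_bound n \<gamma>"
      using chromatic_number_le_if_admissible_ratio[OF large \<gamma>(1)] M by auto
    moreover have "\<bar>\<gamma> - ?\<gamma>\<bar> < d"
      using \<gamma>(2,3) by auto
    ultimately show False
      using d(2)[of \<gamma>] \<open>\<not> M \<le> chromatic_bound n ?\<gamma>\<close> by (cases "\<gamma> = ?\<gamma>") auto
  qed
  then show ?thesis
    by (simp add: M)
qed

lemma chromatic_number_le_9_pow_ereal: "ereal_of_enat (chromatic_number n K) \<le> ereal (9 ^ n)"
proof -
  have "ereal_of_enat (chromatic_number n K) \<le> ereal_of_enat (enat (9 ^ n))"
    using chromatic_number_le_9_pow by (simp only: ereal_of_enat_le_iff)
  then show ?thesis
    by simp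
qed

theorem chromatic_number_le_chromatic_bound:
  assumes large: "large_dimension n" and k: "k \<ge> 1"
  shows "ereal_of_enat (chromatic_number n K) \<le> ereal (chromatic_bound n (tiling_gamma n K k))"
proof (cases "tiling_gamma n K k < 8")
  case True
  then show ?thesis
    by (rule chromatic_number_le_chromatic_bound_if_less_8[OF large k])
next
  case False
  interpret large_dimension n
    by (rule large)
  let ?\<gamma> = "tiling_gamma n K k"
  have "1 * 1 \<le> 2 * real n * (1 + ln (2 * ?\<gamma>))"
    using n_ge_2 False by (intro mult_mono) auto
  moreover have "0 \<le> real n * ln (real n)" "0 \<le> real n * ln (ln (real n))"
    using ln_n_ge_1 by auto
  ultimately have "1 \<le> real n * ln (real n) + real n * ln (ln (real n)) + 2 * real n * (1 + ln (2 * ?\<gamma>))"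
    by linarith
  then have "9 ^ n * 1 \<le> chromatic_bound n ?\<gamma>"
    unfolding chromatic_bound_def using False by (intro mult_mono power_mono) auto
  then show ?thesis
    using chromatic_number_le_9_pow_ereal order_trans by fastforce
qed

theorem chromatic_number_le_power:
  assumes large: "large_dimension n" and bound: "\<forall>\<gamma>\<in>{1..8}. chromatic_bound n \<gamma> \<le> (1 + \<gamma>) ^ n * real n ^ 2"
    and k: "k \<ge> 1"
  shows "ereal_of_enat (chromatic_number n K) \<le> ereal ((1 + tiling_gamma n K k + base_excess n) ^ n)"
proof -
  let ?\<gamma> = "tiling_gamma n K k" and ?r = "real n powr (2 / real n)"
  have \<gamma>: "1 \<le> ?\<gamma>"
    by (rule min_tiling_parameter_eq_tiling_gamma(2)[OF k])
  have r: "1 \<le> ?r"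
    using n_pos by (simp add: ge_one_powr_ge_zero)
  show ?thesis
  proof (cases "?\<gamma> \<le> 8")
    case False
    then have "(9::real) ^ n \<le> (1 + ?\<gamma> + base_excess n) ^ n"
      using r by (intro power_mono) (auto simp: base_excess_def)
    then show ?thesis
      using chromatic_number_le_9_pow_ereal order_trans by fastforce
  next
    case True
    have "?r ^ n = ?r powr real n"
      using n_pos by (simp add: powr_realpow)
    also have "\<dots> = real n ^ 2"
      using n_pos by (simp add: powr_powr powr_numeral)
    finally have r_pow: "?r ^ n = real n ^ 2" .
    have "chromatic_bound n ?\<gamma> \<le> (1 + ?\<gamma>) ^ n * real n ^ 2"
      using bound \<gamma> True by simp
    also have "\<dots> = ((1 + ?\<gamma>) * ?r) ^ n"
      by (simp add: power_mult_distrib r_pow)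
    also have "\<dots> \<le> (1 + ?\<gamma> + base_excess n) ^ n"
    proof (rule power_mono)
      have "(1 + ?\<gamma>) * (?r - 1) \<le> 9 * (?r - 1)"
        using r True by (intro mult_right_mono) auto
      then show "(1 + ?\<gamma>) * ?r \<le> 1 + ?\<gamma> + base_excess n"
        by (simp add: base_excess_def right_diff_distrib)
    qed (use \<gamma> r in simp)
    finally have "chromatic_bound n ?\<gamma> \<le> (1 + ?\<gamma> + base_excess n) ^ n" .
    then show ?thesis
      using chromatic_number_le_chromatic_bound[OF large k] order_trans by fastforce
  qed
qed

end

lemma chromatic_number_le_with_ln_k:
  assumes large: "large_dimension n" and body: "symmetric_convex_body n K" and k: "k \<ge> 1"
  shows "ereal_of_enat (chromatic_number n K) \<le> ereal ((1 + tiling_gamma n K k) ^ n *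
    (real n * ln (real n) + real n * ln (ln (real n)) + 2 * ln (real k)
      + 2 * real n * (1 + ln (2 * tiling_gamma n K k))))"
proof -
  interpret sym_body n K
    using large_dimension.n_ge_2[OF large] body by unfold_locales simp_all
  have "chromatic_bound n (tiling_gamma n K k) \<le> (1 + tiling_gamma n K k) ^ n *
    (real n * ln (real n) + real n * ln (ln (real n)) + 2 * ln (real k)
      + 2 * real n * (1 + ln (2 * tiling_gamma n K k)))"
    unfolding chromatic_bound_def using min_tiling_parameter_eq_tiling_gamma(2)[OF k] k
    by (intro mult_left_mono) auto
  then show ?thesis
    using chromatic_number_le_chromatic_bound[OF large k] order_trans by fastforce
qed

theorem theorem1:
  shows "(\<exists>N::nat. \<forall>n\<ge>N. \<forall>(K::rvec set) (k::nat).
            symmetric_convex_body n K \<and> k \<ge> 1 \<longrightarrow>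
            ereal_of_enat (chromatic_number n K) \<le>
              ereal ((1 + tiling_gamma n K k) ^ n *
                (real n * ln (real n) + real n * ln (ln (real n)) + 2 * ln (real k)
                  + 2 * real n * (1 + ln (2 * tiling_gamma n K k)))))
       \<and> (\<forall>(K :: nat \<Rightarrow> rvec set) (k :: nat \<Rightarrow> nat) (c::real).
            (\<forall>n\<ge>1. symmetric_convex_body n (K n) \<and> k n \<ge> 1 \<and>
                    real (k n) \<le> real n powr (c * real n)) \<longrightarrow>
            (\<exists>\<epsilon> :: nat \<Rightarrow> real. \<epsilon> \<longlonglongrightarrow> 0 \<and>
               (\<forall>\<^sub>F n in sequentially.
                  ereal_of_enat (chromatic_number n (K n)) \<le>
                    ereal ((1 + tiling_gamma n (K n) (k n) + \<epsilon> n) ^ n))))"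
proof (intro conjI allI impI)
  obtain N where N: "\<And>n. n \<ge> N \<Longrightarrow> large_dimension n"
    using eventually_large_dimension unfolding eventually_sequentially by blast
  show "\<exists>N. \<forall>n\<ge>N. \<forall>K k. symmetric_convex_body n K \<and> k \<ge> 1 \<longrightarrow>
      ereal_of_enat (chromatic_number n K) \<le> ereal ((1 + tiling_gamma n K k) ^ n *
        (real n * ln (real n) + real n * ln (ln (real n)) + 2 * ln (real k)
          + 2 * real n * (1 + ln (2 * tiling_gamma n K k))))"
    using N chromatic_number_le_with_ln_k by blast
next
  fix K :: "nat \<Rightarrow> rvec set" and k :: "nat \<Rightarrow> nat" and c :: real
  assume bodies: "\<forall>n\<ge>1. symmetric_convex_body n (K n) \<and> k n \<ge> 1 \<and> real (k n) \<le> real n powr (c * real n)"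
  have "\<forall>\<^sub>F n in sequentially. ereal_of_enat (chromatic_number n (K n))
      \<le> ereal ((1 + tiling_gamma n (K n) (k n) + base_excess n) ^ n)"
    using eventually_large_dimension eventually_chromatic_bound_le eventually_ge_at_top[of 1]
    by eventually_elim (use bodies in \<open>auto intro!: sym_body.chromatic_number_le_power simp: sym_body_def\<close>)
  with base_excess_tendsto_0 show "\<exists>\<epsilon>. \<epsilon> \<longlonglongrightarrow> 0 \<and> (\<forall>\<^sub>F n in sequentially.
      ereal_of_enat (chromatic_number n (K n)) \<le> ereal ((1 + tiling_gamma n (K n) (k n) + \<epsilon> n) ^ n))"
    by blast
qed

end
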